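(* Let $k:\mathbb{R}^d\times\mathbb{R}^d\to\mathbb{R}$ be given by $k(\mathbf{x},\mathbf{y})=\psi(\mathbf{x}-\mathbf{y})$, where $\psi:\mathbb{R}^d\to\mathbb{R}$ is bounded, continuous and positive definite with $\psi(0)=1$, and let $\Lambda$ be the associated Borel probability measure on $\mathbb{R}^d$. Let $m\ge 1$ and let $\hat k$ be the random Fourier feature approximation of $k$ built from $(\boldsymbol{\omega}_i)_{i=1}^m$ drawn i.i.d. from $\Lambda$. Then for any $1<r<\infty$, $\tau>0$ and any non-empty compact set $S\subset\mathbb{R}^d$, $$\Lambda^m\left(\left\{(\boldsymbol{\omega}_i)_{i=1}^m:\ \|\hat k-k\|_{L^r(S)}\ \ge\ \left(\frac{\pi^{d/2}|S|^d}{2^d\,\Gamma(\frac d2+1)}\right)^{2/r}\left(\frac{C'_r}{m^{1-\max\{\frac12,\frac1r\}}}+\frac{\sqrt{2\tau}}{\sqrt m}\right)\right\}\right)\le e^{-\tau},$$ where $C'_r$ is the Khintchine constant given by $C'_r=1$ for $r\in(1,2]$ and $C'_r=\sqrt2\left[\Gamma\left(\frac{r+1}{2}\right)/\sqrt\pi\right]^{1/r}$ for $r\in[2,\infty)$, and $$\|\hat k-k\|_{L^r(S)}:=\left(\int_S\int_S|\hat k(\mathbf{x},\mathbf{y})-k(\mathbf{x},\mathbf{y})|^r\,d\mathbf{x}\,d\mathbf{y}\right)^{1/r}.$$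
   Context: Here $d\ge 1$ and $\Gamma$ is the Gamma function. By Bochner's theorem, a bounded continuous positive definite $\psi:\mathbb{R}^d\to\mathbb{R}$ with $\psi(0)=1$ is the Fourier transform of a unique Borel probability measure $\Lambda$ on $\mathbb{R}^d$: $\psi(\mathbf{z})=\int e^{\sqrt{-1}\,\boldsymbol{\omega}^T\mathbf{z}}\,d\Lambda(\boldsymbol{\omega})=\int\cos(\boldsymbol{\omega}^T\mathbf{z})\,d\Lambda(\boldsymbol{\omega})$. Given $\boldsymbol{\omega}_1,\dots,\boldsymbol{\omega}_m\in\mathbb{R}^d$, the random Fourier feature approximation is $\hat k(\mathbf{x},\mathbf{y})=\frac1m\sum_{i=1}^m\cos(\boldsymbol{\omega}_i^T(\mathbf{x}-\mathbf{y}))$. $\Lambda^m$ is the $m$-fold product measure and $|S|=\sup\{\|\mathbf{x}-\mathbf{y}\|_2:\mathbf{x},\mathbf{y}\in S\}$ is the Euclidean diameter. Integrals over $S$ are with respect to Lebesgue measure.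
   Formalization: The set S is additionally required to have positive diameter, i.e. not to be a single point; for a singleton both the norm and the threshold are 0, so the event has probability 1 and the claim as stated is false. *)

theory Defs
  imports "HOL-Probability.Probability"
begin

text \<open>
  Complex coefficients are used: with real coefficients only, the condition would not
  see the odd part of \<open>\<psi>\<close>, and Bochner's theorem would fail.
\<close>

definition positive_definite_fun :: "('a::real_vector \<Rightarrow> real) \<Rightarrow> bool" where
  "positive_definite_fun \<psi> \<longleftrightarrow>
     (\<forall>(n::nat) (x :: nat \<Rightarrow> 'a) (c :: nat \<Rightarrow> complex).
        (\<Sum>i<n. \<Sum>j<n. c i * cnj (c j) * complex_of_real (\<psi> (x i - x j))) \<in> \<real> \<and>
        0 \<le> Re (\<Sum>i<n. \<Sum>j<n. c i * cnj (c j) * complex_of_real (\<psi> (x i - x j))))"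

definition is_fourier_transform_of ::
    "('a::euclidean_space \<Rightarrow> real) \<Rightarrow> 'a measure \<Rightarrow> bool" where
  "is_fourier_transform_of \<psi> \<Lambda> \<longleftrightarrow>
     (\<forall>z. complex_of_real (\<psi> z) = (\<integral>\<omega>. exp (\<i> * complex_of_real (\<omega> \<bullet> z)) \<partial>\<Lambda>))"

definition rff_kernel ::
    "nat \<Rightarrow> (nat \<Rightarrow> 'a::real_inner) \<Rightarrow> 'a \<Rightarrow> 'a \<Rightarrow> real" where
  "rff_kernel m w x y = (1 / real m) * (\<Sum>i = 1..m. cos (w i \<bullet> (x - y)))"

definition Lr_norm ::
    "real \<Rightarrow> 'a::euclidean_space set \<Rightarrow> ('a \<Rightarrow> 'a \<Rightarrow> real) \<Rightarrow> real" where
  "Lr_norm r S f = (LINT y:S|lborel. (LINT x:S|lborel. \<bar>f x y\<bar> powr r)) powr (1 / r)"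

text \<open>At \<open>r = 2\<close> both formulas give \<open>1\<close>.\<close>

definition khintchine_const :: "real \<Rightarrow> real" where
  "khintchine_const r =
     (if r \<le> 2 then 1 else sqrt 2 * (Gamma ((r + 1) / 2) / sqrt pi) powr (1 / r))"

end

theory Submission
  imports Defs
begin

text \<open>
  Changing one frequency changes the error function by at most \<open>2 / m\<close> everywhere, so its norm on
  \<open>S \<times> S\<close> obeys the bounded differences inequality with constants \<open>2 V / m\<close>, where \<open>V\<close> is the
  volume of \<open>S\<close> to the power \<open>2 / r\<close>; the fluctuation above the mean then has exactly the claimed
  probability, and \<open>V\<close> is bounded by the isodiametric inequality. For the mean, Jensen and Fubini
  reduce to a single pair of points, i.e. to the \<open>r\<close>-th absolute moment of a sum of \<open>m\<close> centred
  independent variables with values in \<open>[-1, 1]\<close> around their mean. Symmetrization would lose a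
  factor of 2 here. Instead, convexity reduces to (biased) signs, and for these the moment is
  compared directly with that of a normal variable of variance \<open>m\<close>: for \<open>r \<le> 2\<close> by the variance,
  and for \<open>r > 2\<close> by writing \<open>\<bar>x\<bar> powr r\<close> as an integral over \<open>t > 0\<close> of \<open>k (t * x) * t powr (- r - 1)\<close>.
  The kernel is \<open>cos x - 1 + x\<^sup>2 / 2\<close> for \<open>2 < r < 4\<close>, \<open>x ^ 4 / 24 - x\<^sup>2 / 2 + 1 - cos x\<close> for
  \<open>4 < r \<le> 5\<close>, and the positive part of \<open>\<bar>x\<bar> - 1\<close> to the power 5 for \<open>r > 5\<close>. In the last case
  the signs can be replaced by normal variables one at a time.
\<close>

section \<open>Steiner symmetrization and the isodiametric inequality\<close>

text \<open>The constant leaves no room in the moment bound: for r > 2,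
  \<open>khintchine_const r powr r\<close> is the absolute moment of order r of a standard normal
  variable, and by the central limit theorem unbiased signs approach it as m grows. So sums of signs
  must be compared with the normal variable sharply, for every bias at once. Taylor remainders of
  the cosine turn this into a comparison of characteristic functions; the subtracted polynomial ties
  each kernel to a range of r. For 2 < r < 4 the second moments agree for unbiased signs, and near t
  = pi the power of \<open>\<bar>cos t\<bar>\<close> exceeds the Gaussian, so only integrals over t
  can be compared. For r > 4 the fourth moment of the signs is smaller, which pays for a comparison
  at every t. Truncated powers need no characteristic functions, but for skewed signs the comparison
  fails with cubes and holds with fifth powers, hence r > 5 there. For r < 2 the claim has the rate
  \<open>m powr (- (1 - 1 / r))\<close>; what is proved is the better rate
  \<open>m powr (- 1 / 2)\<close>.\<close>

lemma nn_integral_lborel_slices: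
  fixes f :: "'a::euclidean_space \<Rightarrow> ennreal"
  assumes b: "b \<in> Basis" and [measurable]: "f \<in> borel_measurable borel"
  shows "(\<integral>\<^sup>+x. f x \<partial>lborel) =
    (\<integral>\<^sup>+y. (\<integral>\<^sup>+t. f ((\<Sum>j\<in>Basis - {b}. y j *\<^sub>R j) + t *\<^sub>R b) \<partial>lborel) \<partial>(\<Pi>\<^sub>M j\<in>Basis - {b}. lborel))"
proof -
  interpret product_sigma_finite "\<lambda>_::'a. lborel :: real measure" ..
  have B: "insert b (Basis - {b}) = (Basis :: 'a set)" using b by auto
  have [measurable]: "(\<lambda>y. \<Sum>j\<in>Basis. y j *\<^sub>R j) \<in> (\<Pi>\<^sub>M j\<in>Basis. lborel) \<rightarrow>\<^sub>M (borel :: 'a measure)"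
    by measurable
  have "(\<integral>\<^sup>+x. f x \<partial>lborel) = (\<integral>\<^sup>+y. f (\<Sum>j\<in>Basis. y j *\<^sub>R j) \<partial>(\<Pi>\<^sub>M j\<in>Basis. lborel))"
    by (subst lborel_eq) (simp add: nn_integral_distr)
  also have "\<dots> = (\<integral>\<^sup>+y. (\<integral>\<^sup>+t. f (\<Sum>j\<in>Basis. (y(b := t)) j *\<^sub>R j) \<partial>lborel) \<partial>(\<Pi>\<^sub>M j\<in>Basis - {b}. lborel))"
    using product_nn_integral_insert[of "Basis - {b}" b "\<lambda>y. f (\<Sum>j\<in>Basis. y j *\<^sub>R j)"] unfolding B
    by simp
  also have "(\<lambda>y t. \<Sum>j\<in>Basis. (y(b := t)) j *\<^sub>R j) = (\<lambda>y t. (\<Sum>j\<in>Basis - {b}. y j *\<^sub>R j) + t *\<^sub>R b)"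
  proof (intro ext)
    fix y :: "'a \<Rightarrow> real" and t :: real
    have "(\<Sum>j\<in>Basis. (y(b := t)) j *\<^sub>R j) = t *\<^sub>R b + (\<Sum>j\<in>Basis - {b}. (y(b := t)) j *\<^sub>R j)"
      using b by (subst sum.remove[of _ b]) auto
    also have "(\<Sum>j\<in>Basis - {b}. (y(b := t)) j *\<^sub>R j) = (\<Sum>j\<in>Basis - {b}. y j *\<^sub>R j)"
      by (intro sum.cong) auto
    finally show "(\<Sum>j\<in>Basis. (y(b := t)) j *\<^sub>R j) = (\<Sum>j\<in>Basis - {b}. y j *\<^sub>R j) + t *\<^sub>R b"
      by simp
  qed
  finally show ?thesis by metis
qed

text \<open>Parametrizing the line through \<open>x\<close> by its coordinate \<open>t\<close> along
  \<open>b\<close> makes the value the same at all points of that line. Extended reals allow slices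
  of infinite length.\<close>

definition slice_length :: "'a::euclidean_space \<Rightarrow> 'a set \<Rightarrow> 'a \<Rightarrow> ennreal" where
  "slice_length b A x = emeasure lborel {t. x + (t - x \<bullet> b) *\<^sub>R b \<in> A}"

text \<open>Each slice becomes the open centred interval of its length. The strict inequality
  removes null slices, so every point of the result comes from a slice of positive measure, as
  \<open>slice_gap\<close> requires.\<close>

definition steiner :: "'a::euclidean_space \<Rightarrow> 'a set \<Rightarrow> 'a set" where
  "steiner b A = {x. ennreal (2 * \<bar>x \<bullet> b\<bar>) < slice_length b A x}"

definition hyperplane_reflection :: "'a::real_inner \<Rightarrow> 'a \<Rightarrow> 'a" where
  "hyperplane_reflection b x = x - (2 * (x \<bullet> b)) *\<^sub>R b"

lemma measurable_slice_length [measurable]: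
  assumes [measurable]: "A \<in> sets borel"
  shows "slice_length b A \<in> borel_measurable borel"
proof -
  have "(\<lambda>x. emeasure lborel (Pair x -` {z \<in> space (borel \<Otimes>\<^sub>M lborel). fst z + (snd z - fst z \<bullet> b) *\<^sub>R b \<in> A})) \<in> borel_measurable borel"
    by (rule lborel.measurable_emeasure_Pair) measurable
  also have "(\<lambda>x. emeasure lborel (Pair x -` {z \<in> space (borel \<Otimes>\<^sub>M lborel). fst z + (snd z - fst z \<bullet> b) *\<^sub>R b \<in> A})) = slice_length b A"
    by (simp add: slice_length_def fun_eq_iff vimage_def space_pair_measure)
  finally show ?thesis .
qed

lemma sets_steiner [measurable]:
  assumes [measurable]: "A \<in> sets borel"
  shows "steiner b A \<in> sets borel"
  unfolding steiner_def by measurable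

lemma emeasure_centred_interval: "emeasure lborel {t. ennreal (2 * \<bar>t\<bar>) < L} = L"
proof (cases L)
  case (real l)
  have "{t. ennreal (2 * \<bar>t\<bar>) < L} = {- l / 2 <..< l / 2}"
    using real by (auto simp: ennreal_less_iff)
  then show ?thesis using real by simp
next
  case top
  then show ?thesis by (simp add: ennreal_less_top)
qed

lemma slice_length_parallel:
  assumes "b \<in> Basis"
  shows "slice_length b A (x + s *\<^sub>R b) = slice_length b A x"
proof -
  have "x + s *\<^sub>R b + (t - (x + s *\<^sub>R b) \<bullet> b) *\<^sub>R b = x + (t - x \<bullet> b) *\<^sub>R b" for t
    using assms by (simp add: inner_simps algebra_simps)
  then show ?thesis by (simp only: slice_length_def)
qed

text \<open>Cavalieri: on every line parallel to \<open>b\<close> the two sets have the same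
  one-dimensional measure; \<open>p y\<close> runs through the hyperplane orthogonal to
  \<open>b\<close>.\<close>

lemma emeasure_steiner:
  assumes b: "b \<in> Basis" and [measurable]: "A \<in> sets borel"
  shows "emeasure lborel (steiner b A) = emeasure lborel A"
proof -
  define p where "p y = (\<Sum>j\<in>Basis - {b}. y j *\<^sub>R j)" for y :: "'a \<Rightarrow> real"
  have pb: "p y \<bullet> b = 0" for y
    using b by (auto simp: p_def inner_sum_left inner_Basis intro!: sum.neutral)
  have bb: "b \<bullet> b = 1" using b by simp
  have m[measurable]: "{t. p y + t *\<^sub>R b \<in> A} \<in> sets borel" for y
    by measurable
  have 1: "(\<integral>\<^sup>+t. indicator A (p y + t *\<^sub>R b) \<partial>lborel) = slice_length b A (p y)" for y
  proof -
    have "(\<integral>\<^sup>+t. indicator A (p y + t *\<^sub>R b) \<partial>lborel) = (\<integral>\<^sup>+t. indicator {t. p y + t *\<^sub>R b \<in> A} t \<partial>lborel)"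
      by (rule nn_integral_cong) (auto simp: indicator_def)
    then show ?thesis by (simp add: slice_length_def pb)
  qed
  have 2: "(\<integral>\<^sup>+t. indicator (steiner b A) (p y + t *\<^sub>R b) \<partial>lborel) = slice_length b A (p y)" for y
  proof -
    have "(\<integral>\<^sup>+t. indicator (steiner b A) (p y + t *\<^sub>R b) \<partial>lborel) =
        (\<integral>\<^sup>+t. indicator {t. ennreal (2 * \<bar>t\<bar>) < slice_length b A (p y)} t \<partial>lborel)"
      by (rule nn_integral_cong)
        (auto simp: indicator_def steiner_def slice_length_parallel[OF b] inner_simps pb bb)
    then show ?thesis by (simp add: emeasure_centred_interval)
  qed
  have "emeasure lborel (steiner b A) = (\<integral>\<^sup>+x. indicator (steiner b A) x \<partial>lborel)" by simp
  also have "\<dots> = (\<integral>\<^sup>+x. indicator A x \<partial>lborel)"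
    unfolding nn_integral_lborel_slices[OF b borel_measurable_indicator[OF sets_steiner[OF assms(2)]]]
      nn_integral_lborel_slices[OF b borel_measurable_indicator[OF assms(2)]] p_def[symmetric] 1 2 ..
  finally show ?thesis by simp
qed

text \<open>\<open>Sup P - Inf Q\<close> and \<open>Sup Q - Inf P\<close> add up to the lengths of
  the two hulls, which exceed \<open>2 * \<bar>s\<bar>\<close> and \<open>2 * \<bar>t\<bar>\<close>;
  so they cannot both be at most \<open>\<bar>s\<bar> + \<bar>t\<bar>\<close>.\<close>

lemma slice_gap:
  fixes P Q :: "real set"
  assumes P: "ennreal (2 * \<bar>s\<bar>) < emeasure lborel P" and Q: "ennreal (2 * \<bar>t\<bar>) < emeasure lborel Q"
  shows "\<exists>u\<in>P. \<exists>v\<in>Q. \<bar>s\<bar> + \<bar>t\<bar> \<le> \<bar>u - v\<bar>"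
proof (rule ccontr)
  assume "\<not> ?thesis"
  then have c: "\<And>u v. u \<in> P \<Longrightarrow> v \<in> Q \<Longrightarrow> \<bar>u - v\<bar> \<le> \<bar>s\<bar> + \<bar>t\<bar>" by force
  obtain u0 v0 where uv: "u0 \<in> P" "v0 \<in> Q"
    using P Q by fastforce
  have bP: "bdd_above P" "bdd_below P" and bQ: "bdd_above Q" "bdd_below Q"
    using c[OF _ uv(2)] c[OF uv(1)]
    by (auto simp: abs_le_iff algebra_simps
        intro!: bdd_aboveI[of P "v0 + (\<bar>s\<bar> + \<bar>t\<bar>)"] bdd_belowI[of P "v0 - (\<bar>s\<bar> + \<bar>t\<bar>)"]
          bdd_aboveI[of Q "u0 + (\<bar>s\<bar> + \<bar>t\<bar>)"] bdd_belowI[of Q "u0 - (\<bar>s\<bar> + \<bar>t\<bar>)"])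
  have m: "emeasure lborel X \<le> ennreal (Sup X - Inf X)" if X: "X \<noteq> {}" "bdd_above X" "bdd_below X" for X :: "real set"
  proof -
    have "emeasure lborel X \<le> emeasure lborel {Inf X..Sup X}"
      using X by (intro emeasure_mono) (auto intro: cInf_lower cSup_upper)
    also have "\<dots> = ennreal (Sup X - Inf X)" using X cInf_le_cSup[of X] by simp
    finally show ?thesis .
  qed
  have 1: "ennreal (2 * \<bar>s\<bar>) < ennreal (Sup P - Inf P)" "ennreal (2 * \<bar>t\<bar>) < ennreal (Sup Q - Inf Q)"
    using P Q m[of P] m[of Q] bP bQ uv by (auto intro: less_le_trans)
  then have 2: "2 * \<bar>s\<bar> < Sup P - Inf P" "2 * \<bar>t\<bar> < Sup Q - Inf Q"
    by (simp_all add: ennreal_less_iff)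
  have "Sup P \<le> Inf Q + (\<bar>s\<bar> + \<bar>t\<bar>)"
  proof (rule cSup_least)
    fix u assume u: "u \<in> P"
    have "u - (\<bar>s\<bar> + \<bar>t\<bar>) \<le> Inf Q"
      using uv c[OF u] by (intro cInf_greatest) (auto simp: abs_le_iff algebra_simps)
    then show "u \<le> Inf Q + (\<bar>s\<bar> + \<bar>t\<bar>)" by simp
  qed (use uv in auto)
  moreover have "Sup Q \<le> Inf P + (\<bar>s\<bar> + \<bar>t\<bar>)"
  proof (rule cSup_least)
    fix v assume v: "v \<in> Q"
    have "v - (\<bar>s\<bar> + \<bar>t\<bar>) \<le> Inf P"
    proof (rule cInf_greatest)
      show "v - (\<bar>s\<bar> + \<bar>t\<bar>) \<le> u" if "u \<in> P" for u using c[OF that v] by (simp add: abs_le_iff)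
    qed (use uv in auto)
    then show "v \<le> Inf P + (\<bar>s\<bar> + \<bar>t\<bar>)" by simp
  qed (use uv in auto)
  ultimately show False using 2 by simp
qed

text \<open>The part \<open>z\<close> of \<open>x - y\<close> orthogonal to \<open>b\<close> is the
  same for all points on the two lines, and by \<open>slice_gap\<close> these lines contain points
  of \<open>A\<close> that are at least as far apart along \<open>b\<close>.\<close>

lemma steiner_dist_le:
  fixes A :: "'a::euclidean_space set"
  assumes b: "b \<in> Basis" and D: "\<And>x y. x \<in> A \<Longrightarrow> y \<in> A \<Longrightarrow> dist x y \<le> D"
    and x: "x \<in> steiner b A" and y: "y \<in> steiner b A"
  shows "dist x y \<le> D"
proof -
  have bb: "b \<bullet> b = 1" using b by simp
  obtain u v where u: "x + (u - x \<bullet> b) *\<^sub>R b \<in> A" and v: "y + (v - y \<bullet> b) *\<^sub>R b \<in> A"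
    and uv: "\<bar>x \<bullet> b\<bar> + \<bar>y \<bullet> b\<bar> \<le> \<bar>u - v\<bar>"
    using slice_gap[OF x[unfolded steiner_def slice_length_def mem_Collect_eq]
        y[unfolded steiner_def slice_length_def mem_Collect_eq]] by blast
  define z where "z = (x - y) - ((x - y) \<bullet> b) *\<^sub>R b"
  have zb: "z \<bullet> b = 0" by (simp add: z_def inner_simps bb)
  have n: "(norm (z + c *\<^sub>R b))\<^sup>2 = (norm z)\<^sup>2 + c\<^sup>2" for c
    unfolding power2_norm_eq_inner by (simp add: inner_simps zb bb inner_commute[of b z] power2_eq_square)
  have "\<bar>(x - y) \<bullet> b\<bar> \<le> \<bar>u - v\<bar>" using uv by (simp add: inner_diff_left)
  then have "((x - y) \<bullet> b)\<^sup>2 \<le> (u - v)\<^sup>2" by (rule abs_le_square_iff[THEN iffD1])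
  then have "(norm (z + ((x - y) \<bullet> b) *\<^sub>R b))\<^sup>2 \<le> (norm (z + (u - v) *\<^sub>R b))\<^sup>2"
    unfolding n by simp
  then have "norm (z + ((x - y) \<bullet> b) *\<^sub>R b) \<le> norm (z + (u - v) *\<^sub>R b)"
    by (rule power2_le_imp_le) simp
  moreover have "z + ((x - y) \<bullet> b) *\<^sub>R b = x - y" by (simp add: z_def)
  moreover have "z + (u - v) *\<^sub>R b = (x + (u - x \<bullet> b) *\<^sub>R b) - (y + (v - y \<bullet> b) *\<^sub>R b)"
    by (simp add: z_def inner_simps algebra_simps)
  ultimately show ?thesis using D[OF u v] by (simp add: dist_norm)
qed

lemma steiner_reflection_self:
  assumes b: "b \<in> Basis" and x: "x \<in> steiner b A"
  shows "hyperplane_reflection b x \<in> steiner b A"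
proof -
  have e: "hyperplane_reflection b x = x + (- 2 * (x \<bullet> b)) *\<^sub>R b" by (simp add: hyperplane_reflection_def)
  have "hyperplane_reflection b x \<bullet> b = - (x \<bullet> b)"
    using b by (simp add: hyperplane_reflection_def inner_simps)
  moreover have "slice_length b A (hyperplane_reflection b x) = slice_length b A x"
    unfolding e by (rule slice_length_parallel[OF b])
  ultimately show ?thesis using x by (simp add: steiner_def)
qed

lemma hyperplane_reflection_twice: "c \<in> Basis \<Longrightarrow> hyperplane_reflection c (hyperplane_reflection c x) = x"
  by (simp add: hyperplane_reflection_def inner_simps algebra_simps)

text \<open>A reflection in another coordinate hyperplane maps lines parallel to \<open>b\<close> to
  such lines and preserves their slices. This is why symmetries obtained earlier survive later
  symmetrizations.\<close>

lemma steiner_reflection_other: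
  assumes b: "b \<in> Basis" and c: "c \<in> Basis" "c \<noteq> b"
    and A: "\<And>x. x \<in> A \<Longrightarrow> hyperplane_reflection c x \<in> A" and x: "x \<in> steiner b A"
  shows "hyperplane_reflection c x \<in> steiner b A"
proof -
  have cb: "c \<bullet> b = 0" "b \<bullet> c = 0" using b c by (auto simp: inner_Basis)
  have Rb: "hyperplane_reflection c x \<bullet> b = x \<bullet> b" by (simp add: hyperplane_reflection_def inner_simps cb)
  have R: "hyperplane_reflection c x + (t - x \<bullet> b) *\<^sub>R b = hyperplane_reflection c (x + (t - x \<bullet> b) *\<^sub>R b)" for t
    by (simp add: hyperplane_reflection_def inner_simps cb)
  have "hyperplane_reflection c z \<in> A \<longleftrightarrow> z \<in> A" for z
    using A[of z] A[of "hyperplane_reflection c z"] hyperplane_reflection_twice[OF c(1), of z] by auto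
  then have "slice_length b A (hyperplane_reflection c x) = slice_length b A x"
    unfolding slice_length_def Rb R by simp
  then show ?thesis using x by (simp add: steiner_def Rb)
qed

lemma exists_symmetrization:
  fixes A B :: "'a::euclidean_space set"
  assumes A: "A \<in> sets borel" and D: "\<And>x y. x \<in> A \<Longrightarrow> y \<in> A \<Longrightarrow> dist x y \<le> D"
    and B: "finite B" "B \<subseteq> Basis"
  shows "\<exists>A'. A' \<in> sets borel \<and> emeasure lborel A' = emeasure lborel A \<and>
    (\<forall>x\<in>A'. \<forall>y\<in>A'. dist x y \<le> D) \<and> (\<forall>c\<in>B. \<forall>x\<in>A'. hyperplane_reflection c x \<in> A')"
  using B
proof (induction B rule: finite_induct)
  case empty
  show ?case by (intro exI[of _ A]) (simp add: A D)
next
  case (insert b B)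
  then obtain A' where A': "A' \<in> sets borel" "emeasure lborel A' = emeasure lborel A"
    "\<And>x y. x \<in> A' \<Longrightarrow> y \<in> A' \<Longrightarrow> dist x y \<le> D" "\<And>c x. c \<in> B \<Longrightarrow> x \<in> A' \<Longrightarrow> hyperplane_reflection c x \<in> A'"
    by auto
  have b: "b \<in> Basis" using insert by simp
  have "hyperplane_reflection c x \<in> steiner b A'" if "c \<in> insert b B" "x \<in> steiner b A'" for c x
  proof (cases "c = b")
    case True
    then show ?thesis using steiner_reflection_self[OF b that(2)] by simp
  next
    case False
    then show ?thesis
      using that insert.prems by (intro steiner_reflection_other[OF b _ _ A'(4)]) auto
  qed
  then show ?case
    using sets_steiner[OF A'(1), of b] emeasure_steiner[OF b A'(1)] A'(2) steiner_dist_le[OF b A'(3)]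
    by - (rule exI[of _ "steiner b A'"], simp)
qed

text \<open>The reflections in all coordinate hyperplanes compose to \<open>- x\<close>. A centrally
  symmetric set of diameter at most \<open>D\<close> contains \<open>x\<close> and
  \<open>- x\<close> together, hence lies in the ball of radius \<open>D / 2\<close>; the
  symmetrized set itself need not be a ball.\<close>

theorem isodiametric_inequality:
  fixes A :: "'a::euclidean_space set"
  assumes A: "A \<in> sets borel" and D: "\<And>x y. x \<in> A \<Longrightarrow> y \<in> A \<Longrightarrow> dist x y \<le> D" and D0: "0 \<le> D"
  shows "emeasure lborel A \<le> ennreal (unit_ball_vol (DIM('a)) * (D / 2) ^ DIM('a))"
proof -
  obtain A' :: "'a set" where A': "A' \<in> sets borel" "emeasure lborel A' = emeasure lborel A"
    "\<And>x y. x \<in> A' \<Longrightarrow> y \<in> A' \<Longrightarrow> dist x y \<le> D"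
    "\<And>c x. c \<in> Basis \<Longrightarrow> x \<in> A' \<Longrightarrow> hyperplane_reflection c x \<in> A'"
    using exists_symmetrization[of A D Basis] A D by auto
  have "A' \<subseteq> cball 0 (D / 2)"
  proof
    fix x assume x: "x \<in> A'"
    \<comment> \<open>The reflections are applied one at a time; each negates one coordinate and
      leaves the others alone.\<close>
    have "x - (\<Sum>c\<in>B. (2 * (x \<bullet> c)) *\<^sub>R c) \<in> A'" if "finite B" "B \<subseteq> Basis" for B
      using that
    proof (induction B rule: finite_induct)
      case (insert c B)
      define z where "z = x - (\<Sum>c\<in>B. (2 * (x \<bullet> c)) *\<^sub>R c)"
      have "(\<Sum>d\<in>B. (2 * (x \<bullet> d)) *\<^sub>R d) \<bullet> c = 0"
        using insert by (auto simp: inner_sum_left inner_Basis intro!: sum.neutral)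
      then have "z \<bullet> c = x \<bullet> c" by (simp add: z_def inner_diff_left)
      moreover have "hyperplane_reflection c z \<in> A'" using insert A'(4) by (simp add: z_def)
      ultimately show ?case
        using insert by (simp add: hyperplane_reflection_def z_def algebra_simps)
    qed (use x in simp)
    from this[OF finite_Basis order_refl] have "x - (\<Sum>c\<in>Basis. (2 * (x \<bullet> c)) *\<^sub>R c) \<in> A'" .
    moreover have "(\<Sum>c\<in>Basis. (2 * (x \<bullet> c)) *\<^sub>R c) = 2 *\<^sub>R x"
      by (simp add: euclidean_representation flip: scaleR_scaleR scaleR_sum_right)
    ultimately have "- x \<in> A'" by (simp add: scaleR_2)
    from A'(3)[OF x this] have "norm (2 *\<^sub>R x) \<le> D" by (simp add: dist_norm scaleR_2)
    then show "x \<in> cball 0 (D / 2)" by simp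
  qed
  then have "emeasure lborel A' \<le> emeasure lborel (cball (0::'a) (D / 2))"
    by (intro emeasure_mono) auto
  also have "\<dots> = ennreal (unit_ball_vol (DIM('a)) * (D / 2) ^ DIM('a))"
    using D0 by (intro emeasure_cball) simp
  finally show ?thesis using A'(2) by simp
qed

section \<open>The bounded differences inequality\<close>

text \<open>Hoeffding's lemma wants an interval; as only the oscillation is bounded, the interval
  starts at the infimum of \<open>f\<close>.\<close>

lemma (in prob_space) exp_moment_le_of_oscillation:
  assumes [measurable]: "f \<in> borel_measurable M" and "0 \<le> c" "0 < l"
    and osc: "\<And>x y. x \<in> space M \<Longrightarrow> y \<in> space M \<Longrightarrow> \<bar>f x - f y\<bar> \<le> c"
  shows "(\<integral>\<^sup>+x. ennreal (exp (l * (f x - expectation f))) \<partial>M) \<le> ennreal (exp (l\<^sup>2 * c\<^sup>2 / 8))"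
    (is "?L \<le> _")
proof -
  obtain x0 where x0: "x0 \<in> space M" using not_empty by auto
  define a where "a = (INF x\<in>space M. f x)"
  have bd: "bdd_below (f ` space M)"
    using osc[OF x0] by (auto simp: abs_le_iff algebra_simps intro!: bdd_belowI[of _ "f x0 - c"])
  have "f x \<in> {a..a + c}" if x: "x \<in> space M" for x
  proof -
    have "a \<le> f x" unfolding a_def using bd x by (intro cINF_lower)
    moreover have "f x - c \<le> a"
      unfolding a_def
    proof (rule cINF_greatest)
      show "f x - c \<le> f y" if "y \<in> space M" for y using osc[OF x that] by linarith
    qed (use x0 in auto)
    ultimately show ?thesis by simp
  qed
  then interpret interval_bounded_random_variable M f a "a + c"
    by unfold_locales auto
  show ?thesis using Hoeffdings_lemma_nn_integral[OF \<open>0 < l\<close>] by simp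
qed

lemma (in prob_space) integral_oscillation:
  fixes f g :: "'a \<Rightarrow> real"
  assumes "integrable M f" "integrable M g" "\<And>x. x \<in> space M \<Longrightarrow> \<bar>f x - g x\<bar> \<le> c"
  shows "\<bar>(\<integral>x. f x \<partial>M) - (\<integral>x. g x \<partial>M)\<bar> \<le> c"
proof -
  have "\<bar>(\<integral>x. f x \<partial>M) - (\<integral>x. g x \<partial>M)\<bar> = \<bar>\<integral>x. f x - g x \<partial>M\<bar>" using assms by simp
  also have "\<dots> \<le> (\<integral>x. \<bar>f x - g x\<bar> \<partial>M)" by (rule integral_abs_bound)
  also have "\<dots> \<le> (\<integral>x. c \<partial>M)" using assms by (intro integral_mono) auto
  finally show ?thesis by (simp add: prob_space)
qed

text \<open>The martingale argument in product form: integrating out one coordinate leaves a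
  function \<open>h\<close> with the same bound and the same differences, and in that coordinate
  \<open>f\<close> has mean \<open>h\<close> and oscillation at most \<open>c\<close>. So each
  coordinate costs one factor from Hoeffding's lemma.\<close>

lemma mcdiarmid_exp_moment:
  fixes f :: "('i \<Rightarrow> 'a) \<Rightarrow> real"
  assumes prob: "prob_space \<Lambda>" and I: "finite I" and c: "0 \<le> c" and l: "0 < l"
    and f: "f \<in> borel_measurable (\<Pi>\<^sub>M i\<in>I. \<Lambda>)"
    and bnd: "\<And>w. w \<in> space (\<Pi>\<^sub>M i\<in>I. \<Lambda>) \<Longrightarrow> \<bar>f w\<bar> \<le> K"
    and diff: "\<And>i w y. i \<in> I \<Longrightarrow> w \<in> space (\<Pi>\<^sub>M i\<in>I. \<Lambda>) \<Longrightarrow> y \<in> space \<Lambda> \<Longrightarrow> \<bar>f (w(i := y)) - f w\<bar> \<le> c"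
  shows "(\<integral>\<^sup>+w. ennreal (exp (l * (f w - (\<integral>w. f w \<partial>(\<Pi>\<^sub>M i\<in>I. \<Lambda>))))) \<partial>(\<Pi>\<^sub>M i\<in>I. \<Lambda>)) \<le>
    ennreal (exp (real (card I) * (l\<^sup>2 * c\<^sup>2 / 8)))"
  using I f bnd diff
proof (induction I arbitrary: f rule: finite_induct)
  case empty
  show ?case by (simp add: PiM_empty nn_integral_count_space_finite lebesgue_integral_count_space_finite)
next
  case (insert i I)
  interpret L: prob_space \<Lambda> by (rule prob)
  interpret product_sigma_finite "\<lambda>_. \<Lambda>" ..
  interpret I: prob_space "\<Pi>\<^sub>M i\<in>I. \<Lambda>" by (intro prob_space_PiM prob)
  interpret J: prob_space "\<Pi>\<^sub>M i\<in>insert i I. \<Lambda>" by (intro prob_space_PiM prob)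
  note f[measurable] = insert.prems(1)
  have upd[measurable]: "(\<lambda>(w, y). w(i := y)) \<in> (\<Pi>\<^sub>M i\<in>I. \<Lambda>) \<Otimes>\<^sub>M \<Lambda> \<rightarrow>\<^sub>M (\<Pi>\<^sub>M i\<in>insert i I. \<Lambda>)"
    using measurable_add_dim[of i I "\<lambda>_. \<Lambda>"] .
  have sp: "w(i := y) \<in> space (\<Pi>\<^sub>M i\<in>insert i I. \<Lambda>)" if "w \<in> space (\<Pi>\<^sub>M i\<in>I. \<Lambda>)" "y \<in> space \<Lambda>" for w y
    using that by (auto simp: space_PiM PiE_def extensional_def)
  define h where "h w = (\<integral>y. f (w(i := y)) \<partial>\<Lambda>)" for w
  have fm[measurable]: "(\<lambda>y. f (w(i := y))) \<in> borel_measurable \<Lambda>" if "w \<in> space (\<Pi>\<^sub>M i\<in>I. \<Lambda>)" for w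
    using measurable_compose[OF measurable_Pair1'[OF that, of \<Lambda>] measurable_compose[OF upd f]] by (simp only: prod.case)
  have fi: "integrable \<Lambda> (\<lambda>y. f (w(i := y)))" if "w \<in> space (\<Pi>\<^sub>M i\<in>I. \<Lambda>)" for w
    using fm[OF that] sp[OF that] insert.prems(2)
    by (intro L.integrable_const_bound[where B = K]) auto
  have hm[measurable]: "h \<in> borel_measurable (\<Pi>\<^sub>M i\<in>I. \<Lambda>)"
    unfolding h_def using measurable_compose[OF upd f]
    by (intro L.borel_measurable_lebesgue_integral) (simp add: case_prod_beta')
  have hb: "\<bar>h w\<bar> \<le> K" if w: "w \<in> space (\<Pi>\<^sub>M i\<in>I. \<Lambda>)" for w
  proof -
    have "\<bar>f (w(i := y)) - 0\<bar> \<le> K" if "y \<in> space \<Lambda>" for y using insert.prems(2)[OF sp[OF w that]] by (simp del: fun_upd_apply)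
    from L.integral_oscillation[OF fi[OF w] _ this] show ?thesis by (simp add: h_def)
  qed
  have hd: "\<bar>h (w(j := y)) - h w\<bar> \<le> c"
    if j: "j \<in> I" and w: "w \<in> space (\<Pi>\<^sub>M i\<in>I. \<Lambda>)" and y: "y \<in> space \<Lambda>" for j w y
  proof -
    have wj: "w(j := y) \<in> space (\<Pi>\<^sub>M i\<in>I. \<Lambda>)"
      using j w y by (auto simp: space_PiM PiE_def extensional_def Pi_def)
    show ?thesis unfolding h_def
    proof (rule L.integral_oscillation[OF fi[OF wj] fi[OF w]])
      fix z assume z: "z \<in> space \<Lambda>"
      have "j \<noteq> i" using j insert.hyps by auto
      then have "(w(j := y))(i := z) = (w(i := z))(j := y)" by (rule fun_upd_twist)
      then show "\<bar>f ((w(j := y))(i := z)) - f (w(i := z))\<bar> \<le> c"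
        using insert.prems(3)[of j "w(i := z)" y] j sp[OF w z] y by (simp del: fun_upd_apply)
    qed
  qed
  have Ef: "(\<integral>w. f w \<partial>(\<Pi>\<^sub>M i\<in>insert i I. \<Lambda>)) = (\<integral>w. h w \<partial>(\<Pi>\<^sub>M i\<in>I. \<Lambda>))"
    unfolding h_def using insert.hyps insert.prems(2)
    by (intro product_integral_insert J.integrable_const_bound[where B = K]) auto
  define e where "e = (\<integral>w. h w \<partial>(\<Pi>\<^sub>M i\<in>I. \<Lambda>))"
  have "(\<integral>\<^sup>+w. ennreal (exp (l * (f w - e))) \<partial>(\<Pi>\<^sub>M i\<in>insert i I. \<Lambda>)) =
      (\<integral>\<^sup>+w. (\<integral>\<^sup>+y. ennreal (exp (l * (f (w(i := y)) - e))) \<partial>\<Lambda>) \<partial>(\<Pi>\<^sub>M i\<in>I. \<Lambda>))"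
    using insert.hyps by (intro product_nn_integral_insert) auto
  \<comment> \<open>For fixed \<open>w\<close> the exponent splits into the fluctuation of
    \<open>f\<close> about \<open>h w\<close> and that of \<open>h w\<close> about the common mean
    \<open>e\<close>.\<close>
  also have "\<dots> \<le> (\<integral>\<^sup>+w. ennreal (exp (l\<^sup>2 * c\<^sup>2 / 8)) * ennreal (exp (l * (h w - e))) \<partial>(\<Pi>\<^sub>M i\<in>I. \<Lambda>))"
  proof (rule nn_integral_mono)
    fix w assume w: "w \<in> space (\<Pi>\<^sub>M i\<in>I. \<Lambda>)"
    note [measurable] = fm[OF w]
    have "(\<integral>\<^sup>+y. ennreal (exp (l * (f (w(i := y)) - e))) \<partial>\<Lambda>) =
        (\<integral>\<^sup>+y. ennreal (exp (l * (f (w(i := y)) - h w))) * ennreal (exp (l * (h w - e))) \<partial>\<Lambda>)"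
      by (rule nn_integral_cong) (simp add: algebra_simps flip: ennreal_mult exp_add)
    also have "\<dots> = (\<integral>\<^sup>+y. ennreal (exp (l * (f (w(i := y)) - h w))) \<partial>\<Lambda>) * ennreal (exp (l * (h w - e)))"
      by (rule nn_integral_multc) simp
    also have "\<dots> \<le> ennreal (exp (l\<^sup>2 * c\<^sup>2 / 8)) * ennreal (exp (l * (h w - e)))"
    proof (rule mult_right_mono)
      show "(\<integral>\<^sup>+y. ennreal (exp (l * (f (w(i := y)) - h w))) \<partial>\<Lambda>) \<le> ennreal (exp (l\<^sup>2 * c\<^sup>2 / 8))"
        unfolding h_def
      proof (rule L.exp_moment_le_of_oscillation[OF fm[OF w] c l])
        fix y z assume yz: "y \<in> space \<Lambda>" "z \<in> space \<Lambda>"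
        then show "\<bar>f (w(i := y)) - f (w(i := z))\<bar> \<le> c"
          using insert.prems(3)[of i "w(i := z)" y] sp[OF w yz(2)] by (simp del: fun_upd_apply)
      qed
    qed simp
    finally show "(\<integral>\<^sup>+y. ennreal (exp (l * (f (w(i := y)) - e))) \<partial>\<Lambda>) \<le>
      ennreal (exp (l\<^sup>2 * c\<^sup>2 / 8)) * ennreal (exp (l * (h w - e)))" .
  qed
  also have "\<dots> = ennreal (exp (l\<^sup>2 * c\<^sup>2 / 8)) * (\<integral>\<^sup>+w. ennreal (exp (l * (h w - e))) \<partial>(\<Pi>\<^sub>M i\<in>I. \<Lambda>))"
    by (rule nn_integral_cmult) simp
  also have "\<dots> \<le> ennreal (exp (l\<^sup>2 * c\<^sup>2 / 8)) * ennreal (exp (real (card I) * (l\<^sup>2 * c\<^sup>2 / 8)))"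
    unfolding e_def by (intro mult_left_mono insert.IH hm hb hd) auto
  also have "\<dots> = ennreal (exp (real (card (insert i I)) * (l\<^sup>2 * c\<^sup>2 / 8)))"
    using insert.hyps by (simp add: algebra_simps flip: ennreal_mult exp_add)
  finally show ?case unfolding Ef e_def .
qed

theorem mcdiarmid:
  fixes f :: "('i \<Rightarrow> 'a) \<Rightarrow> real"
  assumes prob: "prob_space \<Lambda>" and I: "finite I" "I \<noteq> {}" and c: "0 < c" and \<epsilon>: "0 < \<epsilon>"
    and f[measurable]: "f \<in> borel_measurable (\<Pi>\<^sub>M i\<in>I. \<Lambda>)"
    and bnd: "\<And>w. w \<in> space (\<Pi>\<^sub>M i\<in>I. \<Lambda>) \<Longrightarrow> \<bar>f w\<bar> \<le> K"
    and diff: "\<And>i w y. i \<in> I \<Longrightarrow> w \<in> space (\<Pi>\<^sub>M i\<in>I. \<Lambda>) \<Longrightarrow> y \<in> space \<Lambda> \<Longrightarrow> \<bar>f (w(i := y)) - f w\<bar> \<le> c"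
  shows "measure (\<Pi>\<^sub>M i\<in>I. \<Lambda>) {w \<in> space (\<Pi>\<^sub>M i\<in>I. \<Lambda>). f w \<ge> (\<integral>w. f w \<partial>(\<Pi>\<^sub>M i\<in>I. \<Lambda>)) + \<epsilon>} \<le>
    exp (- (2 * \<epsilon>\<^sup>2 / (real (card I) * c\<^sup>2)))"
proof -
  interpret J: prob_space "\<Pi>\<^sub>M i\<in>I. \<Lambda>" by (intro prob_space_PiM prob)
  define P where "P = (\<Pi>\<^sub>M i\<in>I. \<Lambda>)"
  define n where "n = real (card I)"
  have n: "n > 0" using I by (simp add: n_def card_gt_0_iff)
  \<comment> \<open>The minimizer of
    \<open>- l * \<epsilon> + n * l\<^sup>2 * c\<^sup>2 / 8\<close>, the exponent of the Chernoff
    bound.\<close>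
  define l where "l = 4 * \<epsilon> / (n * c\<^sup>2)"
  have l: "l > 0" using n c \<epsilon> by (simp add: l_def)
  define e where "e = (\<integral>w. f w \<partial>P)"
  have [measurable]: "f \<in> borel_measurable P" by (simp add: P_def)
  have "emeasure P {w \<in> space P. f w \<ge> e + \<epsilon>} = (\<integral>\<^sup>+w. indicator {w \<in> space P. f w \<ge> e + \<epsilon>} w \<partial>P)"
    by simp
  also have "\<dots> \<le> (\<integral>\<^sup>+w. ennreal (exp (- (l * \<epsilon>))) * ennreal (exp (l * (f w - e))) \<partial>P)"
  proof (rule nn_integral_mono)
    fix w
    have "1 \<le> exp (- (l * \<epsilon>)) * exp (l * (f w - e))" if "f w \<ge> e + \<epsilon>"
    proof -
      have "l * \<epsilon> \<le> l * (f w - e)" using that l by (intro mult_left_mono) auto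
      then show ?thesis by (simp flip: exp_add)
    qed
    then show "indicator {w \<in> space P. f w \<ge> e + \<epsilon>} w \<le> ennreal (exp (- (l * \<epsilon>))) * ennreal (exp (l * (f w - e)))"
      by (auto simp: indicator_def simp flip: ennreal_mult)
  qed
  also have "\<dots> = ennreal (exp (- (l * \<epsilon>))) * (\<integral>\<^sup>+w. ennreal (exp (l * (f w - e))) \<partial>P)"
    by (rule nn_integral_cmult) simp
  also have "\<dots> \<le> ennreal (exp (- (l * \<epsilon>))) * ennreal (exp (n * (l\<^sup>2 * c\<^sup>2 / 8)))"
    unfolding P_def e_def n_def using c bnd diff
    by (intro mult_left_mono mcdiarmid_exp_moment[OF prob I(1) _ l f]) auto
  also have "\<dots> = ennreal (exp (- (2 * \<epsilon>\<^sup>2 / (n * c\<^sup>2))))"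
  proof -
    have "- (l * \<epsilon>) + n * (l\<^sup>2 * c\<^sup>2 / 8) = - (2 * \<epsilon>\<^sup>2 / (n * c\<^sup>2))"
      using n c by (simp add: l_def power2_eq_square field_simps)
    then show ?thesis by (simp flip: ennreal_mult exp_add)
  qed
  finally show ?thesis
    unfolding P_def e_def n_def by (simp add: J.emeasure_eq_measure)
qed

section \<open>Centred sums of biased signs\<close>

text \<open>At the boundary point 0 convexity reduces to \<open>u powr p \<le> u\<close> for
  \<open>u\<close> in the unit interval.\<close>

lemma convex_on_powr_nonneg:
  assumes p: "p \<ge> 1"
  shows "convex_on {0..} (\<lambda>x::real. x powr p)"
proof (rule convex_onI)
  fix t x y :: real
  assume t: "0 < t" "t < 1" and xy: "x \<in> {0..}" "y \<in> {0..}"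
  have scale: "u powr p \<le> u" if "0 \<le> u" "u \<le> 1" for u :: real
    using powr_mono'[of 1 p u] p that by simp
  consider "x = 0" | "y = 0" | "0 < x" "0 < y" using xy by force
  then show "((1 - t) *\<^sub>R x + t *\<^sub>R y) powr p \<le> (1 - t) * x powr p + t * y powr p"
  proof cases
    case 1
    then show ?thesis using t xy p scale[of t] by (auto simp: powr_mult intro!: mult_right_mono)
  next
    case 2
    then show ?thesis using t xy p scale[of "1 - t"] by (auto simp: powr_mult intro!: mult_right_mono)
  next
    case 3
    then show ?thesis using t by (intro convex_onD[OF powr_convex[OF p]]) auto
  qed
qed simp

text \<open>The expectation of \<open>f\<close> at a sum of \<open>m\<close> independent copies of a
  sign of mean \<open>\<mu>\<close> minus \<open>\<mu>\<close>: a step is \<open>1 - \<mu>\<close>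
  with probability \<open>(1 + \<mu>) / 2\<close> and \<open>- (1 + \<mu>)\<close> otherwise. As a
  recursion it is a finite weighted sum for every \<open>f\<close>, with no integrability to
  check.\<close>

primrec sign_sum_mean :: "real \<Rightarrow> nat \<Rightarrow> (real \<Rightarrow> real) \<Rightarrow> real" where
  "sign_sum_mean \<mu> 0 f = f 0"
| "sign_sum_mean \<mu> (Suc m) f =
     (1 + \<mu>) / 2 * sign_sum_mean \<mu> m (\<lambda>x. f (x + (1 - \<mu>))) +
     (1 - \<mu>) / 2 * sign_sum_mean \<mu> m (\<lambda>x. f (x - (1 + \<mu>)))"

lemma sign_sum_mean_mono:
  assumes "\<bar>\<mu>\<bar> \<le> 1" "\<And>x. f x \<le> g x"
  shows "sign_sum_mean \<mu> m f \<le> sign_sum_mean \<mu> m g"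
  using assms(2)
proof (induction m arbitrary: f g)
  case (Suc m)
  then show ?case
    using assms(1) by (auto intro!: add_mono mult_left_mono)
qed auto

lemma sign_sum_mean_add:
  "sign_sum_mean \<mu> m (\<lambda>x. f x + g x) = sign_sum_mean \<mu> m f + sign_sum_mean \<mu> m g"
  by (induction m arbitrary: f g) (auto simp: algebra_simps)

lemma sign_sum_mean_cmult:
  "sign_sum_mean \<mu> m (\<lambda>x. c * f x) = c * sign_sum_mean \<mu> m f"
  by (induction m arbitrary: f) (auto simp: algebra_simps)

lemma sign_sum_mean_const [simp]: "sign_sum_mean \<mu> m (\<lambda>x. c) = c"
  by (induction m) (auto simp: field_simps)

lemma sign_sum_mean_diff:
  "sign_sum_mean \<mu> m (\<lambda>x. f x - g x) = sign_sum_mean \<mu> m f - sign_sum_mean \<mu> m g"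
  using sign_sum_mean_add[of \<mu> m f "\<lambda>x. (- 1) * g x"] sign_sum_mean_cmult[of \<mu> m "- 1" g] by simp

lemma sign_sum_mean_nonneg:
  assumes "\<bar>\<mu>\<bar> \<le> 1" "\<And>x. 0 \<le> f x"
  shows "0 \<le> sign_sum_mean \<mu> m f"
  using sign_sum_mean_mono[of \<mu> "\<lambda>_. 0" f m] assms by simp

lemma sign_sum_mean_minus: "sign_sum_mean \<mu> m (\<lambda>x. f (- x)) = sign_sum_mean (- \<mu>) m f"
proof (induction m arbitrary: f)
  case (Suc m)
  have 1: "- (x + (1 - \<mu>)) = - x - (1 - \<mu>)" "- (x - (1 + \<mu>)) = - x + (1 + \<mu>)" for x by auto
  show ?case
    unfolding sign_sum_mean.simps 1
      Suc.IH[of "\<lambda>x. f (x + (1 + \<mu>))"] Suc.IH[of "\<lambda>x. f (x - (1 - \<mu>))"]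
    by simp
qed simp

lemma sign_sum_mean_integral:
  assumes "\<And>x. integrable M (f x)"
  shows "integrable M (\<lambda>t. sign_sum_mean \<mu> m (\<lambda>x. f x t)) \<and>
         (\<integral>t. sign_sum_mean \<mu> m (\<lambda>x. f x t) \<partial>M) = sign_sum_mean \<mu> m (\<lambda>x. \<integral>t. f x t \<partial>M)"
  using assms
proof (induction m arbitrary: f)
  case (Suc m)
  note a = Suc.IH[of "\<lambda>x. f (x + (1 - \<mu>))"] and b = Suc.IH[of "\<lambda>x. f (x - (1 + \<mu>))"]
  show ?case using a b Suc.prems by simp
qed auto

section \<open>Moments and characteristic function of a sum of centred signs\<close>

lemma sign_sum_mean_ident: "sign_sum_mean \<mu> m (\<lambda>x. x) = 0"
  by (induction m) (auto simp: sign_sum_mean_add sign_sum_mean_diff field_simps)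

lemma sign_sum_mean_power2: "sign_sum_mean \<mu> m (\<lambda>x. x ^ 2) = real m * (1 - \<mu>\<^sup>2)"
proof (induction m)
  case (Suc m)
  have 1: "(x + (1 - \<mu>))^2 = x^2 + (2 * (1 - \<mu>) * x + (1-\<mu>)^2)"
   "(x - (1 + \<mu>))^2 = x^2 + ((- 2 * (1 + \<mu>)) * x + (1+\<mu>)^2)" for x :: real
    by (auto simp: power2_eq_square algebra_simps)
  show ?case
    unfolding sign_sum_mean.simps 1 sign_sum_mean_add sign_sum_mean_cmult sign_sum_mean_const
      Suc.IH sign_sum_mean_ident
    by (simp add: power2_eq_square field_simps)
qed auto

lemma sign_sum_mean_power3: "sign_sum_mean \<mu> m (\<lambda>x. x ^ 3) = - 2 * real m * \<mu> * (1 - \<mu>\<^sup>2)"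
proof (induction m)
  case (Suc m)
  have 1: "(x + (1 - \<mu>))^3 = x^3 + (3 * (1 - \<mu>) * x^2 + (3 * (1-\<mu>)^2 * x + (1-\<mu>)^3))"
   "(x - (1 + \<mu>))^3 = x^3 + ((- 3 * (1 + \<mu>)) * x^2 + (3 * (1+\<mu>)^2 * x + (- ((1+\<mu>)^3))))" for x :: real
    by (auto simp: power2_eq_square power3_eq_cube algebra_simps)
  show ?case
    unfolding sign_sum_mean.simps 1 sign_sum_mean_add sign_sum_mean_cmult sign_sum_mean_const
      Suc.IH sign_sum_mean_ident sign_sum_mean_power2
    by (simp add: power2_eq_square power3_eq_cube field_simps)
qed auto

text \<open>The first term is three times the squared variance, as for a normal variable; the second
  is \<open>m\<close> times the fourth cumulant of one sign.\<close>

lemma sign_sum_mean_power4: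
  "sign_sum_mean \<mu> m (\<lambda>x. x ^ 4) =
     3 * (real m)\<^sup>2 * (1 - \<mu>\<^sup>2)\<^sup>2 + real m * (1 - \<mu>\<^sup>2) * (4 - 6 * (1 - \<mu>\<^sup>2))"
proof (induction m)
  case (Suc m)
  have 1: "(x + (1 - \<mu>))^4 = x^4 + (4 * (1 - \<mu>) * x^3 + (6 * (1-\<mu>)^2 * x^2 + (4 * (1-\<mu>)^3 * x + (1-\<mu>)^4)))"
   "(x - (1 + \<mu>))^4 = x^4 + ((- 4 * (1 + \<mu>)) * x^3 + (6 * (1+\<mu>)^2 * x^2 + ((- 4 * (1+\<mu>)^3) * x + (1+\<mu>)^4)))" for x :: real
    by (simp_all add: power2_eq_square power3_eq_cube power4_eq_xxxx algebra_simps)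
  show ?case
    unfolding sign_sum_mean.simps 1 sign_sum_mean_add sign_sum_mean_cmult sign_sum_mean_const
      Suc.IH sign_sum_mean_ident sign_sum_mean_power2 sign_sum_mean_power3 of_nat_Suc
    by (simp add: power2_eq_square power3_eq_cube power4_eq_xxxx field_simps)
qed auto

text \<open>The characteristic function of one centred sign; for \<open>\<mu> = 0\<close> it is
  \<open>cos t\<close>.\<close>

definition sign_char :: "real \<Rightarrow> real \<Rightarrow> complex" where
  "sign_char \<mu> t = of_real ((1 + \<mu>) / 2) * cis ((1 - \<mu>) * t) + of_real ((1 - \<mu>) / 2) * cis (- (1 + \<mu>) * t)"

text \<open>The phase \<open>c\<close> makes the induction work: a step of the sum only shifts
  it.\<close>

lemma sign_sum_mean_cis:
  "sign_sum_mean \<mu> m (\<lambda>x. cos (t * x + c)) = Re (cis c * sign_char \<mu> t ^ m)"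
proof (induction m arbitrary: c)
  case (Suc m)
  have 1: "sign_sum_mean \<mu> m (\<lambda>x. cos (t * (x + (1 - \<mu>)) + c)) = Re (cis (c + (1 - \<mu>) * t) * sign_char \<mu> t ^ m)"
    using Suc.IH[of "c + (1 - \<mu>) * t"] by (simp add: algebra_simps)
  have 2: "sign_sum_mean \<mu> m (\<lambda>x. cos (t * (x - (1 + \<mu>)) + c)) = Re (cis (c - (1 + \<mu>) * t) * sign_char \<mu> t ^ m)"
    using Suc.IH[of "c - (1 + \<mu>) * t"] by (simp add: algebra_simps)
  have e1: "cis (c + (1 - \<mu>) * t) = cis c * cis ((1 - \<mu>) * t)" by (rule cis_mult[symmetric])
  have "c - (1 + \<mu>) * t = c + - (1 + \<mu>) * t" by (simp add: algebra_simps)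
  then have e2: "cis (c - (1 + \<mu>) * t) = cis c * cis (- (1 + \<mu>) * t)" by (simp only: cis_mult[symmetric])
  have 3: "cis c * sign_char \<mu> t ^ Suc m = of_real ((1 + \<mu>) / 2) * (cis (c + (1 - \<mu>) * t) * sign_char \<mu> t ^ m) + of_real ((1 - \<mu>) / 2) * (cis (c - (1 + \<mu>) * t) * sign_char \<mu> t ^ m)"
    unfolding power_Suc e1 e2 sign_char_def[of \<mu> t] by (simp add: algebra_simps)
  show ?case unfolding sign_sum_mean.simps 1 2 3
    by (simp del: of_real_add of_real_diff of_real_divide)
qed simp

lemma sign_sum_mean_cos: "sign_sum_mean \<mu> m (\<lambda>x. cos (t * x)) = Re (sign_char \<mu> t ^ m)"
  using sign_sum_mean_cis[of \<mu> m t 0] by simp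

lemma sign_sum_mean_0_cos: "sign_sum_mean 0 m (\<lambda>x. cos (t * x)) = cos t ^ m"
proof -
  have "sign_char 0 t = of_real (cos t)" by (simp add: sign_char_def complex_eq_iff)
  then show ?thesis unfolding sign_sum_mean_cos by (simp flip: of_real_power)
qed

lemma Re_sign_char: "Re (sign_char \<mu> t) = cos t * cos (\<mu> * t) + \<mu> * sin t * sin (\<mu> * t)"
proof -
  have a: "(1 - \<mu>) * t = t - \<mu> * t" "- (1 + \<mu>) * t = - (t + \<mu> * t)" by (auto simp: algebra_simps)
  show ?thesis unfolding sign_char_def a by (simp add: cos_diff cos_add algebra_simps) (simp add: field_simps)
qed

lemma Im_sign_char: "Im (sign_char \<mu> t) = \<mu> * sin t * cos (\<mu> * t) - cos t * sin (\<mu> * t)"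
proof -
  have a: "(1 - \<mu>) * t = t - \<mu> * t" "- (1 + \<mu>) * t = - (t + \<mu> * t)" by (auto simp: algebra_simps)
  show ?thesis unfolding sign_char_def a by (simp add: sin_diff sin_add algebra_simps) (simp add: field_simps)
qed

text \<open>Affine in \<open>\<mu>\<^sup>2\<close>, from \<open>(cos t)\<^sup>2\<close> for an
  unbiased sign to 1 for a constant one.\<close>

lemma norm_sign_char: "(norm (sign_char \<mu> t))\<^sup>2 = 1 - (1 - \<mu>\<^sup>2) * (sin t)\<^sup>2"
proof -
  have "(norm (sign_char \<mu> t))\<^sup>2 = ((cos t)^2 + \<mu>^2 * (sin t)^2) * ((sin (\<mu> * t))^2 + (cos (\<mu> * t))^2)"
    unfolding cmod_power2 Re_sign_char Im_sign_char by algebra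
  also have "\<dots> = (cos t)^2 + \<mu>^2 * (sin t)^2" by simp
  also have "\<dots> = 1 - (1 - \<mu>\<^sup>2) * (sin t)\<^sup>2"
    by (simp add: cos_squared_eq algebra_simps)
  finally show ?thesis .
qed

section \<open>Representing moments by kernels\<close>

lemma nn_integral_even:
  fixes f :: "real \<Rightarrow> ennreal"
  assumes [measurable]: "f \<in> borel_measurable borel" and even: "\<And>x. f (- x) = f x"
  shows "(\<integral>\<^sup>+x. f x \<partial>lborel) = 2 * (\<integral>\<^sup>+x\<in>{0<..}. f x \<partial>lborel)"
proof -
  have neg: "(\<integral>\<^sup>+x\<in>{..<0}. f x \<partial>lborel) = (\<integral>\<^sup>+x\<in>{0<..}. f x \<partial>lborel)"
    by (subst nn_integral_real_affine[where c = "-1" and t = 0])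
      (auto simp: even indicator_def intro!: nn_integral_cong)
  have "(\<integral>\<^sup>+x. f x \<partial>lborel) = (\<integral>\<^sup>+x. f x * indicator {0<..} x + f x * indicator {..<0} x \<partial>lborel)"
    by (intro nn_integral_cong_AE AE_I[where N = "{0}"]) (auto simp: indicator_def)
  also have "\<dots> = 2 * (\<integral>\<^sup>+x\<in>{0<..}. f x \<partial>lborel)"
    by (subst nn_integral_add) (auto simp: neg mult_2)
  finally show ?thesis .
qed

text \<open>The absolute moment of order \<open>r\<close> of a standard normal variable, see
  \<open>nn_integral_abs_moment_std_normal\<close>.\<close>

definition normal_abs_moment :: "real \<Rightarrow> real" where
  "normal_abs_moment r = 2 powr (r / 2) * Gamma ((r + 1) / 2) / sqrt pi"

lemma normal_abs_moment_pos: "r > -1 \<Longrightarrow> normal_abs_moment r > 0"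
  by (auto simp: normal_abs_moment_def intro!: divide_pos_pos mult_pos_pos Gamma_real_pos)

text \<open>Substituting \<open>x\<^sup>2 / 2\<close> for the variable of the Gamma integral at
  \<open>s = (r + 1) / 2\<close>.\<close>

lemma nn_integral_powr_gauss:
  assumes r: "r > -1"
  shows "(\<integral>\<^sup>+x\<in>{0<..}. ennreal (x powr r * exp (- x\<^sup>2 / 2)) \<partial>lborel) =
         ennreal (2 powr ((r - 1) / 2) * Gamma ((r + 1) / 2))"
proof -
  define s where "s = (r + 1) / 2"
  have s: "s > 0" using r by (simp add: s_def)
  define f where "f = (\<lambda>t::real. t powr (s - 1) / exp t)"
  have nn: "f t \<ge> 0" for t by (simp add: f_def)
  have "(f has_integral Gamma s) {0..}"
    using Gamma_integral_real[OF s] by (simp add: f_def)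
  moreover have "(f has_integral Gamma s) {0<..} \<longleftrightarrow> (f has_integral Gamma s) {0..}"
    by (rule has_integral_spike_set_eq; rule negligible_subset[of "{0}"]) auto
  ultimately have fint: "(f has_integral Gamma s) {0<..}" by simp
  have im: "(\<lambda>x. x\<^sup>2 / 2) ` {0<..} = {0::real<..}"
  proof safe
    fix y :: real assume "y > 0"
    then show "y \<in> (\<lambda>x. x\<^sup>2 / 2) ` {0<..}"
      by (intro image_eqI[of _ _ "sqrt (2 * y)"]) auto
  qed auto
  have "f integrable_on {0<..}" using fint by (rule has_integral_integrable)
  then have "f absolutely_integrable_on {0<..}"
    using nn by (intro nonnegative_absolutely_integrable_1) auto
  then have "f absolutely_integrable_on (\<lambda>x. x\<^sup>2 / 2) ` {0<..} \<and> integral ((\<lambda>x. x\<^sup>2 / 2) ` {0<..}) f = Gamma s"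
    unfolding im using fint by (simp add: integral_unique)
  moreover have "(\<lambda>x. \<bar>x\<bar> * f (x\<^sup>2 / 2)) absolutely_integrable_on {0<..} \<and>
      integral {0<..} (\<lambda>x. \<bar>x\<bar> * f (x\<^sup>2 / 2)) = Gamma s \<longleftrightarrow>
      f absolutely_integrable_on (\<lambda>x. x\<^sup>2 / 2) ` {0<..} \<and> integral ((\<lambda>x. x\<^sup>2 / 2) ` {0<..}) f = Gamma s"
    by (rule has_absolute_integral_change_of_variables_1')
      (auto intro!: derivative_eq_intros inj_onI simp: power2_eq_iff_nonneg)
  ultimately have ai: "(\<lambda>x. \<bar>x\<bar> * f (x\<^sup>2 / 2)) absolutely_integrable_on {0<..}"
    and int: "integral {0<..} (\<lambda>x. \<bar>x\<bar> * f (x\<^sup>2 / 2)) = Gamma s" by blast+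
  have "(\<lambda>x. \<bar>x\<bar> * f (x\<^sup>2 / 2)) integrable_on {0<..}"
    using ai by (rule set_lebesgue_integral_eq_integral(1))
  then have "((\<lambda>x. \<bar>x\<bar> * f (x\<^sup>2 / 2)) has_integral Gamma s) {0<..}"
    unfolding int[symmetric] by (rule integrable_integral)
  then have "((\<lambda>x. 2 powr ((r - 1) / 2) * (\<bar>x\<bar> * f (x\<^sup>2 / 2))) has_integral 2 powr ((r - 1) / 2) * Gamma s) {0<..}"
    by (rule has_integral_mult_right)
  then have "((\<lambda>x. x powr r * exp (- x\<^sup>2 / 2)) has_integral 2 powr ((r - 1) / 2) * Gamma s) {0<..}"
  proof (rule has_integral_eq[rotated])
    fix x :: real assume "x \<in> {0<..}"
    then have x: "x > 0" by simp
    have "(x\<^sup>2 / 2) powr (s - 1) = x powr (r - 1) / 2 powr ((r - 1) / 2)"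
    proof -
      have "x\<^sup>2 powr (s - 1) = x powr (r - 1)"
      proof -
        have "x\<^sup>2 powr (s - 1) = (x powr 2) powr (s - 1)" using x by simp
        also have "\<dots> = x powr (2 * (s - 1))" by (rule powr_powr)
        also have "2 * (s - 1) = r - 1" by (simp add: s_def field_simps)
        finally show ?thesis .
      qed
      then show ?thesis
        using x by (simp add: powr_divide s_def field_simps)
    qed
    moreover have "x * x powr (r - 1) = x powr r" using x by (simp add: powr_mult_base)
    ultimately show "2 powr ((r - 1) / 2) * (\<bar>x\<bar> * f (x\<^sup>2 / 2)) = x powr r * exp (- x\<^sup>2 / 2)"
      using x by (simp add: f_def exp_minus field_simps)
  qed
  from nn_integral_has_integral_lebesgue[OF _ this]
  have "(\<integral>\<^sup>+x. ennreal (indicator {0<..} x * (x powr r * exp (- x\<^sup>2 / 2))) \<partial>lborel) =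
      ennreal (2 powr ((r - 1) / 2) * Gamma s)" by simp
  moreover have "(\<integral>\<^sup>+x. ennreal (indicator {0<..} x * (x powr r * exp (- x\<^sup>2 / 2))) \<partial>lborel) =
      (\<integral>\<^sup>+x\<in>{0<..}. ennreal (x powr r * exp (- x\<^sup>2 / 2)) \<partial>lborel)"
    by (intro nn_integral_cong) (auto simp: indicator_def)
  ultimately show ?thesis by (simp add: s_def)
qed

lemma nn_integral_abs_moment_std_normal:
  assumes r: "r > -1"
  shows "(\<integral>\<^sup>+x. ennreal (\<bar>x\<bar> powr r * std_normal_density x) \<partial>lborel) = ennreal (normal_abs_moment r)"
proof -
  have "(\<integral>\<^sup>+x. ennreal (\<bar>x\<bar> powr r * std_normal_density x) \<partial>lborel) =
      2 * (\<integral>\<^sup>+x\<in>{0<..}. ennreal (\<bar>x\<bar> powr r * std_normal_density x) \<partial>lborel)"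
    by (rule nn_integral_even) (auto simp: std_normal_density_def)
  also have "(\<integral>\<^sup>+x\<in>{0<..}. ennreal (\<bar>x\<bar> powr r * std_normal_density x) \<partial>lborel) =
     (\<integral>\<^sup>+x. ennreal (1 / sqrt (2 * pi)) * (ennreal (x powr r * exp (- x\<^sup>2 / 2)) * indicator {0<..} x) \<partial>lborel)"
    by (intro nn_integral_cong) (auto simp: std_normal_density_def indicator_def field_simps simp flip: ennreal_mult)
  also have "\<dots> = ennreal (1 / sqrt (2 * pi)) * ennreal (2 powr ((r - 1) / 2) * Gamma ((r + 1) / 2))"
    unfolding nn_integral_powr_gauss[OF r, symmetric] by (rule nn_integral_cmult) auto
  also have "2 * \<dots> = ennreal (2 * (1 / sqrt (2 * pi) * (2 powr ((r - 1) / 2) * Gamma ((r + 1) / 2))))"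
    using r Gamma_real_pos[of "(r + 1) / 2"] by (subst ennreal_mult) (auto simp: simp flip: ennreal_mult)
  also have "2 * (1 / sqrt (2 * pi) * (2 powr ((r - 1) / 2) * Gamma ((r + 1) / 2))) = normal_abs_moment r"
  proof -
    have "2 powr (r / 2) = 2 powr ((r - 1) / 2) * 2 powr (1/2)"
      by (simp add: powr_add[symmetric] diff_divide_distrib)
    then show ?thesis
      by (simp add: normal_abs_moment_def real_sqrt_mult powr_half_sqrt field_simps)
  qed
  finally show ?thesis .
qed

text \<open>Averaging a kernel over all scales reproduces a power function.\<close>
lemma nn_integral_scaled_kernel:
  fixes k :: "real \<Rightarrow> real"
  assumes [measurable]: "k \<in> borel_measurable borel" and even: "\<And>x. k (- x) = k x"
    and k0: "k 0 = 0" and nn: "\<And>x. 0 \<le> k x"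
  shows "(\<integral>\<^sup>+t\<in>{0<..}. ennreal (k (t * x) * t powr (- r - 1)) \<partial>lborel) =
         ennreal (\<bar>x\<bar> powr r) * (\<integral>\<^sup>+t\<in>{0<..}. ennreal (k t * t powr (- r - 1)) \<partial>lborel)"
proof (cases "x = 0")
  case False
  define c where "c = \<bar>x\<bar>"
  have c: "c > 0" using False by (simp add: c_def)
  have k: "k (t * x) = k (t * c)" for t
    using even[of "t * x"] by (auto simp: c_def abs_if)
  have "(\<integral>\<^sup>+t\<in>{0<..}. ennreal (k t * t powr (- r - 1)) \<partial>lborel) =
     c * (\<integral>\<^sup>+t. ennreal (k (c * t) * (c * t) powr (- r - 1)) * indicator {0<..} (c * t) \<partial>lborel)"
    using c by (subst nn_integral_real_affine[where c = c and t = 0]) auto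
  also have "\<dots> = c * (\<integral>\<^sup>+t. ennreal (c powr (- r - 1)) * (ennreal (k (t * x) * t powr (- r - 1)) * indicator {0<..} t) \<partial>lborel)"
  proof -
    have "k (c * t) * (c * t) powr (- r - 1) = c powr (- r - 1) * (k (t * x) * t powr (- r - 1))" if "t > 0" for t
      unfolding k using c that by (simp add: powr_mult mult.commute[of c t])
    then have "ennreal (k (c * t) * (c * t) powr (- r - 1)) * indicator {0<..} (c * t) =
        ennreal (c powr (- r - 1)) * (ennreal (k (t * x) * t powr (- r - 1)) * indicator {0<..} t)" for t
      using c nn by (auto simp: indicator_def zero_less_mult_iff simp flip: ennreal_mult)
    then show ?thesis by (simp only:)
  qed
  also have "\<dots> = ennreal (c * c powr (- r - 1)) * (\<integral>\<^sup>+t\<in>{0<..}. ennreal (k (t * x) * t powr (- r - 1)) \<partial>lborel)"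
    using c by (subst nn_integral_cmult) (auto simp: ennreal_mult ac_simps)
  also have "c * c powr (- r - 1) = c powr (- r)"
    using c by (simp add: powr_mult_base)
  finally have "ennreal (c powr r) * (\<integral>\<^sup>+t\<in>{0<..}. ennreal (k t * t powr (- r - 1)) \<partial>lborel) =
     ennreal (c powr r * c powr (- r)) * (\<integral>\<^sup>+t\<in>{0<..}. ennreal (k (t * x) * t powr (- r - 1)) \<partial>lborel)"
    by (simp add: ennreal_mult mult.assoc)
  also have "c powr r * c powr (- r) = 1"
    using c by (simp flip: powr_add)
  finally show ?thesis by (simp add: c_def)
qed (simp add: k0)

text \<open>By \<open>nn_integral_scaled_kernel\<close> each value \<open>x\<close> of the sum
  contributes \<open>K * \<bar>x\<bar> powr r\<close>; the mean over signs is a finite sum and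
  passes through the integral.\<close>

lemma sign_sum_mean_kernel:
  fixes k :: "real \<Rightarrow> real"
  assumes [measurable]: "k \<in> borel_measurable borel" and even: "\<And>x. k (- x) = k x"
    and k0: "k 0 = 0" and nn: "\<And>x. 0 \<le> k x" and \<mu>: "\<bar>\<mu>\<bar> \<le> 1" and K: "K \<ge> 0"
    and K_eq: "(\<integral>\<^sup>+t\<in>{0<..}. ennreal (k t * t powr (- r - 1)) \<partial>lborel) = ennreal K"
  shows "(\<integral>\<^sup>+t\<in>{0<..}. ennreal (sign_sum_mean \<mu> m (\<lambda>x. k (t * x)) * t powr (- r - 1)) \<partial>lborel) =
         ennreal (K * sign_sum_mean \<mu> m (\<lambda>x. \<bar>x\<bar> powr r))"
proof -
  define f where "f = (\<lambda>x t. k (t * x) * t powr (- r - 1) * indicator {0<..} t)"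
  have nn_f: "(\<integral>\<^sup>+t. ennreal (f x t) \<partial>lborel) = ennreal (K * \<bar>x\<bar> powr r)" for x
  proof -
    have "(\<integral>\<^sup>+t. ennreal (f x t) \<partial>lborel) = (\<integral>\<^sup>+t\<in>{0<..}. ennreal (k (t * x) * t powr (- r - 1)) \<partial>lborel)"
      by (intro nn_integral_cong) (auto simp: f_def indicator_def)
    also have "\<dots> = ennreal (K * \<bar>x\<bar> powr r)"
      unfolding nn_integral_scaled_kernel[OF assms(1-4)] K_eq using K by (simp add: ennreal_mult mult.commute)
    finally show ?thesis .
  qed
  have f0: "f x t \<ge> 0" for x t by (auto simp: f_def nn)
  have [measurable]: "f x \<in> borel_measurable borel" for x by (simp add: f_def)
  have int: "integrable lborel (f x)" for x
    by (rule integrableI_nonneg) (auto simp: f0 nn_f)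
  have int_eq: "(\<integral>t. f x t \<partial>lborel) = K * \<bar>x\<bar> powr r" for x
    using f0 by (subst integral_eq_nn_integral) (auto simp: nn_f K)
  note * = sign_sum_mean_integral[of lborel f \<mu> m, OF int]
  have 0: "0 \<le> sign_sum_mean \<mu> m (\<lambda>x. f x t)" for t
    using f0 \<mu> by (intro sign_sum_mean_nonneg) auto
  have "(\<integral>\<^sup>+t\<in>{0<..}. ennreal (sign_sum_mean \<mu> m (\<lambda>x. k (t * x)) * t powr (- r - 1)) \<partial>lborel) =
     (\<integral>\<^sup>+t. ennreal (sign_sum_mean \<mu> m (\<lambda>x. f x t)) \<partial>lborel)"
  proof (intro nn_integral_cong)
    fix t :: real
    have "sign_sum_mean \<mu> m (\<lambda>x. f x t) = t powr (- r - 1) * indicator {0<..} t * sign_sum_mean \<mu> m (\<lambda>x. k (t * x))"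
      unfolding sign_sum_mean_cmult[symmetric] f_def by (simp add: ac_simps)
    then show "ennreal (sign_sum_mean \<mu> m (\<lambda>x. k (t * x)) * t powr (- r - 1)) * indicator {0<..} t =
        ennreal (sign_sum_mean \<mu> m (\<lambda>x. f x t))"
      by (auto simp: indicator_def mult.commute)
  qed
  also have "\<dots> = ennreal (\<integral>t. sign_sum_mean \<mu> m (\<lambda>x. f x t) \<partial>lborel)"
    by (rule nn_integral_eq_integral) (use * 0 in auto)
  also have "(\<integral>t. sign_sum_mean \<mu> m (\<lambda>x. f x t) \<partial>lborel) = K * sign_sum_mean \<mu> m (\<lambda>x. \<bar>x\<bar> powr r)"
    using * by (simp add: int_eq sign_sum_mean_cmult)
  finally show ?thesis .
qed

text \<open>The normal counterpart of \<open>sign_sum_mean_kernel\<close>, with the same factor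
  \<open>K\<close>. The comparison therefore never requires the value of \<open>K\<close>, only that
  it is positive and finite.\<close>

lemma normal_kernel:
  fixes k :: "real \<Rightarrow> real"
  assumes [measurable]: "k \<in> borel_measurable borel" and even: "\<And>x. k (- x) = k x"
    and k0: "k 0 = 0" and nn: "\<And>x. 0 \<le> k x" and \<sigma>: "0 \<le> \<sigma>" and r: "r > -1" and K: "K \<ge> 0"
    and K_eq: "(\<integral>\<^sup>+t\<in>{0<..}. ennreal (k t * t powr (- r - 1)) \<partial>lborel) = ennreal K"
  shows "(\<integral>\<^sup>+t\<in>{0<..}. (\<integral>\<^sup>+z. ennreal (k (t * (\<sigma> * z)) * std_normal_density z) \<partial>lborel) * ennreal (t powr (- r - 1)) \<partial>lborel) =
         ennreal (K * (\<sigma> powr r * normal_abs_moment r))"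
proof -
  have "(\<integral>\<^sup>+t\<in>{0<..}. (\<integral>\<^sup>+z. ennreal (k (t * (\<sigma> * z)) * std_normal_density z) \<partial>lborel) * ennreal (t powr (- r - 1)) \<partial>lborel) =
     (\<integral>\<^sup>+t. (\<integral>\<^sup>+z. ennreal (k (t * (\<sigma> * z)) * std_normal_density z * t powr (- r - 1)) * indicator {0<..} t \<partial>lborel) \<partial>lborel)"
    by (intro nn_integral_cong) (auto simp: nn_integral_multc ennreal_mult nn indicator_def)
  also have "\<dots> = (\<integral>\<^sup>+z. (\<integral>\<^sup>+t. ennreal (k (t * (\<sigma> * z)) * std_normal_density z * t powr (- r - 1)) * indicator {0<..} t \<partial>lborel) \<partial>lborel)"
    by (rule lborel_pair.Fubini') measurable
  also have "\<dots> = (\<integral>\<^sup>+z. ennreal (std_normal_density z) * (\<integral>\<^sup>+t\<in>{0<..}. ennreal (k (t * (\<sigma> * z)) * t powr (- r - 1)) \<partial>lborel) \<partial>lborel)"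
  proof (intro nn_integral_cong)
    fix z :: real
    show "(\<integral>\<^sup>+t. ennreal (k (t * (\<sigma> * z)) * std_normal_density z * t powr (- r - 1)) * indicator {0<..} t \<partial>lborel) =
       ennreal (std_normal_density z) * (\<integral>\<^sup>+t\<in>{0<..}. ennreal (k (t * (\<sigma> * z)) * t powr (- r - 1)) \<partial>lborel)"
      by (subst nn_integral_cmult[symmetric])
        (auto intro!: nn_integral_cong simp: indicator_def nn ac_simps simp flip: ennreal_mult)
  qed
  also have "\<dots> = (\<integral>\<^sup>+z. ennreal (K * \<sigma> powr r) * ennreal (\<bar>z\<bar> powr r * std_normal_density z) \<partial>lborel)"
    unfolding nn_integral_scaled_kernel[OF assms(1-4)] K_eq
    using \<sigma> K by (intro nn_integral_cong) (auto simp: abs_mult powr_mult ac_simps simp flip: ennreal_mult)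
  also have "\<dots> = ennreal (K * \<sigma> powr r) * ennreal (normal_abs_moment r)"
    by (subst nn_integral_cmult) (auto simp: nn_integral_abs_moment_std_normal[OF r])
  finally show ?thesis
    using K normal_abs_moment_pos[OF r] by (simp add: ac_simps flip: ennreal_mult)
qed

text \<open>The exponent \<open>a\<close> gives convergence at 0 and \<open>b\<close> at infinity,
  which ties a kernel to a range of \<open>r\<close>. The interval \<open>{4..5}\<close> is merely a
  set of positive measure on which all three kernels used later are clearly positive.\<close>

lemma kernel_integral_finite:
  fixes k :: "real \<Rightarrow> real"
  assumes [measurable]: "k \<in> borel_measurable borel" and nn: "\<And>x. 0 \<le> k x"
    and small: "\<And>x. 0 < x \<Longrightarrow> x \<le> 1 \<Longrightarrow> k x \<le> C * x powr a" "r < a"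
    and large: "\<And>x. 1 \<le> x \<Longrightarrow> k x \<le> C * x powr b" "b < r"
    and pos: "\<And>x. x \<in> {4..5} \<Longrightarrow> 0 < k x"
  obtains K where "K > 0" "(\<integral>\<^sup>+t\<in>{0<..}. ennreal (k t * t powr (- r - 1)) \<partial>lborel) = ennreal K"
proof -
  define I where "I = (\<integral>\<^sup>+t\<in>{0<..}. ennreal (k t * t powr (- r - 1)) \<partial>lborel)"
  have C: "C \<ge> 0" using small(1)[of 1] nn[of 1] by simp
  have 1: "(\<integral>\<^sup>+t. ennreal (t powr (a - r - 1)) * indicator {0..1} t \<partial>lborel) < \<infinity>"
  proof -
    have "((\<lambda>t. t powr (a - r - 1)) has_integral (1 powr (a - r - 1 + 1) / (a - r - 1 + 1))) {0..1}"
      by (rule has_integral_powr_from_0) (use small(2) in auto)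
    from nn_integral_has_integral_lebesgue[OF _ this]
    have "(\<integral>\<^sup>+t. ennreal (indicator {0..1} t * t powr (a - r - 1)) \<partial>lborel) < \<infinity>" by simp
    moreover have "ennreal (t powr (a - r - 1)) * indicator {0..1} t = ennreal (indicator {0..1} t * t powr (a - r - 1))" for t
      by (auto simp: indicator_def)
    ultimately show ?thesis by simp
  qed
  have 2: "(\<integral>\<^sup>+t. ennreal (t powr (b - r - 1)) * indicator {1..} t \<partial>lborel) < \<infinity>"
  proof -
    have "((\<lambda>t. t powr (b - r - 1)) has_integral - (1 powr (b - r - 1 + 1)) / (b - r - 1 + 1)) {1..}"
      by (rule has_integral_powr_to_inf) (use large(2) in auto)
    from nn_integral_has_integral_lebesgue[OF _ this]
    have "(\<integral>\<^sup>+t. ennreal (indicator {1..} t * t powr (b - r - 1)) \<partial>lborel) < \<infinity>" by simp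
    moreover have "ennreal (t powr (b - r - 1)) * indicator {1..} t = ennreal (indicator {1..} t * t powr (b - r - 1))" for t
      by (auto simp: indicator_def)
    ultimately show ?thesis by simp
  qed
  have "I \<le> (\<integral>\<^sup>+t. ennreal C * (ennreal (t powr (a - r - 1)) * indicator {0..1} t) + ennreal C * (ennreal (t powr (b - r - 1)) * indicator {1..} t) \<partial>lborel)"
    unfolding I_def
  proof (intro nn_integral_mono)
    fix t :: real
    have pw: "t powr c * t powr (- r - 1) = t powr (c - r - 1)" for c
    proof -
      have "c + (- r - 1) = c - r - 1" by simp
      then show ?thesis by (metis powr_add)
    qed
    have "k t * t powr (- r - 1) \<le> C * t powr (a - r - 1)" if "0 < t" "t \<le> 1"
      using mult_right_mono[OF small(1)[OF that], of "t powr (- r - 1)"] by (simp add: mult.assoc pw)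
    moreover have "k t * t powr (- r - 1) \<le> C * t powr (b - r - 1)" if "1 \<le> t"
      using mult_right_mono[OF large(1)[OF that], of "t powr (- r - 1)"] by (simp add: mult.assoc pw)
    ultimately show "ennreal (k t * t powr (- r - 1)) * indicator {0<..} t \<le>
        ennreal C * (ennreal (t powr (a - r - 1)) * indicator {0..1} t) + ennreal C * (ennreal (t powr (b - r - 1)) * indicator {1..} t)"
      using C by (cases "t \<le> 1"; cases "t = 1") (auto simp: indicator_def ennreal_leI add_increasing2 simp flip: ennreal_mult)
  qed
  also have "\<dots> < \<infinity>"
    using 1 2 by (subst nn_integral_add) (auto simp: nn_integral_cmult ennreal_mult_less_top)
  finally have fin: "I < \<infinity>" .
  moreover have "I \<noteq> 0"
  proof
    assume "I = 0"
    then have "emeasure lborel {t \<in> space lborel. ennreal (k t * t powr (- r - 1)) * indicator {0<..} t \<noteq> 0} = 0"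
      unfolding I_def by (subst (asm) nn_integral_0_iff) auto
    moreover have "emeasure lborel {4..5::real} \<le>
        emeasure lborel {t \<in> space lborel. ennreal (k t * t powr (- r - 1)) * indicator {0<..} t \<noteq> 0}"
    proof (rule emeasure_mono)
      have "k t * t powr (- r - 1) > 0" if "t \<in> {4..5}" for t
        using pos[OF that] that by (intro mult_pos_pos) auto
      then show "{4..5} \<subseteq> {t \<in> space lborel. ennreal (k t * t powr (- r - 1)) * indicator {0<..} t \<noteq> 0}"
        by (fastforce simp: indicator_def ennreal_eq_0_iff)
    qed measurable
    ultimately have "emeasure lborel {4..5::real} = 0" by simp
    then show False by simp
  qed
  ultimately obtain K where "I = ennreal K" "K \<ge> 0" "I \<noteq> 0" by (cases I) auto
  then show ?thesis using that[of K] unfolding I_def by (cases "K = 0") auto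
qed

lemma sign_sum_moment_le_via_kernel:
  fixes k :: "real \<Rightarrow> real"
  assumes [measurable]: "k \<in> borel_measurable borel" and even: "\<And>x. k (- x) = k x"
    and k0: "k 0 = 0" and nn: "\<And>x. 0 \<le> k x" and \<mu>: "\<bar>\<mu>\<bar> \<le> 1" and K: "K > 0" and r: "r > -1"
    and K_eq: "(\<integral>\<^sup>+t\<in>{0<..}. ennreal (k t * t powr (- r - 1)) \<partial>lborel) = ennreal K"
    and le: "(\<integral>\<^sup>+t\<in>{0<..}. ennreal (sign_sum_mean \<mu> m (\<lambda>x. k (t * x)) * t powr (- r - 1)) \<partial>lborel) \<le>
      (\<integral>\<^sup>+t\<in>{0<..}. (\<integral>\<^sup>+z. ennreal (k (t * (sqrt m * z)) * std_normal_density z) \<partial>lborel) * ennreal (t powr (- r - 1)) \<partial>lborel)"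
  shows "sign_sum_mean \<mu> m (\<lambda>x. \<bar>x\<bar> powr r) \<le> real m powr (r / 2) * normal_abs_moment r"
proof -
  have "ennreal (K * sign_sum_mean \<mu> m (\<lambda>x. \<bar>x\<bar> powr r)) \<le> ennreal (K * (sqrt m powr r * normal_abs_moment r))"
    using le sign_sum_mean_kernel[OF assms(1-5) _ K_eq, of m] normal_kernel[OF assms(1-4) _ r _ K_eq, of "sqrt m"] K
    by simp
  then have "K * sign_sum_mean \<mu> m (\<lambda>x. \<bar>x\<bar> powr r) \<le> K * (sqrt m powr r * normal_abs_moment r)"
    using K normal_abs_moment_pos[OF r] by (subst (asm) ennreal_le_iff) auto
  then have "sign_sum_mean \<mu> m (\<lambda>x. \<bar>x\<bar> powr r) \<le> sqrt m powr r * normal_abs_moment r"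
    using K by simp
  also have "sqrt m powr r = real m powr (r / 2)"
    by (cases "m = 0") (simp_all add: powr_half_sqrt[symmetric] powr_powr)
  finally show ?thesis .
qed

lemma nn_integral_normal_density_scale:
  fixes f :: "real \<Rightarrow> real"
  assumes [measurable]: "f \<in> borel_measurable borel" and \<sigma>: "\<sigma> > 0"
  shows "(\<integral>\<^sup>+x. ennreal (f x * normal_density 0 \<sigma> x) \<partial>lborel) =
    (\<integral>\<^sup>+z. ennreal (f (\<sigma> * z) * std_normal_density z) \<partial>lborel)"
proof -
  have d: "\<sigma> * normal_density 0 \<sigma> (\<sigma> * z) = std_normal_density z" for z
    using \<sigma> by (simp add: normal_density_def real_sqrt_mult power_mult_distrib)
  have "ennreal \<sigma> * ennreal (f (\<sigma> * z) * normal_density 0 \<sigma> (\<sigma> * z)) = ennreal (f (\<sigma> * z) * std_normal_density z)" for z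
  proof -
    have "\<sigma> * (f (\<sigma> * z) * normal_density 0 \<sigma> (\<sigma> * z)) = f (\<sigma> * z) * std_normal_density z"
      unfolding d[symmetric] by (rule mult.left_commute)
    with ennreal_mult'[of \<sigma> "f (\<sigma> * z) * normal_density 0 \<sigma> (\<sigma> * z)"] \<sigma> show ?thesis
      by (simp only:)
  qed
  then show ?thesis
    using \<sigma> by (subst nn_integral_real_affine[where c = \<sigma> and t = 0]) (auto simp flip: nn_integral_cmult)
qed

section \<open>Gaussian integrals of the kernels and first Taylor bounds\<close>

lemma integral_cos_std_normal:
  "has_bochner_integral lborel (\<lambda>z. std_normal_density z * cos (a * z)) (exp (- a\<^sup>2 / 2))"
proof -
  have int: "integrable lborel (\<lambda>z. std_normal_density z * cos (a * z))"
    by (rule Bochner_Integration.integrable_bound[of lborel "normal_density 0 1"])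
      (auto simp: abs_mult mult_left_le)
  interpret real_distribution std_normal_distribution by (rule real_dist_normal_dist)
  have i: "integrable std_normal_distribution (\<lambda>x. iexp (a * x))"
    by (rule integrable_const_bound[where B = 1]) auto
  have "exp (- a\<^sup>2 / 2) = Re (char std_normal_distribution a)"
    unfolding char_std_normal_distribution by (simp only: Re_complex_of_real)
  also have "\<dots> = (\<integral>x. Re (iexp (a * x)) \<partial>std_normal_distribution)"
    unfolding char_def using i by (rule integral_Re[symmetric])
  also have "\<dots> = (\<integral>z. std_normal_density z * cos (a * z) \<partial>lborel)"
    by (subst integral_density) (auto simp: Re_exp)
  finally show ?thesis using int by (simp add: has_bochner_integral_iff)
qed

lemma integral_power2_std_normal:
  "has_bochner_integral lborel (\<lambda>z. std_normal_density z * (a * z) ^ 2) (a ^ 2)"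
proof -
  have "has_bochner_integral lborel (\<lambda>z. a ^ 2 * (std_normal_density z * z ^ (2 * 1))) (a ^ 2 * (fact (2 * 1) / (2 ^ 1 * fact 1)))"
    by (intro has_bochner_integral_mult_right std_normal_moment_even)
  then show ?thesis by (simp add: power_mult_distrib mult_ac)
qed

lemma integral_power4_std_normal:
  "has_bochner_integral lborel (\<lambda>z. std_normal_density z * (a * z) ^ 4) (3 * a ^ 4)"
proof -
  have "has_bochner_integral lborel (\<lambda>z. a ^ 4 * (std_normal_density z * z ^ (2 * 2))) (a ^ 4 * (fact (2 * 2) / (2 ^ 2 * fact 2)))"
    by (intro has_bochner_integral_mult_right std_normal_moment_even)
  then show ?thesis by (simp add: power_mult_distrib mult_ac fact_numeral)
qed

lemma cos_le_taylor4: "cos x \<le> 1 - x\<^sup>2 / 2 + x ^ 4 / 24" for x :: real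
proof -
  obtain t where "cos x = (\<Sum>m<4. cos_coeff m * x ^ m) + (cos (t + 1/2 * real 4 * pi) / fact 4) * x ^ 4"
    using Maclaurin_cos_expansion[of x 4] by blast
  moreover have "(\<Sum>m<4. cos_coeff m * x ^ m) = 1 - x\<^sup>2 / 2"
  proof -
    have "{..<4} = {0, 1, 2, 3::nat}" by auto
    then show ?thesis by (simp add: cos_coeff_def fact_numeral)
  qed
  moreover have "cos (t + 1/2 * real 4 * pi) * x ^ 4 \<le> 1 * x ^ 4"
    by (intro mult_right_mono) auto
  ultimately show ?thesis by (simp add: fact_numeral)
qed

lemma nonneg_if_deriv_nonneg:
  fixes f :: "real \<Rightarrow> real"
  assumes "\<And>x. 0 \<le> x \<Longrightarrow> (f has_real_derivative f' x) (at x)" "\<And>x. 0 \<le> x \<Longrightarrow> 0 \<le> f' x" "0 \<le> f 0" "0 \<le> x"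
  shows "0 \<le> f x"
  using DERIV_nonneg_imp_nondecreasing[of 0 x f] assms by force

lemma exp_minus_le_taylor2:
  assumes "0 \<le> (y::real)"
  shows "exp (- y) \<le> 1 - y + y\<^sup>2 / 2"
proof -
  have "0 \<le> 1 - y + y\<^sup>2 / 2 - exp (- y)"
  proof (rule nonneg_if_deriv_nonneg[where f = "\<lambda>y. 1 - y + y\<^sup>2 / 2 - exp (- y)" and f' = "\<lambda>y. - 1 + y + exp (- y)"])
    show "((\<lambda>y. 1 - y + y\<^sup>2 / 2 - exp (- y)) has_real_derivative - 1 + y + exp (- y)) (at y)" for y :: real
      by (auto intro!: derivative_eq_intros)
    show "0 \<le> - 1 + y + exp (- y)" for y :: real using exp_ge_add_one_self[of "- y"] by simp
  qed (use assms in auto)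
  then show ?thesis by simp
qed

lemma Gamma_half_integers: "Gamma (3 / 2 :: real) = sqrt pi / 2" "Gamma (5 / 2 :: real) = 3 / 4 * sqrt pi"
proof -
  have 1: "(1 / 2 :: real) \<notin> \<int>\<^sub>\<le>\<^sub>0" and 2: "(3 / 2 :: real) \<notin> \<int>\<^sub>\<le>\<^sub>0"
    by (auto dest: nonpos_Ints_nonpos)
  show "Gamma (3 / 2 :: real) = sqrt pi / 2"
    using Gamma_plus1[OF 1] by (simp add: Gamma_one_half_real)
  then show "Gamma (5 / 2 :: real) = 3 / 4 * sqrt pi"
    using Gamma_plus1[OF 2] by simp
qed

text \<open>\<open>2 powr (r / 2) / 2\<close> is the moment of the sum of two unbiased signs divided
  by its variance to the power \<open>r / 2\<close>; this settles \<open>m = 2\<close> for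
  \<open>2 < r < 4\<close>.\<close>

lemma normal_abs_moment_ge_powr:
  assumes "r \<ge> 2"
  shows "2 powr (r / 2) / 2 \<le> normal_abs_moment r"
proof -
  have "Gamma (3 / 2) \<le> Gamma ((r + 1) / 2)"
    using Gamma_real_strict_mono[of "3 / 2" "(r + 1) / 2"] assms by (cases "r = 2") auto
  moreover have "Gamma (3 / 2 :: real) = sqrt pi / 2"
    by (rule Gamma_half_integers)
  ultimately have "2 powr (r / 2) * (sqrt pi / 2) \<le> 2 powr (r / 2) * Gamma ((r + 1) / 2)"
    by (intro mult_left_mono) auto
  then show ?thesis
    by (simp add: normal_abs_moment_def field_simps)
qed

lemma normal_abs_moment_ge_1: "r \<ge> 2 \<Longrightarrow> 1 \<le> normal_abs_moment r"
  using normal_abs_moment_ge_powr[of r] powr_mono[of 1 "r / 2" 2] by simp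

text \<open>4 / 3 is the maximum of \<open>(1 - y) * (1 + 3 * y)\<close>, the estimate for one sign
  when \<open>3 < r \<le> 4\<close>.\<close>

lemma normal_abs_moment_ge_3:
  assumes "r \<ge> 3"
  shows "4 / 3 \<le> normal_abs_moment r"
proof -
  have "Gamma 2 \<le> Gamma ((r + 1) / 2)"
    using Gamma_real_strict_mono[of 2 "(r + 1) / 2"] assms by (cases "r = 3") auto
  moreover have "Gamma (2::real) = 1" using Gamma_fact[of 1, where 'a = real] by simp
  ultimately have G: "1 \<le> Gamma ((r + 1) / 2)" by simp
  have "2 powr (3 / 2) \<le> (2::real) powr (r / 2)" using assms by (intro powr_mono) auto
  moreover have "2 powr (3 / 2 :: real) = 2 * sqrt 2"
    using powr_add[of "2::real" 1 "1 / 2"] by (simp add: powr_half_sqrt)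
  ultimately have "2 * sqrt 2 * 1 \<le> 2 powr (r / 2) * Gamma ((r + 1) / 2)"
    using G by (intro mult_mono) auto
  then have "2 * sqrt 2 \<le> sqrt pi * normal_abs_moment r"
    by (simp add: normal_abs_moment_def)
  moreover have "4 / 3 * sqrt pi \<le> 2 * sqrt 2"
  proof (rule power2_le_imp_le)
    have "pi \<le> 4" using pi_approx by simp
    then show "(4 / 3 * sqrt pi)\<^sup>2 \<le> (2 * sqrt 2)\<^sup>2" by (simp add: power_mult_distrib power_divide)
  qed simp
  ultimately have "sqrt pi * (4 / 3) \<le> sqrt pi * normal_abs_moment r" by linarith
  then show ?thesis by (simp only: mult_le_cancel_left_pos real_sqrt_gt_zero pi_gt_zero)
qed

lemma normal_abs_moment_ge_4:
  assumes "r \<ge> 4"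
  shows "3 \<le> normal_abs_moment r"
proof -
  have "Gamma (5 / 2) \<le> Gamma ((r + 1) / 2)"
    using Gamma_real_strict_mono[of "5 / 2" "(r + 1) / 2"] assms by (cases "r = 4") auto
  moreover have "Gamma (5 / 2 :: real) = 3 / 4 * sqrt pi"
    by (rule Gamma_half_integers)
  moreover have "2 powr 2 \<le> (2::real) powr (r / 2)" using assms by (intro powr_mono) auto
  ultimately have "4 * (3 / 4 * sqrt pi) \<le> 2 powr (r / 2) * Gamma ((r + 1) / 2)"
    by (intro mult_mono) auto
  then show ?thesis
    by (simp add: normal_abs_moment_def field_simps)
qed

lemma powr_le_affine:
  fixes y :: real
  assumes "0 \<le> y" "0 \<le> \<theta>" "\<theta> \<le> 1"
  shows "y powr \<theta> \<le> 1 + \<theta> * (y - 1)"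
proof (cases "y = 0")
  case False
  then show ?thesis
    using Youngs_inequality_0[of \<theta> "1 - \<theta>" y 1] assms by (simp add: algebra_simps)
qed (use assms in auto)

text \<open>For one sign the moment is interpolated between integer ones.\<close>
lemma single_sign_moment_le:
  assumes \<mu>: "\<bar>\<mu>\<bar> \<le> 1" and r: "1 < r" "r \<le> real q + 1" and q: "q > 0"
    and ge1: "1 \<le> ((1 - \<mu>) ^ q + (1 + \<mu>) ^ q) / 2"
  shows "sign_sum_mean \<mu> 1 (\<lambda>x. \<bar>x\<bar> powr r) \<le> (1 - \<mu>\<^sup>2) * (((1 - \<mu>) ^ q + (1 + \<mu>) ^ q) / 2)"
proof -
  define \<theta> where "\<theta> = (r - 1) / real q"
  have \<theta>: "0 \<le> \<theta>" "\<theta> \<le> 1" using r q by (auto simp: \<theta>_def field_simps)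
  have p: "x powr (r - 1) \<le> 1 + \<theta> * (x ^ q - 1)" if "x \<ge> 0" for x :: real
  proof -
    have "x powr (r - 1) = (x powr real q) powr \<theta>" using q by (simp add: powr_powr \<theta>_def)
    also have "x powr real q = x ^ q" using that q by (cases "x = 0") (simp_all add: powr_realpow)
    also have "(x ^ q) powr \<theta> \<le> 1 + \<theta> * (x ^ q - 1)" using \<theta> that by (intro powr_le_affine) auto
    finally show ?thesis .
  qed
  have pr: "x powr r = x * x powr (r - 1)" if "x \<ge> 0" for x :: real
    using that powr_mult_base[of x "r - 1"] by simp
  have "\<bar>0 - (1 + \<mu>)\<bar> = 1 + \<mu>" "\<bar>0 + (1 - \<mu>)\<bar> = 1 - \<mu>" using \<mu> by auto
  then have "sign_sum_mean \<mu> 1 (\<lambda>x. \<bar>x\<bar> powr r) = (1 + \<mu>) / 2 * (1 - \<mu>) powr r + (1 - \<mu>) / 2 * (1 + \<mu>) powr r"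
    unfolding One_nat_def sign_sum_mean.simps by (simp only:)
  \<comment> \<open>One factor of each power combines with the weight to
    \<open>(1 - \<mu>\<^sup>2) / 2\<close>; this lowers the order to \<open>r - 1\<close> and makes
    the weights equal.\<close>
  also have "\<dots> = (1 - \<mu>\<^sup>2) / 2 * ((1 - \<mu>) powr (r - 1) + (1 + \<mu>) powr (r - 1))"
    using \<mu> by (simp add: pr power2_eq_square field_simps)
  also have "\<dots> \<le> (1 - \<mu>\<^sup>2) / 2 * ((1 + \<theta> * ((1 - \<mu>) ^ q - 1)) + (1 + \<theta> * ((1 + \<mu>) ^ q - 1)))"
    using \<mu> by (intro mult_left_mono add_mono p) (auto simp: abs_square_le_1)
  also have "\<dots> = (1 - \<mu>\<^sup>2) * (1 + \<theta> * (((1 - \<mu>) ^ q + (1 + \<mu>) ^ q) / 2 - 1))"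
    by (simp add: field_simps)
  also have "\<dots> \<le> (1 - \<mu>\<^sup>2) * (1 + 1 * (((1 - \<mu>) ^ q + (1 + \<mu>) ^ q) / 2 - 1))"
    using \<theta> ge1 \<mu> by (intro mult_left_mono add_left_mono mult_right_mono) (auto simp: abs_square_le_1)
  finally show ?thesis by simp
qed

text \<open>With \<open>y = \<mu>\<^sup>2\<close> the interpolated moments are polynomials bounded
  by 1, 4 / 3 and 3, values that the normal moment has attained or passed at orders 2, 3 and 4. One
  sign is treated apart since the comparisons of characteristic functions below assume
  \<open>m \<ge> 2\<close>.\<close>

lemma single_sign_moment_le_normal:
  assumes \<mu>: "\<bar>\<mu>\<bar> \<le> 1" and r: "2 < r" "r \<le> 5"
  shows "sign_sum_mean \<mu> 1 (\<lambda>x. \<bar>x\<bar> powr r) \<le> normal_abs_moment r"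
proof -
  define y where "y = \<mu>\<^sup>2"
  have y: "0 \<le> y" "y \<le> 1" using \<mu> by (auto simp: y_def abs_square_le_1)
  consider "r \<le> 3" | "3 < r" "r \<le> 4" | "4 < r" by linarith
  then show ?thesis
  proof cases
    case 1
    have e: "((1 - \<mu>) ^ 2 + (1 + \<mu>) ^ 2) / 2 = 1 + y" by (simp add: y_def power2_eq_square field_simps)
    have "sign_sum_mean \<mu> 1 (\<lambda>x. \<bar>x\<bar> powr r) \<le> (1 - y) * (1 + y)"
      using single_sign_moment_le[OF \<mu>, of r 2] 1 r y unfolding e by (simp add: y_def)
    also have "\<dots> \<le> 1" by (simp add: algebra_simps)
    also have "\<dots> \<le> normal_abs_moment r" using r by (intro normal_abs_moment_ge_1) auto
    finally show ?thesis .
  next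
    case 2
    have e: "((1 - \<mu>) ^ 3 + (1 + \<mu>) ^ 3) / 2 = 1 + 3 * y" by (simp add: y_def power2_eq_square power3_eq_cube field_simps)
    have "sign_sum_mean \<mu> 1 (\<lambda>x. \<bar>x\<bar> powr r) \<le> (1 - y) * (1 + 3 * y)"
      using single_sign_moment_le[OF \<mu>, of r 3] 2 r y unfolding e by (simp add: y_def)
    also have "\<dots> \<le> 4 / 3" using zero_le_power2[of "3 * y - 1"] by (simp add: power2_eq_square algebra_simps)
    also have "\<dots> \<le> normal_abs_moment r" using 2 by (intro normal_abs_moment_ge_3) auto
    finally show ?thesis .
  next
    case 3
    have e: "((1 - \<mu>) ^ 4 + (1 + \<mu>) ^ 4) / 2 = 1 + 6 * y + y\<^sup>2" by (simp add: y_def power2_eq_square power4_eq_xxxx field_simps)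
    have "sign_sum_mean \<mu> 1 (\<lambda>x. \<bar>x\<bar> powr r) \<le> (1 - y) * (1 + 6 * y + y\<^sup>2)"
      using single_sign_moment_le[OF \<mu>, of r 4] 3 r y unfolding e by (simp add: y_def)
    also have "\<dots> \<le> 3"
    proof -
      have "0 \<le> y * (y * y)" using y by simp
      then show ?thesis
        using zero_le_power2[of "2 * y - 1"] by (simp add: power2_eq_square algebra_simps)
    qed
    also have "\<dots> \<le> normal_abs_moment r" using 3 by (intro normal_abs_moment_ge_4) auto
    finally show ?thesis .
  qed
qed

text \<open>Order 4 follows from the exact fourth moment. Neither cosine kernel can be used: the
  integral for the first diverges at 0 and that for the second at infinity.\<close>

lemma sign_sum_moment_le_4:
  assumes \<mu>: "\<bar>\<mu>\<bar> \<le> 1" and m: "m \<ge> 1"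
  shows "sign_sum_mean \<mu> m (\<lambda>x. \<bar>x\<bar> powr 4) \<le> real m powr (4 / 2) * normal_abs_moment 4"
proof -
  define v where "v = 1 - \<mu>\<^sup>2"
  have v: "0 \<le> v" "v \<le> 1" using \<mu> by (auto simp: v_def abs_square_le_1)
  have v2: "v\<^sup>2 \<le> 1" using v by (simp add: power_le_one)
  have "sign_sum_mean \<mu> m (\<lambda>x. \<bar>x\<bar> powr 4) = 3 * (real m)\<^sup>2 * v\<^sup>2 + real m * v * (4 - 6 * v)"
    using sign_sum_mean_power4[of \<mu> m] by (simp add: v_def)
  also have "\<dots> \<le> 3 * (real m)\<^sup>2"
  proof -
    have "real m * (3 * (1 - v\<^sup>2)) \<ge> 1 * (3 * (1 - v\<^sup>2))" using m v2 by (intro mult_right_mono) auto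
    moreover have "3 * (1 - v\<^sup>2) \<ge> v * (4 - 6 * v)"
      using zero_le_power2[of "3 * v - 2"] by (simp add: power2_eq_square algebra_simps)
    ultimately have "real m * (v * (4 - 6 * v)) \<le> real m * (real m * (3 * (1 - v\<^sup>2)))"
      by (intro mult_left_mono) auto
    then show ?thesis by (simp add: power2_eq_square algebra_simps)
  qed
  also have "\<dots> \<le> real m powr 2 * normal_abs_moment 4"
    using normal_abs_moment_ge_4[of 4] by (simp add: mult.commute[of 3] mult_left_mono)
  finally show ?thesis by simp
qed

section \<open>Moments of order between 2 and 4\<close>

text \<open>Bound \<open>\<bar>cos\<bar> ^ m\<close> by \<open>q = (cos\<^sup>2 + cos ^ 4) / 2\<close>, whose mean is \<open>7 / 16\<close>, and integrate
  \<open>q t / t ^ 3\<close> by parts twice. The remainder \<open>- 12 * R t / t ^ 5\<close> is negative; on the first period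
  it is estimated with the cubic Taylor polynomial \<open>p\<close> of \<open>(pi / t) ^ 5\<close> at \<open>pi\<close>, since
  dropping it would be too lossy.\<close>
lemma nn_integral_cos_power_tail:
  assumes m: "m \<ge> 3"
  defines "\<alpha> \<equiv> 1 / pi"
  shows "(\<integral>\<^sup>+t\<in>{pi / 2..}. ennreal (\<bar>cos t\<bar> ^ m * inverse t ^ 3) \<partial>lborel) \<le>
    ennreal (7 / 8 * \<alpha>\<^sup>2 - 189 / 64 * \<alpha> ^ 4 + 315 / 32 * \<alpha> ^ 6)"
proof -
  define q where "q t = ((cos t)\<^sup>2 + cos t ^ 4) / 2" for t :: real
  \<comment> \<open>\<open>Q\<close> is a primitive of \<open>q - 7 / 16\<close> and
    \<open>- R\<close> one of \<open>Q\<close>; the constant in \<open>R\<close> makes it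
    nonnegative and zero where the cosine vanishes. The two integrations by parts yield
    \<open>- W\<close> as a primitive of \<open>W'\<close>.\<close>
  define Q where "Q t = sin t * cos t * (7 + 2 * (cos t)\<^sup>2) / 16" for t :: real
  define R where "R t = (cos t)\<^sup>2 * (7 + (cos t)\<^sup>2) / 32" for t :: real
  define p where "p t = 1 - 5 * \<alpha> * (t - pi) + 15 * \<alpha>\<^sup>2 * (t - pi)\<^sup>2 - 35 * \<alpha> ^ 3 * (t - pi) ^ 3" for t
  \<comment> \<open>A primitive of \<open>(cos t)\<^sup>2 * p t\<close>, from integrating by parts
    until the cubic \<open>p\<close> is differentiated away.\<close>
  define A where "A t = ((t - pi) - 5 / 2 * \<alpha> * (t - pi)\<^sup>2 + 5 * \<alpha>\<^sup>2 * (t - pi) ^ 3 - 35 / 4 * \<alpha> ^ 3 * (t - pi) ^ 4) / 2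
      + p t * (sin t * cos t) / 2
      + (- 5 * \<alpha> + 30 * \<alpha>\<^sup>2 * (t - pi) - 105 * \<alpha> ^ 3 * (t - pi)\<^sup>2) * (2 * (cos t)\<^sup>2 - 1) / 8
      - (30 * \<alpha>\<^sup>2 - 210 * \<alpha> ^ 3 * (t - pi)) * (sin t * cos t) / 8
      + 210 * \<alpha> ^ 3 * (2 * (cos t)\<^sup>2 - 1) / 32" for t
  define W where "W t = 7 / 32 * (inverse t)\<^sup>2 - Q t * inverse t ^ 3 + 3 * R t * inverse t ^ 4" for t
  define W' where "W' t = q t * inverse t ^ 3 + 12 * R t * inverse t ^ 5" for t
  have pos: "0 < \<alpha>" "\<alpha> * pi = 1" by (simp_all add: \<alpha>_def)
  have q0: "0 \<le> q t" for t by (simp add: q_def)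
  have R0: "0 \<le> R t" for t by (simp add: R_def)
  have cos_le_q: "\<bar>cos t\<bar> ^ m \<le> q t" for t :: real
  proof -
    have "\<bar>cos t\<bar> ^ m \<le> \<bar>cos t\<bar> ^ 3" using m by (intro power_decreasing) auto
    also have "\<dots> \<le> (\<bar>cos t\<bar> ^ 2 + \<bar>cos t\<bar> ^ 4) / 2"
    proof -
      have "c ^ 3 \<le> (c ^ 2 + c ^ 4) / 2" for c :: real
      proof -
        have "(c - c\<^sup>2)\<^sup>2 = c ^ 2 - 2 * c ^ 3 + c ^ 4" by algebra
        with zero_le_power2[of "c - c\<^sup>2"] have "0 \<le> c ^ 2 - 2 * c ^ 3 + c ^ 4" by (simp only:)
        moreover have "y \<le> (x + z) / 2" if "0 \<le> x - 2 * y + z" for x y z :: real using that by simp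
        ultimately show ?thesis by blast
      qed
      then show ?thesis .
    qed
    also have "\<dots> = q t" by (simp add: q_def power_even_abs)
    finally show ?thesis .
  qed
  have dQ: "(Q has_real_derivative q t - 7 / 16) (at t)" for t
    unfolding Q_def q_def
    apply (auto intro!: derivative_eq_intros)
    using sin_cos_squared_add[of t] apply algebra
    done
  have dR: "(R has_real_derivative - Q t) (at t)" for t
    unfolding Q_def R_def
    by (auto intro!: derivative_eq_intros simp: power2_eq_square algebra_simps)
  have dW: "((\<lambda>t. - W t) has_real_derivative W' t) (at t)" if "t > 0" for t
    unfolding W_def W'_def
    using that by (auto intro!: derivative_eq_intros dQ dR simp: field_simps power_numeral_reduce)
  have dA: "(A has_real_derivative (cos t)\<^sup>2 * p t) (at t)" for t
    unfolding A_def p_def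
    apply (auto intro!: derivative_eq_intros)
    using sin_cos_squared_add[of t] apply algebra
    done
  have [measurable]: "q \<in> borel_measurable borel" "R \<in> borel_measurable borel" "p \<in> borel_measurable borel"
    unfolding q_def R_def p_def by measurable
  have [measurable]: "W' \<in> borel_measurable borel" unfolding W'_def by measurable
  have W'_ge: "q t * inverse t ^ 3 \<le> W' t" if "t > 0" for t
    using that R0[of t] by (simp add: W'_def)
  \<comment> \<open>Dropping the fourth power of the cosine from \<open>12 * R t\<close> leaves
    \<open>21 / 8 * (cos t)\<^sup>2\<close>, and \<open>p t\<close> is below
    \<open>(pi / t) ^ 5\<close>. What is subtracted from \<open>W'\<close> is thus an explicit part
    of the surplus \<open>12 * R t / t ^ 5\<close>.\<close>
  define V where "V t = W t + 21 / 8 * \<alpha> ^ 5 * A t" for t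
  define V' where "V' t = W' t - 21 / 8 * \<alpha> ^ 5 * ((cos t)\<^sup>2 * p t)" for t
  have [measurable]: "V' \<in> borel_measurable borel" unfolding V'_def by measurable
  have dV: "((\<lambda>t. - V t) has_real_derivative V' t) (at t)" if "t > 0" for t
  proof -
    have "((\<lambda>t. - W t - 21 / 8 * \<alpha> ^ 5 * A t) has_real_derivative V' t) (at t)"
      unfolding V'_def by (intro DERIV_diff dW that DERIV_cmult dA)
    then show ?thesis by (simp add: V_def)
  qed
  have V'_ge: "q t * inverse t ^ 3 \<le> V' t" if "t > 0" for t
  proof -
    define y where "y = \<alpha> * t"
    have y: "y > 0" using that pos by (simp add: y_def)
    have "\<alpha> * (t - pi) = y - 1" by (simp add: y_def right_diff_distrib pos)
    then have py: "p t = 1 - 5 * (y - 1) + 15 * (y - 1)\<^sup>2 - 35 * (y - 1) ^ 3"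
      unfolding p_def by (simp only: mult.assoc power_mult_distrib[symmetric])
    \<comment> \<open>In \<open>y = t / pi\<close>, \<open>p\<close> is the cubic Taylor polynomial
      of \<open>inverse y ^ 5\<close> at 1; the factor \<open>(y - 1) ^ 4\<close> comes from the
      remainder, and its cofactor is positive.\<close>
    have "y ^ 5 * p t = 1 - (y - 1) ^ 4 * (35 * y ^ 4 + 20 * y ^ 3 + 10 * y\<^sup>2 + 4 * y + 1)"
      unfolding py by algebra
    also have "\<dots> \<le> 1" using y by simp
    finally have "\<alpha> ^ 5 * (t ^ 5 * p t) \<le> 1" by (simp add: y_def power_mult_distrib mult.assoc)
    then have "\<alpha> ^ 5 * p t \<le> inverse t ^ 5" using that by (simp add: field_simps)
    then have "(21 / 8 * (cos t)\<^sup>2) * (\<alpha> ^ 5 * p t) \<le> (21 / 8 * (cos t)\<^sup>2) * inverse t ^ 5"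
      by (intro mult_left_mono) auto
    also have "\<dots> \<le> 12 * R t * inverse t ^ 5"
      using that by (intro mult_right_mono) (auto simp: R_def algebra_simps)
    finally show ?thesis by (simp add: V'_def W'_def mult_ac)
  qed
  have nn: "0 \<le> q t * inverse t ^ 3" if "t > 0" for t using that q0[of t] by simp
  have V'0: "0 \<le> V' t" if "t > 0" for t using V'_ge[OF that] nn[OF that] by linarith
  have W'0: "0 \<le> W' t" if "t > 0" for t using W'_ge[OF that] nn[OF that] by linarith
  \<comment> \<open>The cosine vanishes at both points, hence so do \<open>Q\<close> and
    \<open>R\<close>. Between them the refined primitive \<open>- V\<close> is used, beyond
    \<open>b\<close> the plain \<open>- W\<close>.\<close>
  define a where "a = pi / 2"
  define b where "b = 3 / 2 * pi"
  have ab: "0 < a" "0 < b" "a \<le> b" by (auto simp: a_def b_def)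
  have lim: "((\<lambda>t. - W t) \<longlongrightarrow> 0) at_top"
  proof (rule Lim_null_comparison)
    show "((\<lambda>t. 2 * inverse t) \<longlongrightarrow> (0::real)) at_top"
      by (auto intro!: tendsto_mult_right_zero tendsto_inverse_0_at_top filterlim_ident)
    show "eventually (\<lambda>t. norm (- W t) \<le> 2 * inverse t) at_top"
      using eventually_ge_at_top[of 1]
    proof eventually_elim
      case (elim t)
      define i where "i = inverse t"
      have i: "0 \<le> i" "i \<le> 1" using elim by (auto simp: i_def field_simps)
      have c2: "(cos t)\<^sup>2 \<le> 1" by (simp add: abs_square_le_1)
      have "\<bar>Q t\<bar> \<le> 9 / 16"
      proof -
        have "\<bar>sin t * cos t * (7 + 2 * (cos t)\<^sup>2)\<bar> \<le> 1 * 1 * 9"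
          unfolding abs_mult using c2 by (intro mult_mono) auto
        then show ?thesis by (simp add: Q_def)
      qed
      moreover have "\<bar>R t\<bar> \<le> 1 / 4"
      proof -
        have "(cos t)\<^sup>2 * (7 + (cos t)\<^sup>2) \<le> 1 * 8" using c2 by (intro mult_mono) auto
        then show ?thesis by (simp add: R_def)
      qed
      moreover have "i ^ 2 \<le> i" "i ^ 3 \<le> i" "i ^ 4 \<le> i"
        using i power_decreasing[of 1 2 i] power_decreasing[of 1 3 i] power_decreasing[of 1 4 i] by auto
      ultimately have "\<bar>Q t\<bar> * i ^ 3 \<le> 9 / 16 * i" "\<bar>R t\<bar> * i ^ 4 \<le> 1 / 4 * i" "\<bar>i ^ 2\<bar> \<le> i"
        using i mult_mono[of "\<bar>Q t\<bar>" "9 / 16" "i ^ 3" i] mult_mono[of "\<bar>R t\<bar>" "1 / 4" "i ^ 4" i]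
        by (simp_all only: zero_le_power abs_of_nonneg abs_ge_zero)
      then have "\<bar>Q t * i ^ 3\<bar> \<le> 9 / 16 * i" "\<bar>R t * i ^ 4\<bar> \<le> 1 / 4 * i" "\<bar>i ^ 2\<bar> \<le> i"
        using i by (simp_all add: abs_mult)
      then show ?case unfolding W_def i_def[symmetric] real_norm_def using i(1) by linarith
    qed
  qed
  have Va: "V a - V b + W b = 7 / 8 * \<alpha>\<^sup>2 - 189 / 64 * \<alpha> ^ 4 + 315 / 32 * \<alpha> ^ 6"
  proof -
    have tr: "cos a = 0" "cos b = 0" "sin a = 1" "sin b = - 1"
      unfolding a_def b_def cos_3over2_pi sin_3over2_pi by simp_all
    have s: "a - pi = - (pi / 2)" "b - pi = pi / 2" by (auto simp: a_def b_def)
    have pb: "p a = p a" ..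
    have "A b - A a = 9 / 8 * pi - 15 / 4 * \<alpha>"
      unfolding A_def tr s \<alpha>_def by (simp add: field_simps power_numeral_reduce)
    moreover have "V a - V b + W b = W a - 21 / 8 * \<alpha> ^ 5 * (A b - A a)"
      unfolding V_def by algebra
    moreover have "W a = 7 / 8 * \<alpha>\<^sup>2"
      by (simp add: W_def Q_def R_def tr) (simp add: a_def \<alpha>_def power2_eq_square field_simps)
    moreover have "21 / 8 * \<alpha> ^ 5 * (9 / 8 * pi - 15 / 4 * \<alpha>) = 189 / 64 * \<alpha> ^ 4 - 315 / 32 * \<alpha> ^ 6"
    proof -
      have "\<alpha> ^ 5 * pi = \<alpha> ^ 4" using pos(2) by algebra
      then show ?thesis by (simp add: power_numeral_reduce field_simps)
    qed
    ultimately have "V a - V b + W b = 7 / 8 * \<alpha>\<^sup>2 - (189 / 64 * \<alpha> ^ 4 - 315 / 32 * \<alpha> ^ 6)"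
      by (simp only:)
    then show ?thesis by (simp only: diff_diff_eq2 diff_add_eq add_diff_eq)
  qed
  have mono: "ennreal (\<bar>cos t\<bar> ^ m * inverse t ^ 3) \<le> ennreal (q t * inverse t ^ 3)" if "t > 0" for t
    using that cos_le_q[of t] by (intro ennreal_leI mult_right_mono) auto
  have "(\<integral>\<^sup>+t\<in>{a..}. ennreal (\<bar>cos t\<bar> ^ m * inverse t ^ 3) \<partial>lborel) \<le>
      (\<integral>\<^sup>+t. ennreal (V' t) * indicator {a..b} t + ennreal (W' t) * indicator {b..} t \<partial>lborel)"
  proof (rule nn_integral_mono)
    fix t
    show "ennreal (\<bar>cos t\<bar> ^ m * inverse t ^ 3) * indicator {a..} t \<le>
        ennreal (V' t) * indicator {a..b} t + ennreal (W' t) * indicator {b..} t"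
    proof (cases "a \<le> t")
      case True
      then have t: "t > 0" using ab by linarith
      have "ennreal (q t * inverse t ^ 3) \<le> ennreal (V' t)" "ennreal (q t * inverse t ^ 3) \<le> ennreal (W' t)"
        using V'_ge[OF t] W'_ge[OF t] by (auto intro: ennreal_leI)
      then have "ennreal (\<bar>cos t\<bar> ^ m * inverse t ^ 3) \<le> ennreal (V' t)" "ennreal (\<bar>cos t\<bar> ^ m * inverse t ^ 3) \<le> ennreal (W' t)"
        using mono[OF t] by (auto intro: order_trans)
      then show ?thesis using True
        by (cases "t \<le> b") (auto simp: indicator_def intro: add_increasing2)
    qed simp
  qed
  also have "\<dots> = ennreal (- V b - - V a) + ennreal (0 - - W b)"
  proof -
    have "(\<integral>\<^sup>+t. ennreal (V' t) * indicator {a..b} t \<partial>lborel) = ennreal (- V b - - V a)"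
    proof (rule nn_integral_FTC_Icc[where F = "\<lambda>t. - V t"])
      fix x assume "x \<in> {a..b}"
      then have "x > 0" using ab by simp
      then show "((\<lambda>t. - V t) has_real_derivative V' x) (at x)" "0 \<le> V' x" by (rule dV V'0)+
    qed (use ab in auto)
    moreover have "(\<integral>\<^sup>+t. ennreal (W' t) * indicator {b..} t \<partial>lborel) = ennreal (0 - - W b)"
    proof (rule nn_integral_FTC_atLeast[where F = "\<lambda>t. - W t"])
      fix x assume "b \<le> x"
      then have "x > 0" using ab by linarith
      then show "((\<lambda>t. - W t) has_real_derivative W' x) (at x)" "0 \<le> W' x" by (rule dW W'0)+
    qed (use lim in auto)
    ultimately show ?thesis by (subst nn_integral_add) auto
  qed
  also have "\<dots> = ennreal (V a - V b + W b)"
  proof -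
    have "- V a \<le> - V b"
    proof (rule DERIV_nonneg_imp_nondecreasing[OF ab(3)])
      fix x assume "a \<le> x" "x \<le> b"
      then have "x > 0" using ab by linarith
      then show "\<exists>y. ((\<lambda>t. - V t) has_real_derivative y) (at x) \<and> 0 \<le> y" using dV V'0 by blast
    qed
    moreover have "0 \<le> W b"
      unfolding W_def Q_def R_def b_def cos_3over2_pi by simp
    ultimately show ?thesis by (simp add: ennreal_plus[symmetric] del: ennreal_plus)
  qed
  finally show ?thesis unfolding Va by (simp add: a_def)
qed

text \<open>Formally, \<open>ln (cos t)\<close> has derivative \<open>- tan t\<close>, and
  \<open>tan t \<ge> t + t ^ 3 / 3\<close> integrates to the claim. Everything is multiplied out by
  the cosine, which removes the singularity at \<open>pi / 2\<close>.\<close>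

lemma cos_le_gauss_quartic:
  assumes "0 \<le> t" "t \<le> pi"
  shows "cos t \<le> exp (- t\<^sup>2 / 2 - t ^ 4 / 12)"
proof -
  have s1: "x * cos x \<le> sin x" if "0 \<le> x" "x \<le> pi" for x
  proof -
    have "sin 0 - 0 * cos 0 \<le> sin x - x * cos x"
    proof (rule DERIV_nonneg_imp_nondecreasing[OF that(1)])
      fix y assume "0 \<le> y" "y \<le> x"
      then show "\<exists>z. ((\<lambda>x. sin x - x * cos x) has_real_derivative z) (at y) \<and> 0 \<le> z"
        using that by (intro exI[of _ "y * sin y"]) (auto intro!: derivative_eq_intros sin_ge_zero mult_nonneg_nonneg)
    qed
    then show ?thesis by simp
  qed
  have s2: "cos x * (x + x ^ 3 / 3) \<le> sin x" if "0 \<le> x" "x \<le> pi" for x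
  proof -
    have "sin 0 - cos 0 * (0 + 0 ^ 3 / 3) \<le> sin x - cos x * (x + x ^ 3 / 3)"
    proof (rule DERIV_nonneg_imp_nondecreasing[OF that(1)])
      fix y assume y: "0 \<le> y" "y \<le> x"
      have "0 \<le> y * (sin y - y * cos y)" "0 \<le> sin y * y ^ 3 / 3"
        using y that s1[of y] sin_ge_zero[of y] by (auto intro!: mult_nonneg_nonneg)
      then show "\<exists>z. ((\<lambda>x. sin x - cos x * (x + x ^ 3 / 3)) has_real_derivative z) (at y) \<and> 0 \<le> z"
        by (intro exI[of _ "y * (sin y - y * cos y) + sin y * y ^ 3 / 3"])
          (auto intro!: derivative_eq_intros simp: power2_eq_square power3_eq_cube field_simps)
    qed
    then show ?thesis by simp
  qed
  have "- (cos 0 * exp (0\<^sup>2 / 2 + 0 ^ 4 / 12)) \<le> - (cos t * exp (t\<^sup>2 / 2 + t ^ 4 / 12))"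
  proof (rule DERIV_nonneg_imp_nondecreasing[OF assms(1)])
    fix y assume y: "0 \<le> y" "y \<le> t"
    have "0 \<le> exp (y\<^sup>2 / 2 + y ^ 4 / 12) * (sin y - cos y * (y + y ^ 3 / 3))"
      using y assms s2[of y] by (intro mult_nonneg_nonneg) auto
    then show "\<exists>z. ((\<lambda>t. - (cos t * exp (t\<^sup>2 / 2 + t ^ 4 / 12))) has_real_derivative z) (at y) \<and> 0 \<le> z"
      by (intro exI[of _ "exp (y\<^sup>2 / 2 + y ^ 4 / 12) * (sin y - cos y * (y + y ^ 3 / 3))"])
        (auto intro!: derivative_eq_intros simp: power2_eq_square power3_eq_cube field_simps)
  qed
  then have "cos t * exp (t\<^sup>2 / 2 + t ^ 4 / 12) \<le> 1" by simp
  then have "cos t \<le> inverse (exp (t\<^sup>2 / 2 + t ^ 4 / 12))" by (simp add: field_simps)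
  also have "\<dots> = exp (- t\<^sup>2 / 2 - t ^ 4 / 12)" by (simp flip: exp_minus)
  finally show ?thesis .
qed

text \<open>With \<open>z = m * t ^ 4 / 12\<close>, \<open>cos_le_gauss_quartic\<close> gives a
  factor \<open>exp (- z)\<close>; bounding it by \<open>1 - z + z\<^sup>2 / 2\<close> leaves terms
  that, divided by \<open>t ^ 3\<close>, have elementary primitives against the Gaussian.\<close>

lemma gauss_minus_cos_power_ge:
  assumes "0 \<le> t" "t \<le> pi / 2"
  shows "exp (- (real m * t\<^sup>2) / 2) * (real m * t ^ 4 / 12 - (real m)\<^sup>2 * t ^ 8 / 288) \<le>
    exp (- (real m * t\<^sup>2) / 2) - cos t ^ m"
proof -
  define z where "z = real m * t ^ 4 / 12"
  have z: "0 \<le> z" by (simp add: z_def)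
  have "cos t ^ m \<le> exp (- t\<^sup>2 / 2 - t ^ 4 / 12) ^ m"
    using assms by (intro power_mono cos_le_gauss_quartic cos_ge_zero) auto
  also have "\<dots> = exp (- (real m * t\<^sup>2) / 2) * exp (- z)"
    by (simp add: z_def algebra_simps flip: exp_of_nat_mult exp_add)
  also have "\<dots> \<le> exp (- (real m * t\<^sup>2) / 2) * (1 - z + z\<^sup>2 / 2)"
  proof (rule mult_left_mono)
    show "exp (- z) \<le> 1 - z + z\<^sup>2 / 2" using z by (rule exp_minus_le_taylor2)
  qed simp
  finally show ?thesis
    by (simp add: z_def power_divide power_mult_distrib algebra_simps flip: power_mult)
qed

lemma gauss_minus_cos_power_nonneg:
  assumes "0 \<le> t" "t \<le> pi / 2"
  shows "cos t ^ m \<le> exp (- (real m * t\<^sup>2) / 2)"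
proof -
  have "cos t ^ m \<le> exp (- t\<^sup>2 / 2) ^ m"
  proof (intro power_mono)
    have "exp (- t\<^sup>2 / 2 - t ^ 4 / 12) \<le> exp (- t\<^sup>2 / 2)" by simp
    then show "cos t \<le> exp (- t\<^sup>2 / 2)" using cos_le_gauss_quartic[of t] assms by linarith
  qed (use assms in \<open>auto intro: cos_ge_zero\<close>)
  then show ?thesis by (simp flip: exp_of_nat_mult)
qed

text \<open>The linear term integrates to \<open>1 / 12\<close> up to the Gaussian at
  \<open>pi / 2\<close>, the quadratic one to at most \<open>1 / (36 * m)\<close>, its value over
  the whole half-line. The latter stands on the right to avoid subtraction in
  \<open>ennreal\<close>.\<close>

lemma nn_integral_gauss_minus_cos_power:
  assumes m: "m \<ge> 1"
  shows "ennreal (1 / 12 - exp (- (real m * pi\<^sup>2 / 8)) / 12) \<le>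
    (\<integral>\<^sup>+t\<in>{0..pi / 2}. ennreal ((exp (- (real m * t\<^sup>2) / 2) - cos t ^ m) * inverse t ^ 3) \<partial>lborel) +
      ennreal (1 / (36 * real m))"
proof -
  define M where "M = real m"
  have M: "M \<ge> 1" using m by (simp add: M_def)
  define E where "E t = exp (- (M * t\<^sup>2) / 2)" for t :: real
  have [measurable]: "E \<in> borel_measurable borel" unfolding E_def by measurable
  have dE: "(E has_real_derivative - (M * t) * E t) (at t)" for t
    unfolding E_def by (auto intro!: derivative_eq_intros)
  have 1: "(\<integral>\<^sup>+t. ennreal (M * t / 12 * E t) * indicator {0..pi / 2} t \<partial>lborel) = ennreal (- E (pi / 2) / 12 - - E 0 / 12)"
    using M by (intro nn_integral_FTC_Icc) (auto intro!: derivative_eq_intros dE simp: E_def)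
  define B where "B t = - (M * t ^ 4 / 288 + t\<^sup>2 / 72 + 1 / (36 * M)) * E t" for t
  have dB: "(B has_real_derivative M\<^sup>2 * t ^ 5 / 288 * E t) (at t)" for t
    unfolding B_def using M by (auto intro!: derivative_eq_intros dE simp: field_simps power_numeral_reduce)
  have 2: "(\<integral>\<^sup>+t. ennreal (M\<^sup>2 * t ^ 5 / 288 * E t) * indicator {0..pi / 2} t \<partial>lborel) = ennreal (B (pi / 2) - B 0)"
    by (intro nn_integral_FTC_Icc dB) (auto simp: E_def)
  have "ennreal (1 / 12 - exp (- (real m * pi\<^sup>2 / 8)) / 12) = (\<integral>\<^sup>+t. ennreal (M * t / 12 * E t) * indicator {0..pi / 2} t \<partial>lborel)"
    unfolding 1 by (simp add: E_def M_def power_divide)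
  also have "\<dots> \<le> (\<integral>\<^sup>+t. ennreal ((exp (- (real m * t\<^sup>2) / 2) - cos t ^ m) * inverse t ^ 3) * indicator {0..pi / 2} t +
      ennreal (M\<^sup>2 * t ^ 5 / 288 * E t) * indicator {0..pi / 2} t \<partial>lborel)"
  proof (rule nn_integral_mono)
    fix t :: real
    have "M * t / 12 * E t \<le> (exp (- (real m * t\<^sup>2) / 2) - cos t ^ m) * inverse t ^ 3 + M\<^sup>2 * t ^ 5 / 288 * E t"
      if t: "0 < t" "t \<le> pi / 2"
    proof -
      have "E t * (M * t ^ 4 / 12 - M\<^sup>2 * t ^ 8 / 288) * inverse t ^ 3 \<le> (exp (- (real m * t\<^sup>2) / 2) - cos t ^ m) * inverse t ^ 3"
        using gauss_minus_cos_power_ge[of t m] t unfolding E_def M_def by (intro mult_right_mono) auto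
      moreover have "E t * (M * t ^ 4 / 12 - M\<^sup>2 * t ^ 8 / 288) * inverse t ^ 3 = M * t / 12 * E t - M\<^sup>2 * t ^ 5 / 288 * E t"
        using t by (simp add: field_simps power_numeral_reduce)
      ultimately show ?thesis by linarith
    qed
    moreover have "0 \<le> (exp (- (real m * t\<^sup>2) / 2) - cos t ^ m) * inverse t ^ 3" "0 \<le> M\<^sup>2 * t ^ 5 / 288 * E t"
      if "0 \<le> t" "t \<le> pi / 2"
      using gauss_minus_cos_power_nonneg[of t m] that by (auto simp: E_def intro!: mult_nonneg_nonneg)
    ultimately have "ennreal (M * t / 12 * E t) \<le> ennreal ((exp (- (real m * t\<^sup>2) / 2) - cos t ^ m) * inverse t ^ 3) + ennreal (M\<^sup>2 * t ^ 5 / 288 * E t)"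
      if "0 \<le> t" "t \<le> pi / 2"
      using that by (cases "t = 0") (auto simp: ennreal_plus[symmetric] simp del: ennreal_plus intro!: ennreal_leI)
    then show "ennreal (M * t / 12 * E t) * indicator {0..pi / 2} t \<le>
      ennreal ((exp (- (real m * t\<^sup>2) / 2) - cos t ^ m) * inverse t ^ 3) * indicator {0..pi / 2} t +
      ennreal (M\<^sup>2 * t ^ 5 / 288 * E t) * indicator {0..pi / 2} t"
      by (auto simp: indicator_def)
  qed
  also have "\<dots> = (\<integral>\<^sup>+t\<in>{0..pi / 2}. ennreal ((exp (- (real m * t\<^sup>2) / 2) - cos t ^ m) * inverse t ^ 3) \<partial>lborel) + ennreal (B (pi / 2) - B 0)"
    unfolding 2[symmetric] by (rule nn_integral_add) measurable
  also have "ennreal (B (pi / 2) - B 0) \<le> ennreal (1 / (36 * real m))"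
  proof (rule ennreal_leI)
    have "0 \<le> M * (pi / 2) ^ 4 / 288 + (pi / 2)\<^sup>2 / 72 + 1 / (36 * M)" using M by (intro add_nonneg_nonneg) auto
    then have "B (pi / 2) \<le> 0" unfolding B_def by (intro mult_nonpos_nonneg) (linarith, simp add: E_def)
    moreover have "B 0 = - (1 / (36 * M))" by (simp add: B_def E_def)
    ultimately show "B (pi / 2) - B 0 \<le> 1 / (36 * real m)" by (simp add: M_def)
  qed
  finally show ?thesis by (simp add: add_left_mono)
qed

text \<open>The margin is small: for \<open>m = 3\<close> the lower bound for the right side is
  about 0.072 and the tail bound about 0.0686. The leading term
  \<open>7 / 8 * (1 / pi)\<^sup>2\<close> of the latter, about 0.0887, would already be too large
  without the corrections.\<close>

lemma cos_power_tail_le_gap: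
  assumes m: "m \<ge> 3"
  shows "(\<integral>\<^sup>+t\<in>{pi / 2..}. ennreal (\<bar>cos t\<bar> ^ m * inverse t ^ 3) \<partial>lborel) \<le>
    (\<integral>\<^sup>+t\<in>{0..pi / 2}. ennreal ((exp (- (real m * t\<^sup>2) / 2) - cos t ^ m) * inverse t ^ 3) \<partial>lborel)"
    (is "?U \<le> ?L")
proof -
  define x where "x = (1 / pi)\<^sup>2"
  have x: "0 < x" "x \<le> 102 / 1000"
  proof -
    have "(314 / 100)\<^sup>2 \<le> pi\<^sup>2" using pi_approx by (intro power_mono) auto
    then show "x \<le> 102 / 1000" by (simp add: x_def power_divide field_simps)
  qed (simp add: x_def)
  define u where "u = 7 / 8 * x - 189 / 64 * x\<^sup>2 + 315 / 32 * x ^ 3"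
  have "?U \<le> ennreal u"
    using nn_integral_cos_power_tail[OF m] by (simp add: u_def x_def flip: power_mult)
  moreover have "u \<le> 1 / 12 - exp (- (real m * pi\<^sup>2 / 8)) / 12 - 1 / (36 * real m)"
  proof -
    have "exp (- (real m * pi\<^sup>2 / 8)) \<le> 1 / 20"
    proof -
      have "(314 / 100)\<^sup>2 \<le> pi\<^sup>2" using pi_approx by (intro power_mono) auto
      then have "96 / 10 \<le> pi\<^sup>2" by (simp add: power2_eq_square)
      then have "3 * (96 / 10) \<le> real m * pi\<^sup>2" using m by (intro mult_mono) auto
      then have "exp (- (real m * pi\<^sup>2 / 8)) \<le> exp (- (36 / 10))" by simp
      moreover have "20 \<le> exp (36 / 10 :: real)"
      proof -
        have "20 \<le> (13 / 10 :: real) ^ 12" by (simp add: power_divide)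
        also have "\<dots> \<le> exp (3 / 10) ^ 12" using exp_ge_add_one_self[of "3 / 10"] by (intro power_mono) auto
        also have "\<dots> = exp (36 / 10)" by (simp flip: exp_of_nat_mult)
        finally show ?thesis .
      qed
      moreover from this have "exp (- (36 / 10)) \<le> (1 / 20 :: real)" by (simp add: exp_minus field_simps)
      ultimately show ?thesis by linarith
    qed
    moreover have "1 / (36 * real m) \<le> 1 / 108" using m by (simp add: field_simps)
    moreover have "u \<le> 698 / 10000"
    proof -
      \<comment> \<open>The cubic defining \<open>u\<close> at 0.102 minus its value at
        \<open>x\<close>, with the factor \<open>102 / 1000 - x\<close> split off.\<close>
      have "(102 / 1000 - x) * (7 / 8 - 189 / 64 * (102 / 1000 + x) + 315 / 32 * ((102 / 1000)\<^sup>2 + 102 / 1000 * x + x\<^sup>2)) \<ge> 0"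
      proof (intro mult_nonneg_nonneg)
        have "0 \<le> 102 / 1000 * x" "0 \<le> x\<^sup>2" using x by auto
        then show "0 \<le> 7 / 8 - 189 / 64 * (102 / 1000 + x) + 315 / 32 * ((102 / 1000)\<^sup>2 + 102 / 1000 * x + x\<^sup>2)"
          using x by (simp add: power2_eq_square)
      qed (use x in auto)
      moreover have "(c - x) * (7 / 8 - 189 / 64 * (c + x) + 315 / 32 * (c\<^sup>2 + c * x + x\<^sup>2)) =
          (7 / 8 * c - 189 / 64 * c\<^sup>2 + 315 / 32 * c ^ 3) - u" for c
        by (simp add: u_def power2_eq_square power3_eq_cube field_simps)
      moreover have "7 / 8 * (102 / 1000) - 189 / 64 * (102 / 1000)\<^sup>2 + 315 / 32 * (102 / 1000 :: real) ^ 3 \<le> 698 / 10000"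
        by (simp add: power2_eq_square power3_eq_cube)
      ultimately show ?thesis by (simp only:)
    qed
    ultimately show ?thesis by linarith
  qed
  ultimately have "?U + ennreal (1 / (36 * real m)) \<le> ennreal (1 / 12 - exp (- (real m * pi\<^sup>2 / 8)) / 12 - 1 / (36 * real m)) + ennreal (1 / (36 * real m))"
    by (intro add_right_mono) (meson ennreal_leI order_trans)
  also have "\<dots> = ennreal (1 / 12 - exp (- (real m * pi\<^sup>2 / 8)) / 12)"
  proof (subst ennreal_plus[symmetric])
    have "exp (- (real m * pi\<^sup>2 / 8)) \<le> exp (- 1)"
    proof -
      have "3 ^ 2 \<le> pi\<^sup>2" using pi_gt3 by (intro power_mono) auto
      then have "3 * 9 \<le> real m * pi\<^sup>2" using m by (intro mult_mono) auto
      then show ?thesis by simp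
    qed
    moreover have "exp (- 1) \<le> (1 / 2 :: real)"
      using exp_ge_add_one_self[of 1] by (simp add: exp_minus field_simps)
    moreover have "1 / (36 * real m) \<le> 1 / 108" using m by (simp add: field_simps)
    ultimately show "0 \<le> 1 / 12 - exp (- (real m * pi\<^sup>2 / 8)) / 12 - 1 / (36 * real m)" by linarith
  qed auto
  also have "\<dots> \<le> ?L + ennreal (1 / (36 * real m))"
    using m by (intro nn_integral_gauss_minus_cos_power) simp
  finally show ?thesis
    by (simp add: add.commute[of _ "ennreal (1 / (36 * real m))"] ennreal_add_left_cancel_le)
qed

text \<open>The squared modulus is a convex combination of 1 and \<open>(cos t)\<^sup>2\<close>, and
  raising to the power \<open>m / 2 \<ge> 1\<close> is convex. So the biased case is bounded by the
  unbiased one weighted with the variance \<open>1 - \<mu>\<^sup>2\<close>.\<close>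

lemma Re_sign_char_power_le:
  assumes \<mu>: "\<bar>\<mu>\<bar> \<le> 1" and m: "m \<ge> 2"
  shows "Re (sign_char \<mu> t ^ m) \<le> 1 - (1 - \<mu>\<^sup>2) * (1 - \<bar>cos t\<bar> ^ m)"
proof -
  define v where "v = 1 - \<mu>\<^sup>2"
  have v: "0 \<le> v" "v \<le> 1" using \<mu> by (auto simp: v_def abs_square_le_1)
  define p where "p = real m / 2"
  have p: "p \<ge> 1" using m by (simp add: p_def)
  have pw: "(y\<^sup>2) powr p = y ^ m" if "y \<ge> 0" for y :: real
  proof (cases "y = 0")
    case True
    then show ?thesis using m by simp
  next
    case False
    then have "y > 0" using that by simp
    then have "(y\<^sup>2) powr p = (y powr 2) powr p" by simp
    also have "\<dots> = y powr real m" by (simp add: powr_powr p_def)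
    finally show ?thesis using \<open>y > 0\<close> by (simp add: powr_realpow)
  qed
  have "Re (sign_char \<mu> t ^ m) \<le> norm (sign_char \<mu> t) ^ m"
    using complex_Re_le_cmod[of "sign_char \<mu> t ^ m"] by (simp add: norm_power)
  also have "\<dots> = ((norm (sign_char \<mu> t))\<^sup>2) powr p" by (simp add: pw)
  also have "(norm (sign_char \<mu> t))\<^sup>2 = (1 - v) *\<^sub>R 1 + v *\<^sub>R \<bar>cos t\<bar>\<^sup>2"
    unfolding norm_sign_char v_def by (simp add: sin_squared_eq algebra_simps)
  also have "((1 - v) *\<^sub>R 1 + v *\<^sub>R \<bar>cos t\<bar>\<^sup>2) powr p \<le> (1 - v) * (1 powr p) + v * ((\<bar>cos t\<bar>\<^sup>2) powr p)"
    using v by (intro convex_onD[OF convex_on_powr_nonneg[OF p]]) auto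
  also have "\<dots> = (1 - v) + v * \<bar>cos t\<bar> ^ m" by (simp only: pw abs_ge_zero) simp
  finally show ?thesis by (simp add: v_def algebra_simps)
qed

lemma cos_ge_one_minus_half_square: "1 - t\<^sup>2 / 2 \<le> cos t" for t :: real
proof -
  have "(sin (t / 2))\<^sup>2 \<le> (t / 2)\<^sup>2"
    using abs_sin_x_le_abs_x[of "t / 2"] by (simp only: abs_le_square_iff)
  then show ?thesis using cos_double_sin[of "t / 2"] by (simp add: power_divide)
qed

lemma one_minus_cos_power_le: "1 - \<bar>cos t\<bar> ^ m \<le> real m * t\<^sup>2 / 2" for t :: real
proof -
  have c: "\<bar>cos t\<bar> \<ge> 1 - t\<^sup>2 / 2"
    using cos_ge_one_minus_half_square[of t] by linarith
  have "1 + real m * (\<bar>cos t\<bar> - 1) \<le> (1 + (\<bar>cos t\<bar> - 1)) ^ m"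
    by (rule Bernoulli_inequality) simp
  moreover have "real m * (\<bar>cos t\<bar> - 1) \<ge> real m * (- t\<^sup>2 / 2)"
    using c by (intro mult_left_mono) auto
  ultimately show ?thesis by simp
qed

text \<open>Reducing the weight to \<open>t powr (-3)\<close>: the comparison function \<open>t powr (2 - r)\<close> is decreasing.\<close>
lemma cos_power_tail_le_gap_powr:
  assumes m: "m \<ge> 3" and r: "r > 2"
  shows "(\<integral>\<^sup>+t\<in>{pi / 2..}. ennreal (\<bar>cos t\<bar> ^ m * t powr (- r - 1)) \<partial>lborel) \<le>
      (\<integral>\<^sup>+t\<in>{0..pi / 2}. ennreal ((exp (- (real m * t\<^sup>2) / 2) - cos t ^ m) * t powr (- r - 1)) \<partial>lborel)"
    and "(\<integral>\<^sup>+t\<in>{pi / 2..}. ennreal (\<bar>cos t\<bar> ^ m * t powr (- r - 1)) \<partial>lborel) < \<infinity>"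
proof -
  \<comment> \<open>The factor \<open>t powr (2 - r)\<close> equals \<open>c\<close> at
    \<open>pi / 2\<close>, is larger before it, where the gap is, and smaller after it, on the tail;
    so it only helps.\<close>
  define c where "c = (pi / 2) powr (2 - r)"
  have c: "c \<ge> 0" by (simp add: c_def)
  have w: "t powr (- r - 1) = t powr (2 - r) * inverse t ^ 3" if "t > 0" for t
  proof -
    have "- r - 1 = (2 - r) + - 3" by simp
    then have "t powr (- r - 1) = t powr (2 - r) * t powr (- 3)" by (simp only: powr_add)
    also have "t powr (- 3) = inverse t ^ 3"
      using that powr_realpow[of t 3] by (simp add: powr_minus flip: power_inverse)
    finally show ?thesis .
  qed
  have "(\<integral>\<^sup>+t\<in>{pi / 2..}. ennreal (\<bar>cos t\<bar> ^ m * t powr (- r - 1)) \<partial>lborel) \<le>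
      (\<integral>\<^sup>+t. ennreal c * (ennreal (\<bar>cos t\<bar> ^ m * inverse t ^ 3) * indicator {pi / 2..} t) \<partial>lborel)"
  proof (rule nn_integral_mono)
    fix t :: real
    have "\<bar>cos t\<bar> ^ m * t powr (- r - 1) \<le> c * (\<bar>cos t\<bar> ^ m * inverse t ^ 3)" if t: "t \<ge> pi / 2"
    proof -
      have t0: "t > 0" using t pi_gt_zero by linarith
      have "t powr (2 - r) \<le> c" unfolding c_def using t r by (intro powr_mono2') auto
      then have "t powr (2 - r) * (\<bar>cos t\<bar> ^ m * inverse t ^ 3) \<le> c * (\<bar>cos t\<bar> ^ m * inverse t ^ 3)"
        using t0 by (intro mult_right_mono) auto
      then show ?thesis unfolding w[OF t0] by (simp add: mult_ac)
    qed
    then show "ennreal (\<bar>cos t\<bar> ^ m * t powr (- r - 1)) * indicator {pi / 2..} t \<le>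
        ennreal c * (ennreal (\<bar>cos t\<bar> ^ m * inverse t ^ 3) * indicator {pi / 2..} t)"
      using c by (auto simp: indicator_def ennreal_mult'[symmetric] intro!: ennreal_leI)
  qed
  also have "\<dots> = ennreal c * (\<integral>\<^sup>+t\<in>{pi / 2..}. ennreal (\<bar>cos t\<bar> ^ m * inverse t ^ 3) \<partial>lborel)"
    by (rule nn_integral_cmult) measurable
  finally have 1: "(\<integral>\<^sup>+t\<in>{pi / 2..}. ennreal (\<bar>cos t\<bar> ^ m * t powr (- r - 1)) \<partial>lborel) \<le>
      ennreal c * (\<integral>\<^sup>+t\<in>{pi / 2..}. ennreal (\<bar>cos t\<bar> ^ m * inverse t ^ 3) \<partial>lborel)" .
  have "ennreal c * (\<integral>\<^sup>+t\<in>{pi / 2..}. ennreal (\<bar>cos t\<bar> ^ m * inverse t ^ 3) \<partial>lborel) \<le>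
      ennreal c * (\<integral>\<^sup>+t\<in>{0..pi / 2}. ennreal ((exp (- (real m * t\<^sup>2) / 2) - cos t ^ m) * inverse t ^ 3) \<partial>lborel)"
    by (intro mult_left_mono cos_power_tail_le_gap m) simp
  also have "\<dots> = (\<integral>\<^sup>+t. ennreal c * (ennreal ((exp (- (real m * t\<^sup>2) / 2) - cos t ^ m) * inverse t ^ 3) * indicator {0..pi / 2} t) \<partial>lborel)"
    by (rule nn_integral_cmult[symmetric]) measurable
  also have "\<dots> \<le> (\<integral>\<^sup>+t\<in>{0..pi / 2}. ennreal ((exp (- (real m * t\<^sup>2) / 2) - cos t ^ m) * t powr (- r - 1)) \<partial>lborel)"
  proof (rule nn_integral_mono)
    fix t :: real
    define G where "G = exp (- (real m * t\<^sup>2) / 2) - cos t ^ m"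
    have "c * (G * inverse t ^ 3) \<le> G * t powr (- r - 1)" if t: "0 \<le> t" "t \<le> pi / 2"
    proof (cases "t = 0")
      case False
      then have t0: "t > 0" using t by linarith
      have G: "0 \<le> G" using gauss_minus_cos_power_nonneg[OF t, of m] by (simp add: G_def)
      have "c \<le> t powr (2 - r)" unfolding c_def using t t0 r by (intro powr_mono2') auto
      then have "c * (G * inverse t ^ 3) \<le> t powr (2 - r) * (G * inverse t ^ 3)"
        using t0 G by (intro mult_right_mono) auto
      then show ?thesis unfolding w[OF t0] by (simp add: mult_ac)
    qed simp
    then show "ennreal c * (ennreal ((exp (- (real m * t\<^sup>2) / 2) - cos t ^ m) * inverse t ^ 3) * indicator {0..pi / 2} t) \<le>
        ennreal ((exp (- (real m * t\<^sup>2) / 2) - cos t ^ m) * t powr (- r - 1)) * indicator {0..pi / 2} t"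
      using c unfolding G_def[symmetric] by (auto simp: indicator_def ennreal_mult'[symmetric] intro!: ennreal_leI)
  qed
  finally show "(\<integral>\<^sup>+t\<in>{pi / 2..}. ennreal (\<bar>cos t\<bar> ^ m * t powr (- r - 1)) \<partial>lborel) \<le>
      (\<integral>\<^sup>+t\<in>{0..pi / 2}. ennreal ((exp (- (real m * t\<^sup>2) / 2) - cos t ^ m) * t powr (- r - 1)) \<partial>lborel)"
    using 1 by (rule order_trans[rotated])
  have "ennreal c * (\<integral>\<^sup>+t\<in>{pi / 2..}. ennreal (\<bar>cos t\<bar> ^ m * inverse t ^ 3) \<partial>lborel) \<le> ennreal c * ennreal (7 / 8 * (1 / pi)\<^sup>2 - 189 / 64 * (1 / pi) ^ 4 + 315 / 32 * (1 / pi) ^ 6)"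
    by (intro mult_left_mono nn_integral_cos_power_tail m) simp
  also have "\<dots> < \<infinity>" by (simp add: ennreal_mult_less_top)
  finally show "(\<integral>\<^sup>+t\<in>{pi / 2..}. ennreal (\<bar>cos t\<bar> ^ m * t powr (- r - 1)) \<partial>lborel) < \<infinity>"
    using 1 by (rule le_less_trans[rotated])
qed

text \<open>The bias disappears first: the mean of the kernel is at most
  \<open>(1 - \<mu>\<^sup>2) * cg t\<close>, and \<open>cg\<close> is nonnegative. Then
  \<open>cg\<close> is compared with its Gaussian counterpart \<open>gg\<close>: beyond
  \<open>pi / 2\<close> the excess of \<open>cg\<close> is at most the tail, which the deficit on
  \<open>{0..pi / 2}\<close> pays for.\<close>

lemma sign_sum_moment_le_2_4:
  assumes \<mu>: "\<bar>\<mu>\<bar> \<le> 1" and m: "m \<ge> 2" and r: "2 < r" "r < 4"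
  shows "sign_sum_mean \<mu> m (\<lambda>x. \<bar>x\<bar> powr r) \<le> real m powr (r / 2) * normal_abs_moment r"
proof -
  define k where "k = (\<lambda>x::real. cos x - 1 + x\<^sup>2 / 2)"
  have [measurable]: "k \<in> borel_measurable borel" by (simp add: k_def)
  have k0: "0 \<le> k x" for x
    using cos_ge_one_minus_half_square[of x] by (simp add: k_def)
  obtain K where K: "K > 0" "(\<integral>\<^sup>+t\<in>{0<..}. ennreal (k t * t powr (- r - 1)) \<partial>lborel) = ennreal K"
  proof (rule kernel_integral_finite[of k 1 4 r 2])
    show "k x \<le> 1 * x powr 4" if "0 < x" "x \<le> 1" for x
    proof -
      have "k x \<le> x ^ 4 / 24" using cos_le_taylor4[of x] unfolding k_def by linarith
      also have "\<dots> \<le> x ^ 4" using that by simp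
      finally show ?thesis using that by simp
    qed
    show "k x \<le> 1 * x powr 2" if "1 \<le> x" for x
    proof -
      have "k x \<le> x ^ 2" using cos_le_one[of x] zero_le_power2[of x] unfolding k_def by linarith
      then show ?thesis using that by simp
    qed
    show "0 < k x" if "x \<in> {4..5}" for x
    proof -
      have "4 ^ 2 \<le> x ^ 2" using that by (intro power_mono) auto
      then have "16 \<le> x\<^sup>2" by simp
      then show ?thesis using cos_ge_minus_one[of x] unfolding k_def by linarith
    qed
  qed (use r k0 in auto)
  define w where "w t = t powr (- r - 1)" for t :: real
  have w0: "0 \<le> w t" for t by (simp add: w_def)
  define cg where "cg t = \<bar>cos t\<bar> ^ m - 1 + real m * t\<^sup>2 / 2" for t :: real
  define gg where "gg t = exp (- (real m * t\<^sup>2) / 2) - 1 + real m * t\<^sup>2 / 2" for t :: real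
  have [measurable]: "cg \<in> borel_measurable borel" "gg \<in> borel_measurable borel" "w \<in> borel_measurable borel"
    unfolding cg_def gg_def w_def by measurable
  have cg0: "0 \<le> cg t" for t using one_minus_cos_power_le[of t m] by (simp add: cg_def)
  have gg0: "0 \<le> gg t" for t
    using exp_ge_add_one_self[of "- (real m * t\<^sup>2) / 2"] by (simp add: gg_def)
  have sgn_le: "sign_sum_mean \<mu> m (\<lambda>x. k (t * x)) \<le> cg t" for t
  proof -
    have "sign_sum_mean \<mu> m (\<lambda>x. k (t * x)) = sign_sum_mean \<mu> m (\<lambda>x. cos (t * x) - 1 + (t\<^sup>2 / 2) * x ^ 2)"
      by (simp add: k_def power_mult_distrib)
    also have "\<dots> = Re (sign_char \<mu> t ^ m) - 1 + (t\<^sup>2 / 2) * (real m * (1 - \<mu>\<^sup>2))"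
      unfolding sign_sum_mean_add sign_sum_mean_diff sign_sum_mean_cmult sign_sum_mean_power2 sign_sum_mean_cos by simp
    also have "\<dots> \<le> (1 - \<mu>\<^sup>2) * cg t"
    proof -
      have "(1 - \<mu>\<^sup>2) * cg t = - ((1 - \<mu>\<^sup>2) * (1 - \<bar>cos t\<bar> ^ m)) + t\<^sup>2 / 2 * (real m * (1 - \<mu>\<^sup>2))"
        by (simp add: cg_def field_simps)
      then show ?thesis using Re_sign_char_power_le[OF \<mu> m, of t] by linarith
    qed
    also have "\<dots> \<le> 1 * cg t" using \<mu> cg0 by (intro mult_right_mono) auto
    finally show ?thesis by simp
  qed
  have G: "(\<integral>\<^sup>+z. ennreal (k (t * (sqrt m * z)) * std_normal_density z) \<partial>lborel) = ennreal (gg t)" for t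
  proof -
    define a where "a = t * sqrt m"
    have a: "a ^ 2 = real m * t\<^sup>2" by (simp add: a_def power_mult_distrib)
    have "has_bochner_integral lborel (\<lambda>z. std_normal_density z * cos (a * z) - std_normal_density z +
        std_normal_density z * (a * z) ^ 2 / 2) (exp (- a\<^sup>2 / 2) - 1 + a ^ 2 / 2)"
      by (intro has_bochner_integral_add has_bochner_integral_diff has_bochner_integral_divide_zero
          integral_power2_std_normal integral_cos_std_normal)
        (simp add: has_bochner_integral_iff)
    moreover have "k (t * (sqrt m * z)) * std_normal_density z = std_normal_density z * cos (a * z) - std_normal_density z +
        std_normal_density z * (a * z) ^ 2 / 2" for z
      by (simp add: k_def a_def algebra_simps)
    ultimately have hb: "has_bochner_integral lborel (\<lambda>z. k (t * (sqrt m * z)) * std_normal_density z) (gg t)"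
      by (simp add: a gg_def)
    then show ?thesis
      using k0 by (subst nn_integral_eq_integral) (auto simp: has_bochner_integral_iff)
  qed
  have main: "(\<integral>\<^sup>+t\<in>{0<..}. ennreal (cg t * w t) \<partial>lborel) \<le> (\<integral>\<^sup>+t\<in>{0<..}. ennreal (gg t) * ennreal (w t) \<partial>lborel)"
  proof (cases "m = 2")
    \<comment> \<open>As 2 is even, \<open>cg\<close> is exactly the mean of the kernel for two
      unbiased signs, so its integral is a known moment; the tail estimate starts at
      \<open>m = 3\<close>.\<close>
    case True
    have cg2: "cg t = sign_sum_mean 0 m (\<lambda>x. k (t * x))" for t
    proof -
      have "sign_sum_mean 0 m (\<lambda>x. k (t * x)) = sign_sum_mean 0 m (\<lambda>x. cos (t * x) - 1 + (t\<^sup>2 / 2) * x ^ 2)"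
        by (simp add: k_def power_mult_distrib)
      also have "\<dots> = cos t ^ m - 1 + (t\<^sup>2 / 2) * real m"
        unfolding sign_sum_mean_add sign_sum_mean_diff sign_sum_mean_cmult sign_sum_mean_power2 sign_sum_mean_0_cos by simp
      finally show ?thesis using True by (simp add: cg_def)
    qed
    have "(\<integral>\<^sup>+t\<in>{0<..}. ennreal (cg t * w t) \<partial>lborel) = ennreal (K * sign_sum_mean 0 m (\<lambda>x. \<bar>x\<bar> powr r))"
      unfolding cg2 w_def using K k0 by (intro sign_sum_mean_kernel) (auto simp: k_def)
    also have "sign_sum_mean 0 m (\<lambda>x. \<bar>x\<bar> powr r) = 2 powr r / 2"
      using r by (simp add: True numeral_2_eq_2)
    also have "\<dots> = 2 powr (r / 2) * (2 powr (r / 2) / 2)" by (simp flip: powr_add)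
    also have "ennreal (K * \<dots>) \<le> ennreal (K * (2 powr (r / 2) * normal_abs_moment r))"
      using K r by (intro ennreal_leI mult_left_mono normal_abs_moment_ge_powr) auto
    also have "2 powr (r / 2) = sqrt m powr r" by (simp add: True powr_half_sqrt[symmetric] powr_powr)
    also have "ennreal (K * (sqrt m powr r * normal_abs_moment r)) =
        (\<integral>\<^sup>+t\<in>{0<..}. (\<integral>\<^sup>+z. ennreal (k (t * (sqrt m * z)) * std_normal_density z) \<partial>lborel) * ennreal (t powr (- r - 1)) \<partial>lborel)"
      using K k0 r by (intro normal_kernel[symmetric]) (auto simp: k_def)
    finally show ?thesis unfolding G w_def .
  next
    case False
    then have m3: "m \<ge> 3" using m by simp
    \<comment> \<open>\<open>U\<close> is added on both sides and cancelled at the end, which its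
      finiteness permits; this avoids differences of extended reals.\<close>
    define U where "U = (\<integral>\<^sup>+t\<in>{pi / 2..}. ennreal (\<bar>cos t\<bar> ^ m * w t) \<partial>lborel)"
    have "U + (\<integral>\<^sup>+t\<in>{0<..}. ennreal (cg t * w t) \<partial>lborel) \<le>
        (\<integral>\<^sup>+t\<in>{0..pi / 2}. ennreal ((exp (- (real m * t\<^sup>2) / 2) - cos t ^ m) * w t) \<partial>lborel) +
        (\<integral>\<^sup>+t\<in>{0<..}. ennreal (cg t * w t) \<partial>lborel)"
      unfolding U_def w_def using cos_power_tail_le_gap_powr(1)[OF m3 r(1)] by (rule add_right_mono)
    also have "\<dots> = (\<integral>\<^sup>+t. ennreal ((exp (- (real m * t\<^sup>2) / 2) - cos t ^ m) * w t) * indicator {0..pi / 2} t +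
        ennreal (cg t * w t) * indicator {0<..} t \<partial>lborel)"
      by (rule nn_integral_add[symmetric]) measurable
    also have "\<dots> \<le> (\<integral>\<^sup>+t. ennreal (\<bar>cos t\<bar> ^ m * w t) * indicator {pi / 2..} t + ennreal (gg t) * ennreal (w t) * indicator {0<..} t \<partial>lborel)"
    proof (rule nn_integral_mono)
      fix t :: real
      consider "t \<le> 0" | "0 < t" "t \<le> pi / 2" | "t > pi / 2" by linarith
      then show "ennreal ((exp (- (real m * t\<^sup>2) / 2) - cos t ^ m) * w t) * indicator {0..pi / 2} t +
        ennreal (cg t * w t) * indicator {0<..} t \<le>
        ennreal (\<bar>cos t\<bar> ^ m * w t) * indicator {pi / 2..} t + ennreal (gg t) * ennreal (w t) * indicator {0<..} t"
      proof cases
        case 1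
        then show ?thesis by (cases "t = 0") (auto simp: indicator_def w_def)
      next
        case 2
        have cp: "\<bar>cos t\<bar> = cos t" using 2 cos_ge_zero[of t] by simp
        have "ennreal ((exp (- (real m * t\<^sup>2) / 2) - cos t ^ m) * w t) + ennreal (cg t * w t) =
            ennreal ((exp (- (real m * t\<^sup>2) / 2) - cos t ^ m) * w t + cg t * w t)"
          using 2 gauss_minus_cos_power_nonneg[of t m] w0 cg0 by (intro ennreal_plus[symmetric] mult_nonneg_nonneg) auto
        also have "(exp (- (real m * t\<^sup>2) / 2) - cos t ^ m) * w t + cg t * w t = gg t * w t"
          by (simp add: cg_def gg_def cp algebra_simps)
        finally show ?thesis using 2 gg0 w0 by (simp add: ennreal_mult' add_increasing)
      next
        case 3
        have "cg t * w t \<le> \<bar>cos t\<bar> ^ m * w t + gg t * w t"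
        proof -
          have "cg t \<le> \<bar>cos t\<bar> ^ m + gg t" by (simp add: cg_def gg_def)
          then have "cg t * w t \<le> (\<bar>cos t\<bar> ^ m + gg t) * w t" using w0 by (rule mult_right_mono)
          then show ?thesis by (simp add: distrib_right)
        qed
        then have "ennreal (cg t * w t) \<le> ennreal (\<bar>cos t\<bar> ^ m * w t) + ennreal (gg t * w t)"
          using w0[of t] gg0[of t] by (simp add: ennreal_plus[symmetric] ennreal_leI del: ennreal_plus)
        moreover have "0 < t" using 3 pi_gt_zero by linarith
        ultimately show ?thesis using 3 gg0 w0 by (simp add: ennreal_mult')
      qed
    qed
    also have "\<dots> = U + (\<integral>\<^sup>+t\<in>{0<..}. ennreal (gg t) * ennreal (w t) \<partial>lborel)"
      unfolding U_def by (rule nn_integral_add) measurable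
    finally have "U + (\<integral>\<^sup>+t\<in>{0<..}. ennreal (cg t * w t) \<partial>lborel) \<le> U + (\<integral>\<^sup>+t\<in>{0<..}. ennreal (gg t) * ennreal (w t) \<partial>lborel)" .
    moreover have "U \<noteq> \<infinity>"
      using cos_power_tail_le_gap_powr(2)[OF m3 r(1)] unfolding U_def w_def by (rule less_imp_neq)
    ultimately show ?thesis unfolding ennreal_add_left_cancel_le by blast
  qed
  show ?thesis
  proof (rule sign_sum_moment_le_via_kernel[OF _ _ _ _ \<mu> K(1) _ K(2)])
    have "(\<integral>\<^sup>+t\<in>{0<..}. ennreal (sign_sum_mean \<mu> m (\<lambda>x. k (t * x)) * t powr (- r - 1)) \<partial>lborel) \<le>
        (\<integral>\<^sup>+t\<in>{0<..}. ennreal (cg t * w t) \<partial>lborel)"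
      unfolding w_def using sgn_le by (intro nn_integral_mono mult_right_mono ennreal_leI) auto
    then show "(\<integral>\<^sup>+t\<in>{0<..}. ennreal (sign_sum_mean \<mu> m (\<lambda>x. k (t * x)) * t powr (- r - 1)) \<partial>lborel) \<le>
      (\<integral>\<^sup>+t\<in>{0<..}. (\<integral>\<^sup>+z. ennreal (k (t * (sqrt m * z)) * std_normal_density z) \<partial>lborel) * ennreal (t powr (- r - 1)) \<partial>lborel)"
      using main unfolding G w_def by (rule order_trans)
  qed (use r k0 in \<open>auto simp: k_def\<close>)
qed

section \<open>Moments of order between 4 and 5\<close>

lemma Im_power_bound:
  fixes z :: complex
  assumes "norm z \<le> 1"
  shows "\<bar>Im (z ^ m)\<bar> \<le> real m * \<bar>Im z\<bar>"
proof (induction m)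
  case (Suc m)
  have n: "norm (z ^ m) \<le> 1" using assms by (simp add: norm_power power_le_one)
  have "\<bar>Im (z ^ Suc m)\<bar> \<le> \<bar>Re z\<bar> * \<bar>Im (z ^ m)\<bar> + \<bar>Im z\<bar> * \<bar>Re (z ^ m)\<bar>"
    using abs_triangle_ineq[of "Re z * Im (z ^ m)" "Im z * Re (z ^ m)"] by (simp add: abs_mult)
  also have "\<dots> \<le> 1 * (real m * \<bar>Im z\<bar>) + \<bar>Im z\<bar> * 1"
    using assms n abs_Re_le_cmod[of z] abs_Re_le_cmod[of "z ^ m"] Suc.IH
    by (intro add_mono mult_mono) auto
  finally show ?case by (simp add: algebra_simps)
qed simp

text \<open>Replacing one factor \<open>z\<close> by its real part costs \<open>Im z\<close> times
  the imaginary part of the remaining power, which is itself linear in \<open>Im z\<close>. A bound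
  by the modulus would not do: the real part of the power is needed from below.\<close>

lemma Re_power_bound:
  fixes z :: complex
  assumes "norm z \<le> 1"
  shows "\<bar>Re (z ^ m) - Re z ^ m\<bar> \<le> real m * (real m - 1) / 2 * (Im z)\<^sup>2"
proof (induction m)
  case (Suc m)
  have "Re (z ^ Suc m) - Re z ^ Suc m = Re z * (Re (z ^ m) - Re z ^ m) + - (Im z * Im (z ^ m))"
    by (simp add: algebra_simps)
  then have "\<bar>Re (z ^ Suc m) - Re z ^ Suc m\<bar> \<le> \<bar>Re z\<bar> * \<bar>Re (z ^ m) - Re z ^ m\<bar> + \<bar>Im z\<bar> * \<bar>Im (z ^ m)\<bar>"
    using abs_triangle_ineq[of "Re z * (Re (z ^ m) - Re z ^ m)" "- (Im z * Im (z ^ m))"]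
    by (simp only: abs_mult abs_minus_cancel)
  also have "\<dots> \<le> 1 * (real m * (real m - 1) / 2 * (Im z)\<^sup>2) + \<bar>Im z\<bar> * (real m * \<bar>Im z\<bar>)"
    using assms abs_Re_le_cmod[of z] Suc.IH Im_power_bound[OF assms, of m]
    by (intro add_mono mult_mono) auto
  also have "\<dots> = real (Suc m) * (real (Suc m) - 1) / 2 * (Im z)\<^sup>2"
  proof -
    have "\<bar>Im z\<bar> * (real m * \<bar>Im z\<bar>) = real m * (Im z)\<^sup>2" by (simp add: power2_eq_square)
    then show ?thesis by (simp add: field_simps)
  qed
  finally show ?case .
qed simp

lemma norm_sign_char_le_1: "\<bar>\<mu>\<bar> \<le> 1 \<Longrightarrow> norm (sign_char \<mu> t) \<le> 1"
  by (rule power2_le_imp_le) (auto simp: norm_sign_char abs_square_le_1)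

text \<open>The derivative in \<open>t\<close> is \<open>v * sin t * sin (\<mu> * t)\<close> with
  \<open>v = 1 - \<mu>\<^sup>2\<close>. The order is cubic since the imaginary part starts with the
  skewness of the sign.\<close>

lemma Im_sign_char_le:
  assumes \<mu>: "\<bar>\<mu>\<bar> \<le> 1" and t: "0 \<le> t"
  shows "\<bar>Im (sign_char \<mu> t)\<bar> \<le> \<bar>\<mu>\<bar> * (1 - \<mu>\<^sup>2) * t ^ 3 / 3"
proof -
  define v where "v = 1 - \<mu>\<^sup>2"
  have v: "0 \<le> v" using \<mu> by (simp add: v_def abs_square_le_1)
  define g where "g = (\<lambda>t. \<mu> * sin t * cos (\<mu> * t) - cos t * sin (\<mu> * t))"
  have dg: "(g has_real_derivative v * (sin x * sin (\<mu> * x))) (at x)" for x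
    unfolding g_def v_def by (auto intro!: derivative_eq_intros simp: power2_eq_square algebra_simps)
  have b: "\<bar>v * (sin x * sin (\<mu> * x))\<bar> \<le> \<bar>\<mu>\<bar> * v * x\<^sup>2" if "0 \<le> x" for x
  proof -
    have "\<bar>sin x\<bar> * \<bar>sin (\<mu> * x)\<bar> \<le> x * (\<bar>\<mu>\<bar> * x)"
      using abs_sin_x_le_abs_x[of x] abs_sin_x_le_abs_x[of "\<mu> * x"] that by (intro mult_mono) (auto simp: abs_mult)
    then have "v * (\<bar>sin x\<bar> * \<bar>sin (\<mu> * x)\<bar>) \<le> v * (x * (\<bar>\<mu>\<bar> * x))" using v by (intro mult_left_mono)
    then show ?thesis using v by (simp add: abs_mult power2_eq_square mult_ac)
  qed
  have "0 \<le> \<bar>\<mu>\<bar> * v * t ^ 3 / 3 - g t"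
  proof (rule nonneg_if_deriv_nonneg[where f = "\<lambda>x. \<bar>\<mu>\<bar> * v * x ^ 3 / 3 - g x" and f' = "\<lambda>x. \<bar>\<mu>\<bar> * v * x\<^sup>2 - v * (sin x * sin (\<mu> * x))"])
    show "((\<lambda>x. \<bar>\<mu>\<bar> * v * x ^ 3 / 3 - g x) has_real_derivative \<bar>\<mu>\<bar> * v * x\<^sup>2 - v * (sin x * sin (\<mu> * x))) (at x)" for x
      by (auto intro!: derivative_eq_intros dg)
    show "0 \<le> \<bar>\<mu>\<bar> * v * x\<^sup>2 - v * (sin x * sin (\<mu> * x))" if "0 \<le> x" for x
      using b[OF that] by linarith
  qed (use t in \<open>auto simp: g_def\<close>)
  moreover have "0 \<le> \<bar>\<mu>\<bar> * v * t ^ 3 / 3 + g t"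
  proof (rule nonneg_if_deriv_nonneg[where f = "\<lambda>x. \<bar>\<mu>\<bar> * v * x ^ 3 / 3 + g x" and f' = "\<lambda>x. \<bar>\<mu>\<bar> * v * x\<^sup>2 + v * (sin x * sin (\<mu> * x))"])
    show "((\<lambda>x. \<bar>\<mu>\<bar> * v * x ^ 3 / 3 + g x) has_real_derivative \<bar>\<mu>\<bar> * v * x\<^sup>2 + v * (sin x * sin (\<mu> * x))) (at x)" for x
      by (auto intro!: derivative_eq_intros dg)
    show "0 \<le> \<bar>\<mu>\<bar> * v * x\<^sup>2 + v * (sin x * sin (\<mu> * x))" if "0 \<le> x" for x
      using b[OF that] by linarith
  qed (use t in \<open>auto simp: g_def\<close>)
  ultimately have "\<bar>g t\<bar> \<le> \<bar>\<mu>\<bar> * v * t ^ 3 / 3" by linarith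
  then show ?thesis unfolding Im_sign_char g_def v_def .
qed

section \<open>Elementary inequalities for the pointwise comparison\<close>

lemma cos_ge_taylor6: "cos x \<ge> 1 - x\<^sup>2 / 2 + x ^ 4 / 24 - x ^ 6 / (720::real)"
proof -
  obtain t where "cos x = (\<Sum>m<6. cos_coeff m * x ^ m) + (cos (t + 1/2 * real 6 * pi) / fact 6) * x ^ 6"
    using Maclaurin_cos_expansion[of x 6] by blast
  moreover have "(\<Sum>m<6. cos_coeff m * x ^ m) = 1 - x\<^sup>2 / 2 + x ^ 4 / 24"
  proof -
    have "{..<6} = {0, 1, 2, 3, 4, 5::nat}" by auto
    then show ?thesis by (simp add: cos_coeff_def fact_numeral)
  qed
  moreover have "cos (t + 1/2 * real 6 * pi) = - cos t"
  proof -
    have "t + 1/2 * real 6 * pi = t + pi + 2 * pi" by simp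
    then show ?thesis by (simp only: cos_periodic cos_periodic_pi)
  qed
  moreover have "- cos t * x ^ 6 \<ge> - 1 * x ^ 6"
    by (intro mult_right_mono) auto
  ultimately show ?thesis by (simp add: fact_numeral)
qed

lemma exp_minus_le_taylor4:
  assumes "0 \<le> (y::real)"
  shows "exp (- y) \<le> 1 - y + y\<^sup>2 / 2 - y ^ 3 / 6 + y ^ 4 / 24"
proof -
  have 2: "0 \<le> 1 - y + y\<^sup>2 / 2 - exp (- y)" if "0 \<le> y" for y :: real
    using exp_minus_le_taylor2[OF that] by simp
  have 3: "0 \<le> - 1 + y - y\<^sup>2 / 2 + y ^ 3 / 6 + exp (- y)" if "0 \<le> y" for y :: real
  proof (rule nonneg_if_deriv_nonneg[where f = "\<lambda>y. - 1 + y - y\<^sup>2 / 2 + y ^ 3 / 6 + exp (- y)" and f' = "\<lambda>y. 1 - y + y\<^sup>2 / 2 - exp (- y)"])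
    show "((\<lambda>y. - 1 + y - y\<^sup>2 / 2 + y ^ 3 / 6 + exp (- y)) has_real_derivative 1 - y + y\<^sup>2 / 2 - exp (- y)) (at y)" for y :: real
      by (auto intro!: derivative_eq_intros)
    show "0 \<le> 1 - y + y\<^sup>2 / 2 - exp (- y)" if "0 \<le> y" for y :: real using that by (rule 2)
  qed (use that in auto)
  have "0 \<le> 1 - y + y\<^sup>2 / 2 - y ^ 3 / 6 + y ^ 4 / 24 - exp (- y)"
  proof (rule nonneg_if_deriv_nonneg[where f = "\<lambda>y. 1 - y + y\<^sup>2 / 2 - y ^ 3 / 6 + y ^ 4 / 24 - exp (- y)" and f' = "\<lambda>y. - 1 + y - y\<^sup>2 / 2 + y ^ 3 / 6 + exp (- y)"])
    show "((\<lambda>y. 1 - y + y\<^sup>2 / 2 - y ^ 3 / 6 + y ^ 4 / 24 - exp (- y)) has_real_derivative - 1 + y - y\<^sup>2 / 2 + y ^ 3 / 6 + exp (- y)) (at y)" for y :: real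
      by (auto intro!: derivative_eq_intros)
    show "0 \<le> - 1 + y - y\<^sup>2 / 2 + y ^ 3 / 6 + exp (- y)" if "0 \<le> y" for y :: real using that by (rule 3)
  qed (use assms in auto)
  then show ?thesis by simp
qed

text \<open>The fraction behaves like the remainder at both ends: \<open>w\<^sup>2 / 2\<close> near
  0 and \<open>w\<close> at infinity. With the denominator cleared, the derivative is
  \<open>(1 - (1 + w) * exp (- w)) / 2\<close>.\<close>

lemma exp_remainder2_ge:
  assumes "0 \<le> (w::real)"
  shows "w\<^sup>2 / 2 / (1 + w / 2) \<le> exp (- w) - 1 + w"
proof -
  have d: "0 \<le> 1 / 2 * (1 - (1 + w) * exp (- w))" if "0 \<le> w" for w :: real
  proof -
    have "(1 + w) * exp (- w) \<le> exp w * exp (- w)"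
      using exp_ge_add_one_self[of w] by (intro mult_right_mono) auto
    then show ?thesis by (simp flip: exp_add)
  qed
  have "0 \<le> (1 + w / 2) * exp (- w) - 1 + w / 2"
  proof (rule nonneg_if_deriv_nonneg[where f = "\<lambda>w. (1 + w / 2) * exp (- w) - 1 + w / 2" and f' = "\<lambda>w. 1 / 2 * (1 - (1 + w) * exp (- w))"])
    show "((\<lambda>w. (1 + w / 2) * exp (- w) - 1 + w / 2) has_real_derivative 1 / 2 * (1 - (1 + w) * exp (- w))) (at w)" for w :: real
      by (auto intro!: derivative_eq_intros simp: field_simps)
    show "0 \<le> 1 / 2 * (1 - (1 + w) * exp (- w))" if "0 \<le> w" for w :: real using d[OF that] .
  qed (use assms in auto)
  then have "w\<^sup>2 / 2 \<le> (exp (- w) - 1 + w) * (1 + w / 2)"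
    by (simp add: power2_eq_square field_simps)
  then show ?thesis using assms by (subst pos_divide_le_eq) auto
qed

lemma sinh_remainder: "0 \<le> (d::real) \<Longrightarrow> 2 * d \<le> exp d - exp (- d)"
proof -
  assume d: "0 \<le> d"
  have "0 \<le> exp d - exp (- d) - 2 * d"
  proof (rule nonneg_if_deriv_nonneg[where f = "\<lambda>d. exp d - exp (- d) - 2 * d" and f' = "\<lambda>d. exp d + exp (- d) - 2"])
    fix x :: real
    show "0 \<le> exp x + exp (- x) - 2"
      using zero_le_power2[of "exp (x / 2) - exp (- x / 2)"]
      by (simp add: power2_eq_square algebra_simps flip: exp_add)
  qed (use d in \<open>auto intro!: derivative_eq_intros\<close>)
  then show ?thesis by simp
qed

text \<open>Convexity (midpoint rule) for the primitive of \<open>\<lambda>y. (exp (- y / 2) - 1 + y / 2) / 2\<close>.\<close>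
lemma exp_midpoint_gap:
  fixes s x :: real
  assumes "x \<le> s"
  shows "(s - x) / 2 * (exp (- (s + x) / 4) - 1 + (s + x) / 4) \<le>
    - s / 2 + x / 2 + (s\<^sup>2 - x\<^sup>2) / 8 - exp (- s / 2) + exp (- x / 2)"
proof -
  define M where "M = (s + x) / 2"
  define d where "d = (s - x) / 2"
  have sx: "s = M + d" "x = M - d" by (auto simp: M_def d_def field_simps)
  have "2 * (d / 2) \<le> exp (d / 2) - exp (- (d / 2))"
    using assms by (intro sinh_remainder) (simp add: d_def)
  then have "exp (- M / 2) * d \<le> exp (- M / 2) * (exp (d / 2) - exp (- (d / 2)))"
    by (intro mult_left_mono) auto
  also have "\<dots> = exp (- x / 2) - exp (- s / 2)"
  proof -
    have "- x / 2 = - M / 2 + d / 2" "- s / 2 = - M / 2 + - (d / 2)" by (simp_all add: sx field_simps)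
    then show ?thesis by (simp only: exp_add right_diff_distrib)
  qed
  finally have "exp (- M / 2) * d \<le> exp (- x / 2) - exp (- s / 2)" .
  moreover have "(s + x) / 4 = M / 2" "- (s + x) / 4 = - M / 2" "(s - x) / 2 = d" unfolding M_def d_def by linarith+
  moreover have "- s / 2 + x / 2 + (s\<^sup>2 - x\<^sup>2) / 8 = d * (- 1 + M / 2)"
    unfolding sx by (simp add: power2_eq_square field_simps)
  moreover have "d * (exp (- M / 2) - 1 + M / 2) = exp (- M / 2) * d + d * (- 1 + M / 2)"
    by (simp add: algebra_simps)
  ultimately show ?thesis by (simp only:)
qed

text \<open>For \<open>a \<ge> 0\<close> this is Bernoulli's inequality for \<open>a / h\<close>.
  Negative \<open>a\<close> occurs because the real part of \<open>sign_char\<close> may be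
  negative; then \<open>m \<ge> 2\<close> puts the tangent line at or below \<open>- h ^ m\<close>,
  while \<open>\<bar>a\<bar> \<le> h\<close>.\<close>

lemma power_ge_tangent:
  fixes a h :: real
  assumes "0 < h" "- h \<le> a" "m \<ge> 2"
  shows "h ^ m + real m * h ^ (m - 1) * (a - h) \<le> a ^ m"
proof -
  define x where "x = a / h - 1"
  have x: "- 2 \<le> x" using assms by (simp add: x_def field_simps)
  have b: "1 + real m * x \<le> (1 + x) ^ m"
  proof (cases "x \<ge> - 1")
    case False
    have "\<bar>(1 + x) ^ m\<bar> \<le> 1" using x False by (simp add: power_abs power_le_one)
    moreover have "real m * x \<le> 2 * (- 1)"
      using assms False by (intro order_trans[OF mult_left_mono[of x "- 1"]]) auto
    ultimately show ?thesis by linarith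
  qed (use Bernoulli_inequality[of x m] in auto)
  have a: "a = h * (1 + x)" using assms by (simp add: x_def field_simps)
  have "h ^ m * (1 + real m * x) \<le> h ^ m * (1 + x) ^ m"
    using b assms by (intro mult_left_mono) auto
  also have "\<dots> = a ^ m" by (simp add: a power_mult_distrib)
  finally have "h ^ m * (1 + real m * x) \<le> a ^ m" .
  moreover have "h ^ m = h ^ (m - 1) * h" using assms using power_minus_mult[of m h] by simp
  ultimately show ?thesis by (simp add: a algebra_simps)
qed

text \<open>Up to \<open>2 / 5\<close> the first three terms suffice. Beyond, the cube and the
  fourth power are replaced by tangents at \<open>3 / 5\<close> and the square by its chord over
  \<open>{2 / 5..2 / 3}\<close>, which leaves a linear inequality.\<close>

lemma quartic_gap_poly:
  fixes v :: real
  assumes "0 \<le> v" "v \<le> 2 / 3"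
  shows "0 \<le> 135 + 23 * v - 771 * v\<^sup>2 + 523 * v ^ 3 + 390 * v ^ 4"
proof -
  have v34: "0 \<le> v ^ 3" "0 \<le> v ^ 4" using assms by auto
  show ?thesis
  proof (cases "v \<le> 2 / 5")
    case True
    have "v * v \<le> 2 / 5 * v" using True assms by (intro mult_right_mono) auto
    then have "0 \<le> 135 + 23 * v - 771 * v\<^sup>2" using True by (simp add: power2_eq_square)
    then show ?thesis using v34 by linarith
  next
    case False
    define e where "e = v - 3 / 5"
    have "v ^ 3 = (27 / 25 * v - 54 / 125) + e\<^sup>2 * (v + 6 / 5)" unfolding e_def by (simp add: power2_eq_square power3_eq_cube field_simps)
    moreover have "0 \<le> e\<^sup>2 * (v + 6 / 5)" using assms by (intro mult_nonneg_nonneg) auto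
    ultimately have 3: "27 / 25 * v - 54 / 125 \<le> v ^ 3" by simp
    have "v ^ 4 = (108 / 125 * v - 243 / 625) + e\<^sup>2 * ((v + 3 / 5)\<^sup>2 + 18 / 25)" unfolding e_def by (simp add: power2_eq_square power4_eq_xxxx field_simps)
    moreover have "0 \<le> e\<^sup>2 * ((v + 3 / 5)\<^sup>2 + 18 / 25)" by (intro mult_nonneg_nonneg) auto
    ultimately have 4: "108 / 125 * v - 243 / 625 \<le> v ^ 4" by simp
    have "(v - 2 / 5) * (2 / 3 - v) \<ge> 0" using False assms by (intro mult_nonneg_nonneg) auto
    then have "v\<^sup>2 \<le> 16 / 15 * v - 4 / 15" by (simp add: power2_eq_square field_simps)
    then show ?thesis using 3 4 False assms by linarith
  qed
qed

text \<open>The Taylor bound for the cosine averaged over the two values of the sign. The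
  coefficients are the even moments of a centred sign, which depend only on its variance
  \<open>v\<close>.\<close>

lemma Re_sign_char_ge_taylor:
  assumes \<mu>: "\<bar>\<mu>\<bar> \<le> 1" and v: "v = 1 - \<mu>\<^sup>2"
  shows "Re (sign_char \<mu> t) \<ge> 1 - v * t\<^sup>2 / 2 + v * (4 - 3 * v) * t ^ 4 / 24 - v * (16 - 20 * v + 5 * v\<^sup>2) * t ^ 6 / 720"
proof -
  have "(1 + \<mu>) / 2 * (1 - ((1 - \<mu>) * t)\<^sup>2 / 2 + ((1 - \<mu>) * t) ^ 4 / 24 - ((1 - \<mu>) * t) ^ 6 / 720) +
      (1 - \<mu>) / 2 * (1 - ((1 + \<mu>) * t)\<^sup>2 / 2 + ((1 + \<mu>) * t) ^ 4 / 24 - ((1 + \<mu>) * t) ^ 6 / 720) \<le>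
      (1 + \<mu>) / 2 * cos ((1 - \<mu>) * t) + (1 - \<mu>) / 2 * cos ((1 + \<mu>) * t)"
    using \<mu> by (intro add_mono mult_left_mono cos_ge_taylor6) auto
  also have "\<dots> = Re (sign_char \<mu> t)"
  proof -
    have e: "- (1 + \<mu>) * t = - ((1 + \<mu>) * t)" by (rule minus_mult_left[symmetric])
    show ?thesis unfolding sign_char_def e by simp
  qed
  finally show ?thesis
    unfolding v power_mult_distrib
    by (simp add: power2_eq_square power4_eq_xxxx power_numeral_reduce field_simps)
qed

text \<open>The balance of the terms of order \<open>t ^ 6\<close> in
  \<open>quartic_kernel_pointwise\<close>, divided by \<open>m\<close>: on the left the losses from
  the imaginary part, the fourth cumulant and the sixth moment, on the right the gain from
  \<open>exp_midpoint_gap\<close>.\<close>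

lemma quartic_gap_coeff:
  fixes v M :: real
  assumes v: "0 \<le> v" "v \<le> 1" and M: "2 \<le> M"
  shows "(M - 1) * ((1 - v) * v\<^sup>2 / 18) + (if v < 7 / 10 then (M - 1) * (v\<^sup>2 * max 0 (2 - 3 * v) / 24) + v * (1 - v) / 45 else 0)
    \<le> M\<^sup>2 * (1 - v) * (1 + v)\<^sup>2 / (64 * (1 + 3 * M * (1 + v) / 8))" (is "?L \<le> ?R")
proof -
  have pos: "0 < 7 + 3 * v" "0 < 1 + 3 * M * (1 + v) / 8" using v M by (auto intro!: add_pos_nonneg)
  \<comment> \<open>Makes the right side proportional to \<open>M - 1\<close>, like the main terms
    on the left, so that an inequality in \<open>v\<close> alone remains, with \<open>A\<close> as
    its bound.\<close>
  have Mb: "(M - 1) * (12 / (7 + 3 * v)) \<le> M\<^sup>2 / (1 + 3 * M * (1 + v) / 8)"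
  proof -
    have "(M - 1) * 12 * (1 + 3 * M * (1 + v) / 8) \<le> M\<^sup>2 * (7 + 3 * v)"
    proof -
      have "0 \<le> (M - 3 / 2)\<^sup>2" by simp
      then have "- 9 / 4 \<le> M\<^sup>2 - 3 * M" by (simp add: power2_eq_square field_simps)
      define Z where "Z = (5 / 2 - 3 / 2 * v) * (M\<^sup>2 - 3 * M)"
      have "- 6 \<le> (5 / 2 - 3 / 2 * v) * (- 9 / 4)" using v by simp
      also have "\<dots> \<le> Z"
        unfolding Z_def using v \<open>- 9 / 4 \<le> M\<^sup>2 - 3 * M\<close> by (intro mult_left_mono) auto
      finally have "0 \<le> Z + 12" by simp
      also have "Z + 12 = M\<^sup>2 * (7 + 3 * v) - (M - 1) * 12 * (1 + 3 * M * (1 + v) / 8)"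
        by (simp add: Z_def power2_eq_square field_simps)
      finally show ?thesis by (simp only: diff_ge_0_iff_ge)
    qed
    then have "(M - 1) * 12 * (1 + 3 * M * (1 + v) / 8) / (7 + 3 * v) \<le> M\<^sup>2"
      using pos by (subst pos_divide_le_eq) auto
    then show ?thesis using pos by (subst pos_le_divide_eq) (auto simp: mult_ac)
  qed
  define A where "A = 3 * (1 + v)\<^sup>2 / (16 * (7 + 3 * v))"
  have A: "720 * (7 + 3 * v) * A = 135 * (1 + v)\<^sup>2" using pos by (simp add: A_def field_simps)
  have "(M - 1) * ((1 - v) * A) = (M - 1) * (12 / (7 + 3 * v)) * ((1 - v) * (1 + v)\<^sup>2 / 64)"
  proof -
    have "A = 12 / (7 + 3 * v) * ((1 + v)\<^sup>2 / 64)" using pos by (simp add: A_def divide_simps)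
    then show ?thesis by simp
  qed
  also have "\<dots> \<le> M\<^sup>2 / (1 + 3 * M * (1 + v) / 8) * ((1 - v) * (1 + v)\<^sup>2 / 64)"
    using Mb v by (intro mult_right_mono) auto
  also have "\<dots> = ?R" using pos by (simp add: field_simps)
  finally have R: "(M - 1) * ((1 - v) * A) \<le> ?R" .
  have cancel: "B \<le> A" if "720 * (7 + 3 * v) * B \<le> 135 * (1 + v)\<^sup>2" for B
    using that A pos by (metis mult_le_cancel_left_pos mult_pos_pos zero_less_numeral)
  have vv: "v * v \<le> v" using v by (simp add: mult_left_le)
  \<comment> \<open>The conditional term exists only below \<open>7 / 10\<close>, and its
    \<open>max\<close> is zero from \<open>2 / 3\<close> on.\<close>
  consider "7 / 10 \<le> v" | "2 / 3 \<le> v" "v < 7 / 10" | "v < 2 / 3" by linarith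
  then show ?thesis
  proof cases
    case 1
    have "v\<^sup>2 / 18 \<le> A"
    proof (rule cancel)
      have "720 * (7 + 3 * v) * (v\<^sup>2 / 18) = (7 + 3 * v) * (40 * v\<^sup>2)" by simp
      also have "\<dots> \<le> 10 * (40 * v\<^sup>2)" using v by (intro mult_right_mono) auto
      also have "\<dots> = 100 * (2 * v)\<^sup>2" by (simp add: power_mult_distrib)
      also have "\<dots> \<le> 135 * (1 + v)\<^sup>2" using v by (intro mult_mono power_mono) auto
      finally show "720 * (7 + 3 * v) * (v\<^sup>2 / 18) \<le> 135 * (1 + v)\<^sup>2" .
    qed
    then have "(M - 1) * ((1 - v) * (v\<^sup>2 / 18)) \<le> (M - 1) * ((1 - v) * A)"
      using v M by (intro mult_left_mono) auto
    moreover have "?L = (M - 1) * ((1 - v) * (v\<^sup>2 / 18))" using 1 by simp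
    ultimately show ?thesis using R by linarith
  next
    case 2
    have "v\<^sup>2 / 18 + v / 45 \<le> A"
    proof (rule cancel)
      have "v\<^sup>2 \<le> (7 / 10)\<^sup>2" using 2 v by (intro power_mono) auto
      then have hh: "40 * v\<^sup>2 + 16 * v \<le> 40 * (7 / 10)\<^sup>2 + 16 * (7 / 10)"
        using 2 by (intro add_mono mult_left_mono) auto
      have "(7 + 3 * v) * (40 * v\<^sup>2 + 16 * v) \<le> 10 * (40 * (7 / 10)\<^sup>2 + 16 * (7 / 10))"
        by (intro mult_mono hh) (use v 2 in auto)
      moreover have "(5 / 3)\<^sup>2 \<le> (1 + v)\<^sup>2" using 2 by (intro power_mono) auto
      moreover have "720 * (7 + 3 * v) * (v\<^sup>2 / 18 + v / 45) = (7 + 3 * v) * (40 * v\<^sup>2 + 16 * v)" by (simp add: algebra_simps)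
      ultimately show "720 * (7 + 3 * v) * (v\<^sup>2 / 18 + v / 45) \<le> 135 * (1 + v)\<^sup>2"
        by (simp add: power_divide)
    qed
    then have "(M - 1) * ((1 - v) * (v\<^sup>2 / 18 + v / 45)) \<le> (M - 1) * ((1 - v) * A)"
      using v M by (intro mult_left_mono) auto
    moreover have "1 * (v * (1 - v) / 45) \<le> (M - 1) * (v * (1 - v) / 45)"
      using v M by (intro mult_right_mono) auto
    moreover have "?L = (M - 1) * ((1 - v) * (v\<^sup>2 / 18)) + v * (1 - v) / 45" using 2 by (simp add: max_def)
    moreover have "(M - 1) * ((1 - v) * (v\<^sup>2 / 18 + v / 45)) = (M - 1) * ((1 - v) * (v\<^sup>2 / 18)) + (M - 1) * (v * (1 - v) / 45)"
      by (simp add: algebra_simps)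
    ultimately show ?thesis using R by linarith
  next
    case 3
    have "0 \<le> 135 + 23 * v - 771 * v\<^sup>2 + 523 * v ^ 3 + 390 * v ^ 4"
      using v 3 by (intro quartic_gap_poly) auto
    also have "\<dots> = (1 - v) * (135 * (1 + v)\<^sup>2) - (7 + 3 * v) * (40 * v\<^sup>2 * (1 - v) + 30 * v\<^sup>2 * (2 - 3 * v) + 16 * v * (1 - v))"
      by (simp add: power2_eq_square power_numeral_reduce algebra_simps)
    also have "\<dots> = 720 * (7 + 3 * v) * ((1 - v) * A - ((1 - v) * v\<^sup>2 / 18 + v\<^sup>2 * (2 - 3 * v) / 24 + v * (1 - v) / 45))"
      unfolding A[symmetric] by (simp add: field_simps)
    finally have "0 \<le> (1 - v) * A - ((1 - v) * v\<^sup>2 / 18 + v\<^sup>2 * (2 - 3 * v) / 24 + v * (1 - v) / 45)"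
      using pos by (simp add: zero_le_mult_iff)
    then have "(M - 1) * ((1 - v) * v\<^sup>2 / 18 + v\<^sup>2 * (2 - 3 * v) / 24 + v * (1 - v) / 45) \<le> (M - 1) * ((1 - v) * A)"
      using M by (intro mult_left_mono) auto
    moreover have "1 * (v * (1 - v) / 45) \<le> (M - 1) * (v * (1 - v) / 45)"
      using v M by (intro mult_right_mono) auto
    moreover have "?L = (M - 1) * ((1 - v) * v\<^sup>2 / 18) + ((M - 1) * (v\<^sup>2 * (2 - 3 * v) / 24) + v * (1 - v) / 45)"
      using 3 by (simp add: max_def)
    ultimately show ?thesis using R unfolding distrib_left by linarith
  qed
qed

text \<open>The expression is the normal mean of the quartic kernel minus the mean over signs. The
  power of \<open>sign_char\<close> is compared with that of
  \<open>h = exp (- v * t\<^sup>2 / 2)\<close>, a Gaussian of the same variance; the terms of order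
  \<open>t ^ 4\<close> cancel, and the errors of order \<open>t ^ 6\<close> are covered by the
  convexity gap between the variances \<open>v\<close> and 1.\<close>

lemma quartic_kernel_pointwise:
  fixes \<mu> t :: real
  assumes \<mu>: "\<bar>\<mu>\<bar> \<le> 1" and m: "m \<ge> 2" and t: "0 < t"
  defines "v \<equiv> 1 - \<mu>\<^sup>2" and "s \<equiv> real m * t\<^sup>2"
  shows "0 \<le> Re (sign_char \<mu> t ^ m) - exp (- s / 2) - (1 - v) * s / 2 + s\<^sup>2 * (1 - v\<^sup>2) / 8 + s\<^sup>2 / real m * (v\<^sup>2 / 4 - v / 6)"
    (is "0 \<le> ?D")
proof -
  have v: "0 \<le> v" "v \<le> 1" using \<mu> by (auto simp: v_def abs_square_le_1)
  define \<tau> where "\<tau> = t\<^sup>2"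
  have \<tau>: "0 < \<tau>" using t by (simp add: \<tau>_def)
  have s: "s = real m * \<tau>" by (simp add: s_def \<tau>_def)
  have M: "2 \<le> real m" using m by simp
  have s0: "0 < s" using \<tau> M by (simp add: s)
  have n1: "norm (sign_char \<mu> t) \<le> 1" by (rule norm_sign_char_le_1[OF \<mu>])
  have sm: "s\<^sup>2 / real m * (v\<^sup>2 / 4 - v / 6) = real m * \<tau>\<^sup>2 * (3 * v\<^sup>2 - 2 * v) / 12"
    using M by (simp add: s power2_eq_square field_simps)
  show ?thesis
  \<comment> \<open>From 3 on the polynomial terms outweigh the trivial bound \<open>- 1\<close> for
    the real part. Below 3 one has \<open>cos t \<ge> - 1 / 5 \<ge> - h\<close>, which the tangent
    inequality needs.\<close>
  proof (cases "3 \<le> \<tau>")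
    case True
    have "norm (sign_char \<mu> t ^ m) \<le> 1" using n1 by (simp add: norm_power power_le_one)
    then have c: "- 1 \<le> Re (sign_char \<mu> t ^ m)" using abs_Re_le_cmod[of "sign_char \<mu> t ^ m"] by linarith
    have s6: "6 \<le> s" unfolding s using mult_mono[of 2 "real m" 3 \<tau>] M True by simp
    have e: "exp (- s / 2) \<le> 1 / 4"
    proof -
      have "exp (- s / 2) \<le> exp (- 3)" using s6 by simp
      also have "\<dots> \<le> 1 / (1 + 3)" using exp_ge_add_one_self[of 3] by (simp add: exp_minus field_simps)
      finally show ?thesis by simp
    qed
    define f where "f = (\<lambda>v. - (5 / 4) - (1 - v) * s / 2 + s\<^sup>2 * (1 - v\<^sup>2) / 8 + real m * \<tau>\<^sup>2 * (3 * v\<^sup>2 - 2 * v) / 12)"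
    \<comment> \<open>A quadratic in \<open>v\<close> against its chord over the unit interval: the
      deviation is \<open>v * (1 - v)\<close> times a nonnegative number, so the endpoints
      decide.\<close>
    have "f v = (1 - v) * f 0 + v * f 1 + v * (1 - v) * (s\<^sup>2 / 8 - real m * \<tau>\<^sup>2 / 4)"
      by (simp add: f_def power2_eq_square field_simps)
    moreover have "f 0 \<ge> 0"
    proof -
      have "(s - 6) * (s + 2) \<ge> 0" using s6 by (intro mult_nonneg_nonneg) auto
      then show ?thesis by (simp add: f_def power2_eq_square field_simps)
    qed
    moreover have "f 1 \<ge> 0"
    proof -
      have "3 * 3 \<le> \<tau> * \<tau>" using True by (intro mult_mono) auto
      then have "2 * 9 \<le> real m * \<tau>\<^sup>2" using M by (intro mult_mono) (auto simp: power2_eq_square)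
      then show ?thesis by (simp add: f_def)
    qed
    moreover have "s\<^sup>2 / 8 - real m * \<tau>\<^sup>2 / 4 \<ge> 0"
    proof -
      have "2 * (real m * \<tau>\<^sup>2) \<le> real m * (real m * \<tau>\<^sup>2)" using M by (intro mult_right_mono) auto
      then show ?thesis by (simp add: s power2_eq_square mult_ac)
    qed
    ultimately have "0 \<le> f v" using v by simp
    then show ?thesis using c e unfolding sm f_def by linarith
  next
    case False
    then have \<tau>3: "\<tau> \<le> 3" by simp
    define a where "a = Re (sign_char \<mu> t)"
    define b where "b = Im (sign_char \<mu> t)"
    define y where "y = v * \<tau> / 2"
    define h where "h = exp (- y)"
    \<comment> \<open>The coefficient of \<open>t ^ 4\<close> in \<open>a - h\<close>: the fourth
      cumulant of the sign divided by 24.\<close>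
    define q where "q = v * (2 - 3 * v) / 12"
    define x where "x = v * s"
    define c6 where "c6 = v * (16 - 20 * v + 5 * v\<^sup>2) / 720"
    have y: "0 \<le> y" "y \<le> 3 / 2" using v \<tau> \<tau>3 mult_mono[of v 1 \<tau> 3] by (auto simp: y_def)
    have h: "0 < h" "h \<le> 1" "1 / 5 \<le> h"
    proof -
      have "(1 + (- (3 / 2)) / real 15) ^ 15 \<le> exp (- (3 / 2) :: real)"
      proof -
        have "(1 + (- (3 / 2)) / real 15) ^ 15 \<le> exp (- (3 / 2) / real 15) ^ 15"
          by (intro power_mono exp_ge_add_one_self) auto
        then show ?thesis by (simp flip: exp_of_nat_mult)
      qed
      moreover have "1 / 5 \<le> (1 + (- (3 / 2)) / real 15 :: real) ^ 15" by (simp add: power_divide)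
      moreover have "exp (- (3 / 2)) \<le> h" using y by (simp add: h_def)
      ultimately show "1 / 5 \<le> h" by linarith
    qed (use y in \<open>auto simp: h_def\<close>)
    have hm: "h ^ m = exp (- x / 2)"
      by (simp add: h_def y_def x_def s mult_ac flip: exp_of_nat_mult)
    have t46: "t ^ 4 = \<tau>\<^sup>2" "t ^ 6 = \<tau> ^ 3" by (simp_all add: \<tau>_def power2_eq_square power_numeral_reduce)
    have a_ge: "a \<ge> 1 - v * \<tau> / 2 + v * (4 - 3 * v) * \<tau>\<^sup>2 / 24 - c6 * \<tau> ^ 3"
      using Re_sign_char_ge_taylor[OF \<mu> v_def[THEN meta_eq_to_obj_eq], of t] unfolding t46 \<tau>_def[symmetric] a_def c6_def by simp
    have h_le: "h \<le> 1 - y + y\<^sup>2 / 2 - y ^ 3 / 6 + y ^ 4 / 24"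
      unfolding h_def using y(1) by (rule exp_minus_le_taylor4)
    \<comment> \<open>A lower bound for the coefficient of \<open>t ^ 6\<close>, into which the next
      term of the exponential is absorbed through its factor \<open>\<tau>\<close>.\<close>
    define c' where "c' = v ^ 3 / 48 - v ^ 4 * \<tau> / 384 - c6"
    have ah: "a - h \<ge> q * \<tau>\<^sup>2 + c' * \<tau> ^ 3"
    proof -
      have "1 - v * \<tau> / 2 + v * (4 - 3 * v) * \<tau>\<^sup>2 / 24 - c6 * \<tau> ^ 3 - (1 - y + y\<^sup>2 / 2 - y ^ 3 / 6 + y ^ 4 / 24) = q * \<tau>\<^sup>2 + c' * \<tau> ^ 3"
        by (simp add: y_def q_def c'_def power2_eq_square power_numeral_reduce field_simps)
      then show ?thesis using a_ge h_le by linarith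
    qed
    have a_ge_h: "- h \<le> a"
    proof -
      have t2: "t \<le> 2" using power2_le_imp_le[of t 2] \<tau>3 by (simp add: \<tau>_def)
      \<comment> \<open>The derivative of the difference in \<open>t\<close> is
        \<open>v * sin t * (1 - cos (\<mu> * t))\<close>, nonnegative up to
        \<open>pi\<close>.\<close>
      have "0 \<le> a - (1 - v + v * cos t)"
      proof -
        have "0 \<le> v * sin x * (1 - cos (\<mu> * x))" if "0 \<le> x" "x \<le> t" for x
        proof -
          have "x \<le> pi" using that t2 pi_ge_two by linarith
          then show ?thesis using v sin_ge_zero[of x] that by (intro mult_nonneg_nonneg) auto
        qed
        moreover have "((\<lambda>x. cos x * cos (\<mu> * x) + \<mu> * sin x * sin (\<mu> * x) - (1 - v + v * cos x)) has_real_derivative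
            v * sin x * (1 - cos (\<mu> * x))) (at x)" for x
          unfolding v_def by (auto intro!: derivative_eq_intros simp: power2_eq_square algebra_simps)
        ultimately show ?thesis
          using DERIV_nonneg_imp_nondecreasing[of 0 t "\<lambda>x. cos x * cos (\<mu> * x) + \<mu> * sin x * sin (\<mu> * x) - (1 - v + v * cos x)"] t
          unfolding a_def Re_sign_char by force
      qed
      moreover have ct: "cos t \<ge> - 1 / 5"
      proof -
        have "\<tau> ^ 3 \<le> 3 * \<tau>\<^sup>2" using \<tau>3 mult_right_mono[of \<tau> 3 "\<tau>\<^sup>2"] by (simp add: power_numeral_reduce)
        moreover have "0 \<le> (3 - \<tau>) * (31 / 3 - \<tau>)" using \<tau>3 by (intro mult_nonneg_nonneg) auto
        moreover have "cos t \<ge> 1 - \<tau> / 2 + \<tau>\<^sup>2 / 24 - \<tau> ^ 3 / 720"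
          using cos_ge_taylor6[of t] unfolding t46 \<tau>_def[symmetric] .
        ultimately show ?thesis by (simp add: power2_eq_square field_simps)
      qed
      moreover have "v * cos t \<ge> v * (- 1 / 5)" using ct v by (intro mult_left_mono) auto
      ultimately show ?thesis using v h(3) by (simp add: field_simps)
    qed
    have J1: "h ^ m + real m * h ^ (m - 1) * (a - h) \<le> a ^ m"
      by (rule power_ge_tangent[OF h(1) a_ge_h m])
    define \<eta> where "\<eta> = h ^ (m - 1)"
    have \<eta>: "0 \<le> \<eta>" "\<eta> \<le> 1" using h by (auto simp: \<eta>_def power_le_one)
    have \<eta>_ge: "1 - \<eta> \<le> (real m - 1) * y"
    proof -
      have "h ^ (m - 1) = exp (- ((real m - 1) * y))"
        using m by (simp add: h_def of_nat_diff flip: exp_of_nat_mult)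
      then show ?thesis using exp_ge_add_one_self[of "- ((real m - 1) * y)"] by (simp add: \<eta>_def)
    qed
    have J2: "a ^ m - h ^ m - real m * q * \<tau>\<^sup>2 \<ge> real m * (\<eta> * (c' * \<tau> ^ 3) - (1 - \<eta>) * (q * \<tau>\<^sup>2))"
    proof -
      have "\<eta> * (q * \<tau>\<^sup>2 + c' * \<tau> ^ 3) \<le> \<eta> * (a - h)" using ah \<eta> by (intro mult_left_mono) auto
      then have "real m * (\<eta> * (q * \<tau>\<^sup>2 + c' * \<tau> ^ 3)) \<le> real m * (\<eta> * (a - h))" by (rule mult_left_mono) simp
      then show ?thesis using J1 by (simp add: \<eta>_def algebra_simps)
    qed
    \<comment> \<open>The coefficient of the loss not due to the imaginary part; from
      \<open>v = 7 / 10\<close> on there is none, as then \<open>q \<le> 0\<close> and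
      \<open>c' \<ge> 0\<close>.\<close>
    define Lq where "Lq = (if v < 7 / 10 then (real m - 1) * (v\<^sup>2 * max 0 (2 - 3 * v) / 24) + v * (1 - v) / 45 else 0)"
    have J3: "\<eta> * (c' * \<tau> ^ 3) - (1 - \<eta>) * (q * \<tau>\<^sup>2) \<ge> - (Lq * \<tau> ^ 3)"
    proof (cases "v < 7 / 10")
      case True
      have "v ^ 4 * \<tau> \<le> v ^ 3 * 3"
        using v \<tau> \<tau>3 by (intro mult_mono power_decreasing) auto
      moreover have "0 \<le> v ^ 3" using v by simp
      ultimately have "v ^ 4 * \<tau> / 384 \<le> v ^ 3 / 48" by linarith
      moreover have "c6 \<le> v * (1 - v) / 45"
      proof -
        have "v * v \<le> 7 / 10 * v" using True v by (intro mult_right_mono) auto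
        then have "v * (16 - 20 * v + 5 * v\<^sup>2) \<le> v * (16 * (1 - v))"
          using v by (intro mult_left_mono) (auto simp: power2_eq_square)
        moreover have e: "v * (1 - v) / 45 = v * (16 * (1 - v)) / 720" by simp
        ultimately show ?thesis unfolding e c6_def by (intro divide_right_mono) auto
      qed
      ultimately have c': "- (v * (1 - v) / 45) \<le> c'" unfolding c'_def by linarith
      have "\<eta> * (c' * \<tau> ^ 3) \<ge> - (v * (1 - v) / 45 * \<tau> ^ 3)"
      proof -
        have "- (v * (1 - v) / 45) \<le> \<eta> * - (v * (1 - v) / 45)"
          using \<eta> v mult_right_mono[of \<eta> 1 "v * (1 - v) / 45"] by simp
        also have "\<dots> \<le> \<eta> * c'" using c' \<eta> by (intro mult_left_mono)
        finally have "- (v * (1 - v) / 45) * \<tau> ^ 3 \<le> \<eta> * c' * \<tau> ^ 3" using \<tau> by (intro mult_right_mono) auto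
        then show ?thesis by (simp add: mult_ac)
      qed
      moreover have "(1 - \<eta>) * (q * \<tau>\<^sup>2) \<le> (real m - 1) * (v\<^sup>2 * max 0 (2 - 3 * v) / 24) * \<tau> ^ 3"
      proof -
        have "(1 - \<eta>) * (q * \<tau>\<^sup>2) \<le> (1 - \<eta>) * (v * max 0 (2 - 3 * v) / 12 * \<tau>\<^sup>2)"
          using \<eta> v by (intro mult_left_mono mult_right_mono) (auto simp: q_def intro!: divide_right_mono mult_left_mono)
        also have "\<dots> \<le> ((real m - 1) * y) * (v * max 0 (2 - 3 * v) / 12 * \<tau>\<^sup>2)"
          using \<eta>_ge v by (intro mult_right_mono) auto
        also have "\<dots> = (real m - 1) * (v\<^sup>2 * max 0 (2 - 3 * v) / 24) * \<tau> ^ 3"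
          by (simp add: y_def power2_eq_square power3_eq_cube)
        finally show ?thesis .
      qed
      moreover have "Lq * \<tau> ^ 3 = (real m - 1) * (v\<^sup>2 * max 0 (2 - 3 * v) / 24) * \<tau> ^ 3 + v * (1 - v) / 45 * \<tau> ^ 3"
        unfolding Lq_def using True by (simp add: distrib_right)
      ultimately show ?thesis by linarith
    next
      case F: False
      have "c' \<ge> 0"
      proof -
        have "0 \<le> (v - 7 / 10) * (35 / 8 * v + 20 + 49 / 16)" using F v by (intro mult_nonneg_nonneg) auto
        then have 1: "16 - 20 * v + 5 * v\<^sup>2 \<le> 75 / 8 * v\<^sup>2" by (simp add: power2_eq_square field_simps)
        have 2: "v ^ 3 * \<tau> \<le> v ^ 3 * 3" using v \<tau>3 by (intro mult_left_mono) auto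
        have 3: "v ^ 3 \<le> v\<^sup>2" using v by (intro power_decreasing) auto
        have "(16 - 20 * v + 5 * v\<^sup>2) / 720 \<le> v\<^sup>2 / 48 - v ^ 3 * \<tau> / 384"
        proof -
          have "(16 - 20 * v + 5 * X) / 720 \<le> X / 48 - Z / 384"
            if "16 - 20 * v + 5 * X \<le> 75 / 8 * X" "Z \<le> Y * 3" "Y \<le> X" for X Y Z :: real
          proof -
            have "(16 - 20 * v + 5 * X) / 720 \<le> 75 / 8 * X / 720" using that(1) by (rule divide_right_mono) simp
            moreover have "Z \<le> X * 3" using that by simp
            ultimately show ?thesis by (simp add: field_simps)
          qed
          then show ?thesis using 1 2 3 by blast
        qed
        then have "0 \<le> v * (v\<^sup>2 / 48 - v ^ 3 * \<tau> / 384 - (16 - 20 * v + 5 * v\<^sup>2) / 720)" using v by (intro mult_nonneg_nonneg) auto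
        also have "\<dots> = c'" by (simp add: c'_def c6_def power2_eq_square power_numeral_reduce field_simps)
        finally show ?thesis .
      qed
      moreover have "q \<le> 0" using F v by (simp add: q_def mult_nonneg_nonpos)
      then have "(1 - \<eta>) * (q * \<tau>\<^sup>2) \<le> 0"
        using \<eta> by (intro mult_nonneg_nonpos mult_nonpos_nonneg) auto
      moreover have "0 \<le> \<eta> * (c' * \<tau> ^ 3)" using \<open>c' \<ge> 0\<close> \<eta> \<tau> by (intro mult_nonneg_nonneg) auto
      moreover have "Lq * \<tau> ^ 3 = 0" using F by (simp add: Lq_def)
      ultimately show ?thesis by linarith
    qed
    have b2: "b\<^sup>2 \<le> (1 - v) * v\<^sup>2 * \<tau> ^ 3 / 9"
    proof -
      have "\<bar>b\<bar> \<le> \<bar>\<mu>\<bar> * v * t ^ 3 / 3" unfolding b_def v_def using \<mu> t by (intro Im_sign_char_le) auto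
      then have "\<bar>b\<bar>\<^sup>2 \<le> (\<bar>\<mu>\<bar> * v * t ^ 3 / 3)\<^sup>2" by (intro power_mono) auto
      also have "\<dots> = (1 - v) * v\<^sup>2 * \<tau> ^ 3 / 9"
        unfolding t46(2)[symmetric] by (simp add: v_def power_mult_distrib power_divide flip: power_mult)
      finally show ?thesis by simp
    qed
    have Re_ge: "Re (sign_char \<mu> t ^ m) \<ge> a ^ m - real m * ((real m - 1) * ((1 - v) * v\<^sup>2 / 18)) * \<tau> ^ 3"
    proof -
      have "a ^ m - Re (sign_char \<mu> t ^ m) \<le> real m * (real m - 1) / 2 * b\<^sup>2"
        using Re_power_bound[OF n1, of m] unfolding a_def b_def by linarith
      also have "\<dots> \<le> real m * (real m - 1) / 2 * ((1 - v) * v\<^sup>2 * \<tau> ^ 3 / 9)"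
        using b2 M by (intro mult_left_mono) auto
      finally show ?thesis by (simp add: field_simps)
    qed
    \<comment> \<open>The midpoint of \<open>s / 2\<close> and \<open>x / 2\<close>, at which the
      midpoint rule evaluates the remainder of the exponential.\<close>
    define w where "w = (s + x) / 4"
    have w: "w = real m * \<tau> * (1 + v) / 4" by (simp add: w_def x_def s algebra_simps)
    have w0: "0 \<le> w" using v \<tau> M by (simp add: w)
    have K: "real m * \<tau> ^ 3 * ((real m)\<^sup>2 * (1 - v) * (1 + v)\<^sup>2 / (64 * (1 + 3 * real m * (1 + v) / 8))) \<le>
        - s / 2 + x / 2 + (s\<^sup>2 - x\<^sup>2) / 8 - exp (- s / 2) + exp (- x / 2)"
    proof -
      have d0: "0 < 1 + w / 2" using w0 by simp
      have d1: "1 + w / 2 \<le> 1 + 3 * real m * (1 + v) / 8"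
      proof -
        have "real m * \<tau> * (1 + v) \<le> real m * 3 * (1 + v)" using v \<tau>3 by (intro mult_right_mono mult_left_mono) auto
        then show ?thesis by (simp add: w)
      qed
      have sx: "(s - x) / 2 = (1 - v) * (real m * \<tau>) / 2" by (simp add: x_def s algebra_simps)
      have "real m * \<tau> ^ 3 * ((real m)\<^sup>2 * (1 - v) * (1 + v)\<^sup>2 / (64 * (1 + 3 * real m * (1 + v) / 8))) =
          (s - x) / 2 * (w\<^sup>2 / 2 / (1 + 3 * real m * (1 + v) / 8))"
        unfolding sx w by (simp add: power2_eq_square power3_eq_cube)
      also have "\<dots> \<le> (s - x) / 2 * (w\<^sup>2 / 2 / (1 + w / 2))"
        unfolding sx using v \<tau> d0 d1 M by (intro mult_left_mono divide_left_mono) auto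
      also have "\<dots> \<le> (s - x) / 2 * (exp (- w) - 1 + w)"
        unfolding sx using v \<tau> M w0 by (intro mult_left_mono exp_remainder2_ge) auto
      also have "\<dots> = (s - x) / 2 * (exp (- (s + x) / 4) - 1 + (s + x) / 4)"
        by (simp only: w_def minus_divide_left)
      also have "\<dots> \<le> - s / 2 + x / 2 + (s\<^sup>2 - x\<^sup>2) / 8 - exp (- s / 2) + exp (- x / 2)"
        using v s0 by (intro exp_midpoint_gap) (use mult_right_mono[of v 1 s] in \<open>simp add: x_def\<close>)
      finally show ?thesis .
    qed
    have D: "?D = (Re (sign_char \<mu> t ^ m) - h ^ m - real m * q * \<tau>\<^sup>2) + (- s / 2 + x / 2 + (s\<^sup>2 - x\<^sup>2) / 8 - exp (- s / 2) + exp (- x / 2))"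
      unfolding sm hm by (simp add: q_def x_def power2_eq_square field_simps)
    have "(real m - 1) * ((1 - v) * v\<^sup>2 / 18) + Lq \<le> (real m)\<^sup>2 * (1 - v) * (1 + v)\<^sup>2 / (64 * (1 + 3 * real m * (1 + v) / 8))"
      unfolding Lq_def by (rule quartic_gap_coeff[OF v M])
    then have "real m * \<tau> ^ 3 * ((real m - 1) * ((1 - v) * v\<^sup>2 / 18) + Lq) \<le>
        real m * \<tau> ^ 3 * ((real m)\<^sup>2 * (1 - v) * (1 + v)\<^sup>2 / (64 * (1 + 3 * real m * (1 + v) / 8)))"
      using \<tau> by (intro mult_left_mono) auto
    moreover have "real m * (\<eta> * (c' * \<tau> ^ 3) - (1 - \<eta>) * (q * \<tau>\<^sup>2)) \<ge> real m * (- (Lq * \<tau> ^ 3))"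
      using J3 by (intro mult_left_mono) auto
    moreover have "real m * \<tau> ^ 3 * ((real m - 1) * ((1 - v) * v\<^sup>2 / 18) + Lq) =
        real m * ((real m - 1) * ((1 - v) * v\<^sup>2 / 18)) * \<tau> ^ 3 - real m * (- (Lq * \<tau> ^ 3))"
      by (simp add: algebra_simps)
    ultimately show ?thesis
      unfolding D using K J2 Re_ge by linarith
  qed
qed

text \<open>The comparison holds at each \<open>t\<close> separately and is only integrated against
  \<open>t powr (- r - 1)\<close>. The kernel contains \<open>- cos\<close>, hence the
  characteristic function was bounded from below.\<close>

lemma sign_sum_moment_le_4_5:
  assumes \<mu>: "\<bar>\<mu>\<bar> \<le> 1" and m: "m \<ge> 2" and r: "4 < r" "r < 6"
  shows "sign_sum_mean \<mu> m (\<lambda>x. \<bar>x\<bar> powr r) \<le> real m powr (r / 2) * normal_abs_moment r"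
proof -
  define k where "k = (\<lambda>x::real. x ^ 4 / 24 - x\<^sup>2 / 2 + 1 - cos x)"
  have [measurable]: "k \<in> borel_measurable borel" by (simp add: k_def)
  have k0: "0 \<le> k x" for x using cos_le_taylor4[of x] by (simp add: k_def)
  obtain K where K: "K > 0" "(\<integral>\<^sup>+t\<in>{0<..}. ennreal (k t * t powr (- r - 1)) \<partial>lborel) = ennreal K"
  proof (rule kernel_integral_finite[of k 2 6 r 4])
    show "k x \<le> 2 * x powr 6" if "0 < x" "x \<le> 1" for x
    proof -
      have "k x \<le> x ^ 6 / 720" using cos_ge_taylor6[of x] unfolding k_def by linarith
      also have "\<dots> \<le> 2 * x ^ 6" using that by simp
      finally show ?thesis using that by simp
    qed
    show "k x \<le> 2 * x powr 4" if "1 \<le> x" for x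
    proof -
      have "1 \<le> x ^ 2" "1 \<le> x ^ 4" using that one_le_power[of x] by blast+
      then have "k x \<le> 2 * x ^ 4" using cos_ge_minus_one[of x] unfolding k_def by linarith
      then show ?thesis using that by simp
    qed
    show "0 < k x" if "x \<in> {4..5}" for x
    proof -
      have 16: "4 ^ 2 \<le> x ^ 2" using that by (intro power_mono) auto
      have "16 * x ^ 2 \<le> x ^ 2 * x ^ 2" using 16 by (intro mult_right_mono) auto
      also have "\<dots> = x ^ 4" by (simp flip: power_add)
      finally have "16 * x ^ 2 \<le> x ^ 4" .
      moreover have "16 \<le> x ^ 2" using 16 by simp
      ultimately show ?thesis using cos_le_one[of x] unfolding k_def by linarith
    qed
  qed (use r k0 in auto)
  show ?thesis
  proof (rule sign_sum_moment_le_via_kernel[OF _ _ _ _ \<mu> K(1) _ K(2)])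
    show "(\<integral>\<^sup>+t\<in>{0<..}. ennreal (sign_sum_mean \<mu> m (\<lambda>x. k (t * x)) * t powr (- r - 1)) \<partial>lborel) \<le>
      (\<integral>\<^sup>+t\<in>{0<..}. (\<integral>\<^sup>+z. ennreal (k (t * (sqrt m * z)) * std_normal_density z) \<partial>lborel) * ennreal (t powr (- r - 1)) \<partial>lborel)"
    proof (rule nn_integral_mono)
      fix t :: real
      show "ennreal (sign_sum_mean \<mu> m (\<lambda>x. k (t * x)) * t powr (- r - 1)) * indicator {0<..} t \<le>
        (\<integral>\<^sup>+z. ennreal (k (t * (sqrt m * z)) * std_normal_density z) \<partial>lborel) * ennreal (t powr (- r - 1)) * indicator {0<..} t"
      proof (cases "t > 0")
        case True
        define v where "v = 1 - \<mu>\<^sup>2"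
        define s where "s = real m * t\<^sup>2"
        define a where "a = t * sqrt m"
        have a: "a ^ 2 = s" "a ^ 4 = s ^ 2"
          by (simp_all add: a_def s_def power_mult_distrib power4_eq_xxxx power2_eq_square)
        have "has_bochner_integral lborel (\<lambda>z. std_normal_density z * (a * z) ^ 4 / 24 - std_normal_density z * (a * z) ^ 2 / 2
            + std_normal_density z - std_normal_density z * cos (a * z)) (3 * a ^ 4 / 24 - a ^ 2 / 2 + 1 - exp (- a\<^sup>2 / 2))"
          by (intro has_bochner_integral_add has_bochner_integral_diff has_bochner_integral_divide_zero
              integral_power4_std_normal integral_power2_std_normal integral_cos_std_normal)
            (simp add: has_bochner_integral_iff)
        moreover have "k (t * (sqrt m * z)) * std_normal_density z = std_normal_density z * (a * z) ^ 4 / 24 - std_normal_density z * (a * z) ^ 2 / 2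
            + std_normal_density z - std_normal_density z * cos (a * z)" for z
          by (simp add: k_def a_def algebra_simps)
        ultimately have hb: "has_bochner_integral lborel (\<lambda>z. k (t * (sqrt m * z)) * std_normal_density z) (s\<^sup>2 / 8 - s / 2 + 1 - exp (- s / 2))"
          by (simp add: a)
        have G: "(\<integral>\<^sup>+z. ennreal (k (t * (sqrt m * z)) * std_normal_density z) \<partial>lborel) = ennreal (s\<^sup>2 / 8 - s / 2 + 1 - exp (- s / 2))"
          using hb k0 by (subst nn_integral_eq_integral) (auto simp: has_bochner_integral_iff)
        have "sign_sum_mean \<mu> m (\<lambda>x. k (t * x)) = sign_sum_mean \<mu> m (\<lambda>x. (t ^ 4 / 24) * x ^ 4 - (t\<^sup>2 / 2) * x ^ 2 + 1 - cos (t * x))"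
          by (simp add: k_def power_mult_distrib)
        also have "\<dots> = (t ^ 4 / 24) * (3 * (real m)\<^sup>2 * v\<^sup>2 + real m * v * (4 - 6 * v)) - (t\<^sup>2 / 2) * (real m * v) + 1 - Re (sign_char \<mu> t ^ m)"
          unfolding sign_sum_mean_diff sign_sum_mean_add sign_sum_mean_cmult sign_sum_mean_power4 sign_sum_mean_power2 sign_sum_mean_cos v_def by simp
        also have "\<dots> \<le> s\<^sup>2 / 8 - s / 2 + 1 - exp (- s / 2)"
        proof -
          have "s\<^sup>2 / 8 - s / 2 + 1 - exp (- s / 2) - ((t ^ 4 / 24) * (3 * (real m)\<^sup>2 * v\<^sup>2 + real m * v * (4 - 6 * v)) - (t\<^sup>2 / 2) * (real m * v) + 1 - Re (sign_char \<mu> t ^ m)) =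
             Re (sign_char \<mu> t ^ m) - exp (- s / 2) - (1 - v) * s / 2 + s\<^sup>2 * (1 - v\<^sup>2) / 8 + s\<^sup>2 / real m * (v\<^sup>2 / 4 - v / 6)"
            using m by (simp add: s_def power2_eq_square power4_eq_xxxx field_simps)
          then show ?thesis using quartic_kernel_pointwise[OF \<mu> m True] unfolding v_def s_def by linarith
        qed
        finally have "ennreal (sign_sum_mean \<mu> m (\<lambda>x. k (t * x))) \<le> (\<integral>\<^sup>+z. ennreal (k (t * (sqrt m * z)) * std_normal_density z) \<partial>lborel)"
          unfolding G by (rule ennreal_leI)
        moreover have "ennreal (sign_sum_mean \<mu> m (\<lambda>x. k (t * x)) * t powr (- r - 1)) =
            ennreal (sign_sum_mean \<mu> m (\<lambda>x. k (t * x))) * ennreal (t powr (- r - 1))"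
          by (rule ennreal_mult'') simp
        ultimately show ?thesis by (simp only:) (intro mult_right_mono, auto)
      qed simp
    qed
  qed (use r k0 in \<open>auto simp: k_def\<close>)
qed

section \<open>Moments of order above 5\<close>

text \<open>With cubes in place of fifth powers, the comparison of one biased sign with a normal
  variable fails, for instance at \<open>\<mu> = - 2 / 5\<close> and the shift
  \<open>s = 3 / 5\<close>.\<close>

abbreviation pos5 :: "real \<Rightarrow> real" where
  "pos5 x \<equiv> (max 0 x) ^ 5"

text \<open>Half the sum of the absolute and the signed moment is the moment of the positive part.
  The ratio of the second value to the first is the constant \<open>c\<close> in
  \<open>normal_pos5_ge_exp\<close>.\<close>

lemma std_normal_pos5_moments:
  shows
    "has_bochner_integral lborel (\<lambda>z. std_normal_density z * pos5 z) (4 * sqrt (2 / pi))"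
    "has_bochner_integral lborel (\<lambda>z. std_normal_density z * (max 0 z) ^ 6) (15 / 2)"
proof -
  have "has_bochner_integral lborel
      (\<lambda>z. (std_normal_density z * \<bar>z\<bar> ^ (2 * 2 + 1) + std_normal_density z * z ^ (2 * 2 + 1)) / 2)
      ((sqrt (2 / pi) * 2 ^ 2 * fact 2 + 0) / 2)"
    by (intro has_bochner_integral_divide_zero has_bochner_integral_add std_normal_moment_abs_odd std_normal_moment_odd)
  then show "has_bochner_integral lborel (\<lambda>z. std_normal_density z * pos5 z) (4 * sqrt (2 / pi))"
    by (rule has_bochner_integral_cong[THEN iffD1, rotated -1])
      (auto simp: max_def abs_if fact_numeral)
  have odd: "has_bochner_integral lborel (\<lambda>z. std_normal_density z * (z * \<bar>z\<bar> ^ 5)) 0"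
  proof -
    have i: "integrable lborel (\<lambda>z. std_normal_density z * (z * \<bar>z\<bar> ^ 5))"
      by (rule Bochner_Integration.integrable_bound[OF integrable_std_normal_moment_abs[of 6]])
        (auto simp: abs_mult power_numeral_reduce)
    have "(\<integral>z. std_normal_density z * (z * \<bar>z\<bar> ^ 5) \<partial>lborel) =
        (\<integral>z. std_normal_density (- z) * (- z * \<bar>- z\<bar> ^ 5) \<partial>lborel)"
      by (subst lborel_integral_real_affine[where c = "-1" and t = 0]) auto
    also have "\<dots> = - (\<integral>z. std_normal_density z * (z * \<bar>z\<bar> ^ 5) \<partial>lborel)"
      unfolding Bochner_Integration.integral_minus[symmetric] by (simp add: std_normal_density_def)
    finally show ?thesis using i by (simp add: has_bochner_integral_iff)
  qed
  have "has_bochner_integral lborel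
      (\<lambda>z. (std_normal_density z * z ^ (2 * 3) + std_normal_density z * (z * \<bar>z\<bar> ^ 5)) / 2)
      ((fact (2 * 3) / (2 ^ 3 * fact 3) + 0) / 2)"
    by (intro has_bochner_integral_divide_zero has_bochner_integral_add std_normal_moment_even odd)
  then show "has_bochner_integral lborel (\<lambda>z. std_normal_density z * (max 0 z) ^ 6) (15 / 2)"
    by (rule has_bochner_integral_cong[THEN iffD1, rotated -1])
      (auto simp: max_def abs_if fact_numeral power_numeral_reduce)
qed

lemma integrable_std_normal_pos5:
  "integrable lborel (\<lambda>z. std_normal_density z * pos5 (z - t))"
proof (rule Bochner_Integration.integrable_bound)
  show "integrable lborel (\<lambda>z. 32 * (std_normal_density z * \<bar>z\<bar> ^ 5) + 32 * \<bar>t\<bar> ^ 5 * std_normal_density z)"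
    using integrable_std_normal_moment_abs[of 5] by auto
  have *: "pos5 (z - t) \<le> 32 * \<bar>z\<bar> ^ 5 + 32 * \<bar>t\<bar> ^ 5" for z :: real
  proof -
    have "pos5 (z - t) \<le> (2 * max \<bar>z\<bar> \<bar>t\<bar>) ^ 5" by (intro power_mono) auto
    also have "\<dots> \<le> 32 * \<bar>z\<bar> ^ 5 + 32 * \<bar>t\<bar> ^ 5" by (simp add: power_mult_distrib max_def)
    finally show ?thesis .
  qed
  show "AE z in lborel. norm (std_normal_density z * pos5 (z - t)) \<le>
      norm (32 * (std_normal_density z * \<bar>z\<bar> ^ 5) + 32 * \<bar>t\<bar> ^ 5 * std_normal_density z)"
  proof (intro AE_I2)
    fix z :: real
    have "std_normal_density z * pos5 (z - t) \<le> std_normal_density z * (32 * \<bar>z\<bar> ^ 5 + 32 * \<bar>t\<bar> ^ 5)"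
      using * by (intro mult_left_mono) auto
    then show "norm (std_normal_density z * pos5 (z - t)) \<le>
        norm (32 * (std_normal_density z * \<bar>z\<bar> ^ 5) + 32 * \<bar>t\<bar> ^ 5 * std_normal_density z)"
      by (simp add: abs_mult algebra_simps)
  qed
qed auto

text \<open>Dropping the truncation loses little for large positive \<open>s\<close>; the polynomial
  is the fifth moment of a normal variable with mean \<open>s\<close> and variance 1.\<close>

lemma normal_pos5_ge_poly:
  "(\<integral>z. std_normal_density z * pos5 (z + s) \<partial>lborel) \<ge> s ^ 5 + 10 * s ^ 3 + 15 * s"
proof -
  have 1: "has_bochner_integral lborel (\<lambda>z. std_normal_density z * z ^ (2 * 2 + 1) +
     (5 * s * (std_normal_density z * z ^ (2 * 2)) + (10 * s\<^sup>2 * (std_normal_density z * z ^ (2 * 1 + 1)) +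
     (10 * s ^ 3 * (std_normal_density z * z ^ (2 * 1)) + (5 * s ^ 4 * (std_normal_density z * z ^ (2 * 0 + 1)) +
     s ^ 5 * (std_normal_density z * z ^ (2 * 0)))))))
     (0 + (5 * s * (fact (2 * 2) / (2 ^ 2 * fact 2)) + (10 * s\<^sup>2 * 0 + (10 * s ^ 3 * (fact (2 * 1) / (2 ^ 1 * fact 1)) +
     (5 * s ^ 4 * 0 + s ^ 5 * (fact (2 * 0) / (2 ^ 0 * fact 0)))))))"
    by (intro has_bochner_integral_add has_bochner_integral_mult_right std_normal_moment_even std_normal_moment_odd)
  have 2: "has_bochner_integral lborel (\<lambda>z. std_normal_density z * (z + s) ^ 5) (s ^ 5 + 10 * s ^ 3 + 15 * s)"
    by (rule has_bochner_integral_cong[THEN iffD1, OF refl _ _ 1])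
      (auto simp: fact_numeral power_numeral_reduce algebra_simps)
  then have "s ^ 5 + 10 * s ^ 3 + 15 * s = (\<integral>z. std_normal_density z * (z + s) ^ 5 \<partial>lborel)"
    by (simp add: has_bochner_integral_iff)
  also have "\<dots> \<le> (\<integral>z. std_normal_density z * pos5 (z + s) \<partial>lborel)"
  proof (rule integral_mono)
    show "integrable lborel (\<lambda>z. std_normal_density z * (z + s) ^ 5)"
      using 2 by (simp add: has_bochner_integral_iff)
    show "integrable lborel (\<lambda>z. std_normal_density z * pos5 (z + s))"
      using integrable_std_normal_pos5[of "- s"] by simp
    show "std_normal_density z * (z + s) ^ 5 \<le> std_normal_density z * pos5 (z + s)" for z
    proof -
      have "(z + s) ^ 5 \<le> pos5 (z + s)"
      proof (cases "z + s \<ge> 0")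
        case False
        then have "(z + s) ^ 5 \<le> 0" by (simp add: power_le_zero_eq)
        then show ?thesis by (rule order_trans) simp
      qed (simp add: max_def)
      then show ?thesis by (simp add: mult_left_mono)
    qed
  qed
  finally show ?thesis .
qed

text \<open>Shifting the density gives the mean of \<open>pos5 z\<close> weighted by
  \<open>exp (s * z - s\<^sup>2 / 2)\<close>. The bound is Jensen's inequality for the measure whose
  density is proportional to \<open>pos5 z\<close> times the normal density and whose mean is
  \<open>c\<close>; it appears as the tangent of the exponential at \<open>c\<close>.\<close>

lemma normal_pos5_ge_exp:
  assumes m5: "m5 = 4 * sqrt (2 / pi)"
  shows "(\<integral>z. std_normal_density z * pos5 (z + s) \<partial>lborel) \<ge> m5 * exp (15 / 2 / m5 * s - s\<^sup>2 / 2)"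
proof -
  have m5_pos: "m5 > 0" by (simp add: m5)
  define c where "c = 15 / 2 / m5"
  have c: "c * m5 = 15 / 2" using m5_pos by (simp add: c_def)
  have "has_bochner_integral lborel
      (\<lambda>z. exp (c * s - s\<^sup>2 / 2) * ((1 - s * c) * (std_normal_density z * pos5 z) + s * (std_normal_density z * (max 0 z) ^ 6)))
      (exp (c * s - s\<^sup>2 / 2) * ((1 - s * c) * (4 * sqrt (2 / pi)) + s * (15 / 2)))"
    by (intro has_bochner_integral_mult_right has_bochner_integral_add std_normal_pos5_moments)
  moreover have "(1 - s * c) * (4 * sqrt (2 / pi)) + s * (15 / 2) = m5"
    using c by (simp add: m5[symmetric] algebra_simps)
  ultimately have 1: "has_bochner_integral lborel
      (\<lambda>z. exp (c * s - s\<^sup>2 / 2) * ((1 - s * c) * (std_normal_density z * pos5 z) + s * (std_normal_density z * (max 0 z) ^ 6)))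
      (exp (c * s - s\<^sup>2 / 2) * m5)" by simp
  have shift: "(\<integral>z. std_normal_density z * pos5 (z + s) \<partial>lborel) = (\<integral>z. std_normal_density (z - s) * pos5 z \<partial>lborel)"
    by (subst lborel_integral_real_affine[where c = 1 and t = "- s"]) auto
  have "integrable lborel (\<lambda>z. std_normal_density z * pos5 (z + s))"
    using integrable_std_normal_pos5[of "- s"] by simp
  from lborel_integrable_real_affine[OF this, of 1 "- s"]
  have int: "integrable lborel (\<lambda>z. std_normal_density (z - s) * pos5 z)" by simp
  have "exp (c * s - s\<^sup>2 / 2) * m5 = (\<integral>z. exp (c * s - s\<^sup>2 / 2) *
      ((1 - s * c) * (std_normal_density z * pos5 z) + s * (std_normal_density z * (max 0 z) ^ 6)) \<partial>lborel)"
    using 1 by (simp add: has_bochner_integral_iff)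
  also have "\<dots> \<le> (\<integral>z. std_normal_density (z - s) * pos5 z \<partial>lborel)"
  proof (rule integral_mono[OF _ int])
    fix z :: real
    have dens: "std_normal_density (z - s) = std_normal_density z * exp (z * s - s\<^sup>2 / 2)"
      unfolding std_normal_density_def by (simp add: power2_eq_square field_simps flip: exp_add)
    have "exp (z * s - s\<^sup>2 / 2) = exp (c * s - s\<^sup>2 / 2) * exp (s * (z - c))"
      by (simp add: algebra_simps flip: exp_add)
    moreover have "1 + s * (z - c) \<le> exp (s * (z - c))" by (rule exp_ge_add_one_self)
    ultimately have "exp (c * s - s\<^sup>2 / 2) * (1 + s * (z - c)) \<le> exp (z * s - s\<^sup>2 / 2)"
      by simp
    then have "std_normal_density z * pos5 z * (exp (c * s - s\<^sup>2 / 2) * (1 + s * (z - c))) \<le>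
        std_normal_density z * pos5 z * exp (z * s - s\<^sup>2 / 2)"
      by (intro mult_left_mono) auto
    moreover have "(max 0 z) ^ 6 = pos5 z * z"
      by (auto simp: max_def power_numeral_reduce)
    ultimately show "exp (c * s - s\<^sup>2 / 2) *
      ((1 - s * c) * (std_normal_density z * pos5 z) + s * (std_normal_density z * (max 0 z) ^ 6))
      \<le> std_normal_density (z - s) * pos5 z"
      unfolding dens by (simp add: algebra_simps)
  qed (use 1 in \<open>simp add: has_bochner_integral_iff\<close>)
  finally show ?thesis using shift by (simp add: c_def mult.commute)
qed

text \<open>The inequality of arithmetic and geometric means with weights 1 and 5; it serves to
  eliminate the bias of a sign.\<close>

lemma weighted_power5_le:
  assumes "a \<ge> (0::real)" "u \<ge> 0"
  shows "a * u ^ 5 \<le> ((a + 5 * u) / 6) ^ 6"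
proof (cases "a + 5 * u = 0")
  case False
  define w where "w = (a + 5 * u) / 6"
  have w: "w > 0" using assms False by (auto simp: w_def)
  define x where "x = u / w - 1"
  have u: "u = w * (1 + x)" using w by (simp add: x_def)
  have a: "a = w * (1 - 5 * x)" using w by (simp add: x_def w_def field_simps)
  have "x \<ge> -1" using assms w by (simp add: x_def)
  moreover have "1 - 5 * x \<ge> 0" using a w assms by (simp add: zero_le_mult_iff)
  moreover have "1 + x \<le> exp x" "1 - 5 * x \<le> exp (- 5 * x)"
    using exp_ge_add_one_self[of x] exp_ge_add_one_self[of "- 5 * x"] by auto
  ultimately have "(1 - 5 * x) * (1 + x) ^ 5 \<le> exp (- 5 * x) * exp x ^ 5"
    by (intro mult_mono power_mono) auto
  also have "\<dots> = 1" by (simp flip: exp_of_nat_mult exp_add)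
  finally have "w ^ 6 * ((1 - 5 * x) * (1 + x) ^ 5) \<le> w ^ 6 * 1"
    using w by (intro mult_left_mono) auto
  then show ?thesis
    unfolding w_def[symmetric] by (simp add: a u power_mult_distrib power_numeral_reduce mult_ac)
next
  case True
  then have "a = 0" "u = 0" using assms by linarith+
  then show ?thesis by simp
qed

lemma pi_bounds: "(6283 / 2000) \<le> pi" "pi \<le> (3927 / 1250)"
  using pi_approx by auto

lemma exp_neg_ge: "exp (- 7) \<ge> 1 / (2187::real)"
proof -
  have "exp (7::real) = exp 1 ^ 7" by (simp flip: exp_of_nat_mult)
  also have "\<dots> \<le> 3 ^ 7" using exp_le by (intro power_mono) auto
  finally show ?thesis by (simp add: exp_minus field_simps)
qed

lemma exp_ge_power: "n > 0 \<Longrightarrow> 1 + x / real n \<ge> 0 \<Longrightarrow> (1 + x / real n) ^ n \<le> exp x"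
proof -
  assume n: "n > 0" "1 + x / real n \<ge> 0"
  have "(1 + x / real n) ^ n \<le> exp (x / real n) ^ n"
    using n by (intro power_mono exp_ge_add_one_self) auto
  also have "\<dots> = exp x" using n by (simp flip: exp_of_nat_mult)
  finally show ?thesis .
qed

text \<open>The left side bounds the mean over one sign for all biases simultaneously. The right
  side is estimated by \<open>normal_pos5_ge_exp\<close>, with \<open>m5\<close> about 3.1915 and
  \<open>c\<close> about 2.35 enclosed by rationals.\<close>

lemma normal_pos5_ge_near:
  assumes "-2 \<le> s" "s \<le> 2 / 5"
  shows "1 / 10 * (5 / 6 * (2 + s)) ^ 6 + (max 0 s) ^ 5 \<le> (\<integral>z. std_normal_density z * pos5 (z + s) \<partial>lborel)"
proof -
  define m5 where "m5 = 4 * sqrt (2 / pi)"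
  have "((15957 / 5000) / 4)\<^sup>2 \<le> 2 / pi" "2 / pi \<le> ((7979 / 2500) / 4)\<^sup>2"
    using pi_bounds by (auto simp: field_simps power2_eq_square)
  then have m5: "(15957 / 5000) \<le> m5" "m5 \<le> (7979 / 2500)"
    using real_le_rsqrt[of "(15957 / 5000) / 4" "2 / pi"] real_le_lsqrt[of "(7979 / 2500) / 4" "2 / pi"]
    by (simp_all add: m5_def)
  define c where "c = 15 / 2 / m5"
  have c: "(2349 / 1000) \<le> c" "c \<le> (11751 / 5000)"
    using m5 by (auto simp: c_def field_simps)
  have main: "(15957 / 5000) * exp (c * s - s\<^sup>2 / 2) \<le> (\<integral>z. std_normal_density z * pos5 (z + s) \<partial>lborel)"
  proof -
    have "(15957 / 5000) * exp (c * s - s\<^sup>2 / 2) \<le> m5 * exp (c * s - s\<^sup>2 / 2)"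
      using m5 by (intro mult_right_mono) auto
    then show ?thesis using normal_pos5_ge_exp[OF m5_def, of s] unfolding c_def by (rule order_trans)
  qed
  have const: "1 / 10 * (5 / 6 * (2 + s)) ^ 6 = (15625 / 7290) * (1 + s / 2) ^ 6"
  proof -
    have "5 / 6 * (2 + s) = 5 / 3 * (1 + s / 2)" by simp
    then show ?thesis by (simp only: power_mult_distrib) (simp add: power_divide)
  qed
  consider "s \<ge> 0" | "s < 0" "s \<ge> - (17 / 10)" | "s < - (17 / 10)" by linarith
  then show ?thesis
  proof cases
    case 1
    \<comment> \<open>A shift of \<open>a\<close> by \<open>1 / 50\<close> will make room for the
      term \<open>max 0 s ^ 5\<close>. The factor \<open>2137 / 2000\<close> is just below the sixth
      root of the quotient of \<open>15957 / 5000\<close> by \<open>15625 / 7290\<close>.\<close>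
    define a where "a = 1 + s / 2"
    have s2: "0 \<le> s\<^sup>2" "s\<^sup>2 \<le> 2 / 5 * s"
      using mult_right_mono[of s "2 / 5" s] 1 assms by (simp_all add: power2_eq_square)
    have nn: "0 \<le> 1 + ((2349 / 1000) * s - s\<^sup>2 / 2) / 6"
      using s2 1 assms by (simp add: field_simps)
    have "a + (1 / 50) \<le> (2137 / 2000) * (1 + ((2349 / 1000) * s - s\<^sup>2 / 2) / 6)"
      using s2 1 assms by (simp add: a_def field_simps)
    then have "(a + (1 / 50)) ^ 6 \<le> ((2137 / 2000) * (1 + ((2349 / 1000) * s - s\<^sup>2 / 2) / 6)) ^ 6"
      using 1 by (intro power_mono) (auto simp: a_def)
    also have "\<dots> = (2137 / 2000) ^ 6 * (1 + ((2349 / 1000) * s - s\<^sup>2 / 2) / real 6) ^ 6"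
      by (simp only: power_mult_distrib of_nat_numeral)
    also have "\<dots> \<le> (2137 / 2000) ^ 6 * exp ((2349 / 1000) * s - s\<^sup>2 / 2)"
      using exp_ge_power[of 6 "(2349 / 1000) * s - s\<^sup>2 / 2"] nn by (intro mult_left_mono) auto
    also have "\<dots> \<le> (2137 / 2000) ^ 6 * exp (c * s - s\<^sup>2 / 2)"
      using c 1 mult_right_mono[of "(2349 / 1000)" c s] by (intro mult_left_mono) simp_all
    finally have A: "(a + (1 / 50)) ^ 6 \<le> (2137 / 2000) ^ 6 * exp (c * s - s\<^sup>2 / 2)" .
    have "a \<ge> 1" using 1 by (simp add: a_def)
    have "a ^ 6 + (3 / 25) \<le> (a + (1 / 50)) ^ 6"
    proof -
      have "1 + 6 * ((1 / 50) / a) \<le> (1 + (1 / 50) / a) ^ 6"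
        using Bernoulli_inequality[of "(1 / 50) / a" 6] \<open>a \<ge> 1\<close> by (simp add: divide_nonneg_pos order_trans[of _ 0])
      then have "a ^ 6 * (1 + 6 * ((1 / 50) / a)) \<le> a ^ 6 * (1 + (1 / 50) / a) ^ 6"
        using \<open>a \<ge> 1\<close> by (intro mult_left_mono) auto
      also have "\<dots> = (a + (1 / 50)) ^ 6"
        using \<open>a \<ge> 1\<close> by (simp add: power_mult_distrib[symmetric] algebra_simps)
      also have "a ^ 6 * (1 + 6 * ((1 / 50) / a)) = a ^ 6 + (3 / 25) * a ^ 5"
        using \<open>a \<ge> 1\<close> by (simp add: power_numeral_reduce field_simps)
      finally have "a ^ 6 + (3 / 25) * a ^ 5 \<le> (a + (1 / 50)) ^ 6" .
      moreover have "a ^ 6 + (3 / 25) \<le> a ^ 6 + (3 / 25) * a ^ 5" using one_le_power[OF \<open>a \<ge> 1\<close>, of 5] by simp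
      ultimately show ?thesis by (rule order_trans[rotated])
    qed
    also note A
    finally have "(15625 / 7290) * (a ^ 6 + (3 / 25)) \<le> (15625 / 7290) * ((2137 / 2000) ^ 6 * exp (c * s - s\<^sup>2 / 2))"
      by (rule mult_left_mono) simp
    moreover have "(max 0 s) ^ 5 \<le> (2 / 5) ^ 5" using assms 1 by (intro power_mono) auto
    moreover have "(2 / 5) ^ 5 \<le> (15625 / 7290) * ((3 / 25)::real)" by (simp add: power_divide)
    ultimately have "(15625 / 7290) * a ^ 6 + (max 0 s) ^ 5 \<le> (15625 / 7290) * ((2137 / 2000) ^ 6 * exp (c * s - s\<^sup>2 / 2))"
      unfolding distrib_left by linarith
    also have "\<dots> = (15625 / 7290 * (2137 / 2000) ^ 6) * exp (c * s - s\<^sup>2 / 2)" by simp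
    also have "\<dots> \<le> (15957 / 5000) * exp (c * s - s\<^sup>2 / 2)"
      by (intro mult_right_mono) (simp_all add: power_divide)
    finally show ?thesis using main const by (simp add: a_def)
  next
    case 2
    define t where "t = - s"
    have t: "0 < t" "t \<le> (17 / 10)" using 2 by (auto simp: t_def)
    have "(1 + s / 2) ^ 6 \<le> exp (s / 2) ^ 6"
      using assms 2 exp_ge_add_one_self[of "s / 2"] by (intro power_mono) auto
    also have "\<dots> = exp (3 * s)" by (simp flip: exp_of_nat_mult)
    finally have 3: "(1 + s / 2) ^ 6 \<le> exp (3 * s)" .
    \<comment> \<open>Relative to \<open>exp (3 * s)\<close> the exponent is a concave quadratic in
      \<open>t\<close>, on this range smallest at \<open>17 / 10\<close>.\<close>
    have q: "(3249 / 5000) * t - t\<^sup>2 / 2 \<ge> - (69 / 200)"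
    proof -
      have "(t - (17 / 10)) * (t / 2 + (1001 / 5000)) \<le> 0" using t by (intro mult_nonpos_nonneg) auto
      then show ?thesis by (simp add: power2_eq_square field_simps)
    qed
    have "(15625 / 7290) \<le> (15957 / 5000) * (1 + (- (69 / 200)) / real 2) ^ 2"
      by (simp add: power2_eq_square)
    also have "\<dots> \<le> (15957 / 5000) * exp (- (69 / 200))"
      by (intro mult_left_mono exp_ge_power) auto
    also have "\<dots> \<le> (15957 / 5000) * exp ((3249 / 5000) * t - t\<^sup>2 / 2)"
      using q by simp
    also have "\<dots> \<le> (15957 / 5000) * exp ((c - 3) * s - s\<^sup>2 / 2)"
    proof -
      have "(3249 / 5000) * t \<le> (3 - c) * t" using c t by (intro mult_right_mono) auto
      then show ?thesis by (simp add: t_def algebra_simps)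
    qed
    finally have "(15625 / 7290) * (1 + s / 2) ^ 6 \<le> (15957 / 5000) * exp ((c - 3) * s - s\<^sup>2 / 2) * exp (3 * s)"
      using 3 assms by (intro mult_mono) auto
    also have "\<dots> = (15957 / 5000) * exp (c * s - s\<^sup>2 / 2)"
      by (simp add: algebra_simps flip: exp_add)
    finally show ?thesis using main const 2 by (simp add: max_def)
  next
    case 3
    have "(1 + s / 2) ^ 6 \<le> (3 / 20) ^ 6" using assms 3 by (intro power_mono) auto
    then have "(15625 / 7290) * (1 + s / 2) ^ 6 \<le> (15957 / 5000) * (1 / 2187)"
      by (simp add: power_numeral_reduce)
    also have "\<dots> \<le> (15957 / 5000) * exp (- 7)" using exp_neg_ge by simp
    also have "\<dots> \<le> (15957 / 5000) * exp (c * s - s\<^sup>2 / 2)"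
    proof -
      have "c * s \<ge> (11751 / 5000) * s" using c 3 by (simp add: mult_right_mono_neg)
      moreover have "s\<^sup>2 \<le> 2\<^sup>2" using assms 3 by (subst abs_le_square_iff[symmetric]) auto
      ultimately show ?thesis using assms by simp
    qed
    finally show ?thesis using main const 3 by (simp add: max_def)
  qed
qed

text \<open>The polynomial is \<open>s ^ 5 + 10 * s ^ 3 + 15 * s\<close> minus the fifth moment of
  \<open>s\<close> plus a centred sign of mean parameter \<open>- \<nu>\<close>. Positive
  \<open>\<nu>\<close> is the delicate sign: then the rarer value is the large positive one.\<close>

lemma two_point_poly_nonneg:
  fixes s \<nu> :: real
  assumes \<nu>: "0 \<le> \<nu>" "\<nu> \<le> 1" and s: "1 - \<nu> \<le> s" "2 / 5 \<le> s"
  shows "10 * s * (s * \<nu> - (1 - \<nu>\<^sup>2))\<^sup>2 + 5 * s * \<nu>\<^sup>2 * (2 + \<nu>\<^sup>2) - 4 * \<nu> * (1 - \<nu> ^ 4) \<ge> 0"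
proof -
  define v where "v = 1 - \<nu>\<^sup>2"
  define P where "P = (\<lambda>s. 10 * s * (s * \<nu> - v)\<^sup>2 + 5 * s * \<nu>\<^sup>2 * (2 + \<nu>\<^sup>2) - 4 * \<nu> * (1 - \<nu> ^ 4))"
  have v: "0 \<le> v" using \<nu> by (simp add: v_def power_le_one)
  have P_ge: "P s \<ge> \<nu> * (10 * (s * \<nu>) - 4) + 5 * s * \<nu> ^ 4 + 4 * \<nu> ^ 5"
  proof -
    have "P s = 10 * s * (s * \<nu> - v)\<^sup>2 + (\<nu> * (10 * (s * \<nu>) - 4) + 5 * s * \<nu> ^ 4 + 4 * \<nu> ^ 5)"
      by (simp add: P_def algebra_simps power_numeral_reduce power2_eq_square)
    then show ?thesis using s by simp
  qed
  have P_ge2: "P s \<ge> 10 * s * ((s * \<nu> - v)\<^sup>2 + \<nu>\<^sup>2) - 4 * \<nu>"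
  proof -
    have "P s = 10 * s * ((s * \<nu> - v)\<^sup>2 + \<nu>\<^sup>2) - 4 * \<nu> + (5 * s * \<nu> ^ 4 + 4 * \<nu> ^ 5)"
      by (simp add: P_def algebra_simps power_numeral_reduce power2_eq_square)
    moreover have "0 \<le> 5 * s * \<nu> ^ 4 + 4 * \<nu> ^ 5" using \<nu> s by simp
    ultimately show ?thesis by simp
  qed
  have "P s \<ge> 0"
  proof (cases "s * \<nu> \<ge> 2 / 5")
    case True
    then have "\<nu> * (10 * (s * \<nu>) - 4) \<ge> 0" using \<nu> by (intro mult_nonneg_nonneg) linarith+
    moreover have "5 * s * \<nu> ^ 4 \<ge> 0" "4 * \<nu> ^ 5 \<ge> 0" using \<nu> s by auto
    ultimately show ?thesis using P_ge by linarith
  next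
    case y: False
    \<comment> \<open>For small \<open>\<nu>\<close> the two squares are combined by
      \<open>2 * a * b \<le> a\<^sup>2 + b\<^sup>2\<close>; in the middle range \<open>P\<close>
      increases in \<open>s\<close>, so \<open>s = 1 - \<nu>\<close> decides; for large
      \<open>\<nu>\<close> the middle term alone beats the negative one.\<close>
    consider "\<nu> \<le> (9 / 20)" "s \<ge> (4 / 5)" | "\<nu> \<le> (9 / 20)" "s < (4 / 5)" | "(9 / 20) < \<nu>" "\<nu> \<le> (67 / 100)" | "(67 / 100) < \<nu>" by linarith
    then show ?thesis
    proof cases
      case 1
      have n2: "\<nu>\<^sup>2 \<le> (9 / 20)\<^sup>2" using 1 \<nu> by (intro power_mono) auto
      have "v - s * \<nu> \<ge> (7 / 20)" using n2 y by (simp add: v_def power2_eq_square)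
      then have "2 * ((7 / 20) * \<nu>) \<le> 2 * ((v - s * \<nu>) * \<nu>)" using \<nu> by (intro mult_left_mono mult_right_mono) auto
      also have "\<dots> \<le> (s * \<nu> - v)\<^sup>2 + \<nu>\<^sup>2"
        using zero_le_power2[of "v - s * \<nu> - \<nu>"] by (simp add: power2_eq_square algebra_simps)
      finally have "8 * (2 * ((7 / 20) * \<nu>)) \<le> 10 * s * ((s * \<nu> - v)\<^sup>2 + \<nu>\<^sup>2)"
        using 1 \<nu> by (intro mult_mono) auto
      then show ?thesis using P_ge2 \<nu> by simp
    next
      case 2
      have n2: "\<nu>\<^sup>2 \<le> (9 / 20) * \<nu>"
        using mult_right_mono[of \<nu> "(9 / 20)" \<nu>] 2 \<nu> by (simp add: power2_eq_square)
      have "s * \<nu> \<le> (4 / 5) * \<nu>" using 2 \<nu> by (intro mult_right_mono) auto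
      then have d: "v - s * \<nu> \<ge> 1 - (5 / 4) * \<nu>" using n2 by (simp add: v_def)
      have "(11 / 20) * (43 / 100) \<le> s * (v - s * \<nu>)"
        using d s 2 by (intro mult_mono) auto
      then have "(1 / 5) \<le> s * (v - s * \<nu>)" by simp
      then have "20 * \<nu> * (1 / 5) \<le> 20 * \<nu> * (s * (v - s * \<nu>))" using \<nu> by (intro mult_left_mono) auto
      also have "\<dots> = 10 * s * (2 * ((v - s * \<nu>) * \<nu>))" by (simp add: algebra_simps)
      also have "\<dots> \<le> 10 * s * ((s * \<nu> - v)\<^sup>2 + \<nu>\<^sup>2)"
        using zero_le_power2[of "v - s * \<nu> - \<nu>"] s by (intro mult_left_mono) (auto simp: power2_eq_square algebra_simps)
      finally have "4 * \<nu> \<le> 10 * s * ((s * \<nu> - v)\<^sup>2 + \<nu>\<^sup>2)" by simp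
      then show ?thesis using P_ge2 \<nu> by simp
    next
      case 3
      have n2: "(9 / 20)\<^sup>2 \<le> \<nu>\<^sup>2" using 3 by (intro power_mono) auto
      have "v\<^sup>2 \<le> (319 / 400)\<^sup>2" using n2 v by (intro power_mono) (auto simp: v_def power2_eq_square)
      moreover have "(9 / 20) ^ 4 \<le> \<nu> ^ 4" using 3 by (intro power_mono) auto
      ultimately have slope: "10 * \<nu>\<^sup>2 + 5 * \<nu> ^ 4 - 10 * v\<^sup>2 / 3 \<ge> 0"
        using n2 by (simp add: power_numeral_reduce)
      define a where "a = 1 - \<nu>"
      have "P a \<le> P s"
      proof (rule DERIV_nonneg_imp_nondecreasing[of a s])
        show "a \<le> s" using s by (simp add: a_def)
        fix x :: real
        have "(P has_real_derivative 10 * (x * \<nu> - v)\<^sup>2 + 10 * x * (2 * (x * \<nu> - v) * \<nu>) + 5 * \<nu>\<^sup>2 * (2 + \<nu>\<^sup>2)) (at x)"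
          unfolding P_def by (auto intro!: derivative_eq_intros simp: power2_eq_square algebra_simps)
        moreover have "10 * (x * \<nu> - v)\<^sup>2 + 10 * x * (2 * (x * \<nu> - v) * \<nu>) + 5 * \<nu>\<^sup>2 * (2 + \<nu>\<^sup>2) =
            30 * (x * \<nu> - 2 * v / 3)\<^sup>2 + (10 * \<nu>\<^sup>2 + 5 * \<nu> ^ 4 - 10 * v\<^sup>2 / 3)"
          by (simp add: power2_eq_square power_numeral_reduce algebra_simps)
        ultimately show "\<exists>y. (P has_real_derivative y) (at x) \<and> 0 \<le> y"
          using slope by (intro exI[of _ "30 * (x * \<nu> - 2 * v / 3)\<^sup>2 + (10 * \<nu>\<^sup>2 + 5 * \<nu> ^ 4 - 10 * v\<^sup>2 / 3)"]) auto
      qed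
      moreover have "P a = (1 - \<nu>) * (10 - 24 * \<nu> + 16 * \<nu>\<^sup>2 - 4 * \<nu> ^ 3 + \<nu> ^ 4)"
        by (simp add: P_def a_def v_def power2_eq_square power_numeral_reduce algebra_simps)
      moreover have "10 - 24 * \<nu> + 16 * \<nu>\<^sup>2 - 4 * \<nu> ^ 3 + \<nu> ^ 4 \<ge> 0"
      proof -
        have "\<nu> ^ 3 \<le> \<nu>\<^sup>2" "0 \<le> \<nu>\<^sup>2" using \<nu> power_decreasing[of 2 3 \<nu>] by auto
        then have "0 \<le> 24 - 16 * ((67 / 100) + \<nu>) + (4 * (\<nu>\<^sup>2 + (67 / 100) * \<nu> + (4489 / 10000)) - (\<nu> ^ 3 + (67 / 100) * \<nu>\<^sup>2 + (4489 / 10000) * \<nu> + (300763 / 1000000)))"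
        proof -
          have "0 \<le> 24 - 16 * ((67 / 100) + \<nu>) + (4 * (p + (67 / 100) * \<nu> + (4489 / 10000)) - (q + (67 / 100) * p + (4489 / 10000) * \<nu> + (300763 / 1000000)))"
            if "q \<le> p" "0 \<le> p" for p q :: real using 3 that by (simp add: field_simps)
          then show ?thesis using \<open>\<nu> ^ 3 \<le> \<nu>\<^sup>2\<close> by simp
        qed
        then have "0 \<le> ((67 / 100) - \<nu>) * (24 - 16 * ((67 / 100) + \<nu>) + (4 * (\<nu>\<^sup>2 + (67 / 100) * \<nu> + (4489 / 10000)) - (\<nu> ^ 3 + (67 / 100) * \<nu>\<^sup>2 + (4489 / 10000) * \<nu> + (300763 / 1000000))))"
          using 3 by (intro mult_nonneg_nonneg) auto
        then show ?thesis
          by (simp add: field_simps power2_eq_square power_numeral_reduce)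
      qed
      ultimately show ?thesis
        using \<nu> mult_nonneg_nonneg[of "1 - \<nu>" "10 - 24 * \<nu> + 16 * \<nu>\<^sup>2 - 4 * \<nu> ^ 3 + \<nu> ^ 4"] by linarith
    next
      case 4
      have "(67 / 100) ^ 2 \<le> \<nu> ^ 2" "(67 / 100) ^ 4 \<le> \<nu> ^ 4" using 4 by (auto intro!: power_mono)
      then have "2 * \<nu> * (2 + \<nu>\<^sup>2) \<ge> 4 * (1 - \<nu> ^ 4)"
        using 4 mult_mono[of "(67 / 100)" \<nu> "2 + (67 / 100)^2" "2 + \<nu>\<^sup>2"] by (simp add: power_numeral_reduce)
      then have "\<nu> * (2 * \<nu> * (2 + \<nu>\<^sup>2)) \<ge> \<nu> * (4 * (1 - \<nu> ^ 4))" using \<nu> by (intro mult_left_mono) auto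
      moreover have "5 * s * (\<nu>\<^sup>2 * (2 + \<nu>\<^sup>2)) \<ge> 2 * (\<nu>\<^sup>2 * (2 + \<nu>\<^sup>2))" using s by (intro mult_right_mono) auto
      moreover have "10 * s * (s * \<nu> - v)\<^sup>2 \<ge> 0" using s by simp
      ultimately show ?thesis by (simp add: P_def power2_eq_square algebra_simps)
    qed
  qed
  then show ?thesis by (simp add: P_def v_def)
qed

text \<open>A single centred biased sign is dominated by a standard normal variable on the cone generated by
  the functions \<open>x \<mapsto> ((x - t)\<^sub>+)\<^sup>5\<close>.\<close>
lemma two_point_pos5_le_normal:
  assumes \<mu>: "\<bar>\<mu>\<bar> \<le> 1"
  shows "(1 + \<mu>) / 2 * pos5 (s + (1 - \<mu>)) + (1 - \<mu>) / 2 * pos5 (s - (1 + \<mu>))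
    \<le> (\<integral>z. std_normal_density z * pos5 (z + s) \<partial>lborel)" (is "?L \<le> ?G")
proof -
  have G0: "0 \<le> ?G" by (intro Bochner_Integration.integral_nonneg) auto
  \<comment> \<open>Below \<open>- 2\<close> both terms vanish; up to \<open>2 / 5\<close> the bias
    is eliminated; beyond, the polynomial bound applies, with one or both terms present according to
    whether \<open>s\<close> reaches \<open>1 + \<mu>\<close>.\<close>
  consider "s < - 2" | "- 2 \<le> s" "s \<le> 2 / 5" | "s \<ge> 2 / 5" "s < 1 + \<mu>" | "s \<ge> 2 / 5" "1 + \<mu> \<le> s" by linarith
  then show ?thesis
  proof cases
    case 1
    then have "pos5 (s + (1 - \<mu>)) = 0" "pos5 (s - (1 + \<mu>)) = 0" using \<mu> by (auto simp: max_def)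
    then show ?thesis using G0 by simp
  next
    case 2
    define u where "u = max 0 (s + (1 - \<mu>))"
    have "(1 + \<mu>) / 2 * u ^ 5 = 1 / 10 * (5 * (1 + \<mu>) * u ^ 5)" by simp
    also have "5 * (1 + \<mu>) * u ^ 5 \<le> ((5 * (1 + \<mu>) + 5 * u) / 6) ^ 6"
      using \<mu> by (intro weighted_power5_le) (auto simp: u_def)
    finally have 3: "(1 + \<mu>) / 2 * u ^ 5 \<le> 1 / 10 * ((5 * (1 + \<mu>) + 5 * u) / 6) ^ 6" by simp
    have A: "(1 + \<mu>) / 2 * u ^ 5 \<le> 1 / 10 * (5 / 6 * (2 + s)) ^ 6"
    proof (cases "s + (1 - \<mu>) \<ge> 0")
      case True
      \<comment> \<open>The weighted mean is free of \<open>\<mu>\<close>; this is why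
        \<open>1 + \<mu>\<close> was multiplied by 5.\<close>
      then have e: "(5 * (1 + \<mu>) + 5 * u) / 6 = 5 / 6 * (2 + s)" by (simp add: u_def max_def field_simps)
      show ?thesis using 3 unfolding e .
    qed (simp add: u_def max_def)
    have "(1 - \<mu>) / 2 * pos5 (s - (1 + \<mu>)) \<le> 1 * (max 0 s) ^ 5"
      using \<mu> by (intro mult_mono power_mono) (auto simp: max_def)
    then have "?L \<le> 1 / 10 * (5 / 6 * (2 + s)) ^ 6 + (max 0 s) ^ 5" using A by (simp add: u_def)
    also have "\<dots> \<le> ?G" by (rule normal_pos5_ge_near) (use 2 in auto)
    finally show ?thesis .
  next
    case 3
    \<comment> \<open>Half of the only point that contributes; \<open>s < 1 + \<mu>\<close> makes it
      at most 1.\<close>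
    define w where "w = max 0 (s + (1 - \<mu>)) / 2"
    have w: "0 \<le> w" "w \<le> 1" using 3 by (auto simp: w_def)
    have "?L = (1 + \<mu>) / 2 * (2 * w) ^ 5" using 3 by (simp add: w_def max_def)
    also have "\<dots> = 16 * ((1 + \<mu>) * w ^ 5)" by (simp add: power_mult_distrib)
    also have "(1 + \<mu>) * w ^ 5 \<le> s"
    proof (cases "s + (1 - \<mu>) \<ge> 0")
      case True
      have w5: "w ^ 5 = w * w ^ 4" "w ^ 4 \<le> w ^ 3" "w ^ 3 \<le> w ^ 2" "w ^ 2 \<le> w" "w ^ 5 \<le> w ^ 4" "w \<le> 1" "0 \<le> w ^ 5"
        using w power_decreasing[of 3 4 w] power_decreasing[of 2 3 w] power_decreasing[of 1 2 w] power_decreasing[of 4 5 w]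
        by (auto simp: power_numeral_reduce)
      have "(1 - w) * (2 * w ^ 5) \<le> (1 - w) * (s * (1 + w + w ^ 2 + w ^ 3 + w ^ 4))"
      proof (intro mult_left_mono)
        have "2 * w ^ 5 = 2 / 5 * (5 * w ^ 5)" by simp
        also have "\<dots> \<le> s * (1 + w + w ^ 2 + w ^ 3 + w ^ 4)"
          using w5 3 by (intro mult_mono) auto
        finally show "2 * w ^ 5 \<le> s * (1 + w + w ^ 2 + w ^ 3 + w ^ 4)" .
      qed (use w in auto)
      also have "\<dots> = s * (1 - w ^ 5)" by (simp add: algebra_simps power_numeral_reduce)
      finally have "2 * (1 - w) * w ^ 5 \<le> s - s * w ^ 5" by (simp add: algebra_simps)
      \<comment> \<open>With this, \<open>(1 + \<mu>) * w ^ 5 \<le> s\<close> reads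
        \<open>2 * (1 - w) * w ^ 5 \<le> s * (1 - w ^ 5)\<close>, where both sides contain the
        factor \<open>1 - w\<close>.\<close>
      moreover have e: "1 + \<mu> = s + 2 * (1 - w)" using True by (simp add: w_def max_def field_simps)
      ultimately show ?thesis unfolding e by (simp add: algebra_simps)
    qed (use 3 in \<open>simp add: w_def max_def\<close>)
    also have "16 * s \<le> s ^ 5 + 10 * s ^ 3 + 15 * s"
    proof -
      have "(2 / 5)\<^sup>2 \<le> s\<^sup>2" using 3 by (intro power_mono) auto
      then have "s * 1 \<le> s * (10 * s\<^sup>2)" using 3 by (intro mult_left_mono) (auto simp: power2_eq_square)
      moreover have "s * (10 * s\<^sup>2) = 10 * s ^ 3" by (simp add: power_numeral_reduce)
      moreover have "0 \<le> s ^ 5" using 3 by simp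
      ultimately show ?thesis by linarith
    qed
    also have "\<dots> \<le> ?G" by (rule normal_pos5_ge_poly)
    finally show ?thesis by simp
  next
    case 4
    define \<nu> where "\<nu> = - \<mu>"
    define P where "P = 10 * s * (s * \<nu> - (1 - \<nu>\<^sup>2))\<^sup>2 + 5 * s * \<nu>\<^sup>2 * (2 + \<nu>\<^sup>2) - 4 * \<nu> * (1 - \<nu> ^ 4)"
    have "P \<ge> 0"
    proof (cases "\<nu> \<ge> 0")
      case True
      then show ?thesis unfolding P_def using 4 \<mu> by (intro two_point_poly_nonneg) (auto simp: \<nu>_def)
    next
      case False
      have "\<nu> ^ 4 \<le> 1" using \<mu> power_le_one[of "\<bar>\<nu>\<bar>" 4] by (simp add: \<nu>_def)
      then have "- 4 * \<nu> * (1 - \<nu> ^ 4) \<ge> 0" using False by (intro mult_nonneg_nonneg[of "- 4 * \<nu>"]) simp_all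
      moreover have "10 * s * (s * \<nu> - (1 - \<nu>\<^sup>2))\<^sup>2 \<ge> 0" "5 * s * \<nu>\<^sup>2 * (2 + \<nu>\<^sup>2) \<ge> 0" using 4 by auto
      moreover have "P = 10 * s * (s * \<nu> - (1 - \<nu>\<^sup>2))\<^sup>2 + 5 * s * \<nu>\<^sup>2 * (2 + \<nu>\<^sup>2) + (- 4 * \<nu> * (1 - \<nu> ^ 4))"
        by (simp add: P_def)
      ultimately show ?thesis by (metis add_nonneg_nonneg)
    qed
    moreover have "?L = (1 + \<mu>) / 2 * (s + (1 - \<mu>)) ^ 5 + (1 - \<mu>) / 2 * (s - (1 + \<mu>)) ^ 5"
      using 4 \<mu> by (simp add: max_def)
    moreover have "(1 + \<mu>) / 2 * (s + (1 - \<mu>)) ^ 5 + (1 - \<mu>) / 2 * (s - (1 + \<mu>)) ^ 5 = s ^ 5 + 10 * s ^ 3 + 15 * s - P"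
      unfolding P_def \<nu>_def by (simp add: power_numeral_reduce power2_eq_square field_simps)
    ultimately have "?L \<le> s ^ 5 + 10 * s ^ 3 + 15 * s" by linarith
    also have "\<dots> \<le> ?G" by (rule normal_pos5_ge_poly)
    finally show ?thesis .
  qed
qed

section \<open>From one sign to sums of signs\<close>

lemma nn_integral_std_normal_pos5:
  "ennreal (\<integral>z. std_normal_density z * pos5 (z + s) \<partial>lborel) = (\<integral>\<^sup>+z. ennreal (std_normal_density z * pos5 (z + s)) \<partial>lborel)"
  using integrable_std_normal_pos5[of "- s"] by (subst nn_integral_eq_integral) auto

text \<open>A sign is added to a sum already replaced by a normal variable: given the latter,
  \<open>two_point_pos5_le_normal\<close> replaces the new sign, and the two normal densities
  convolve. Counting from \<open>Suc m\<close> keeps the variance positive; the free shift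
  \<open>y\<close> carries the induction.\<close>

lemma sign_sum_mean_pos5_le_normal:
  assumes \<mu>: "\<bar>\<mu>\<bar> \<le> 1"
  shows "ennreal (sign_sum_mean \<mu> (Suc m) (\<lambda>x. pos5 (x + y))) \<le>
    (\<integral>\<^sup>+x. ennreal (pos5 (x + y) * normal_density 0 (sqrt (real (Suc m))) x) \<partial>lborel)"
proof (induction m arbitrary: y)
  case 0
  have "ennreal (sign_sum_mean \<mu> (Suc 0) (\<lambda>x. pos5 (x + y))) =
      ennreal ((1 + \<mu>) / 2 * pos5 (y + (1 - \<mu>)) + (1 - \<mu>) / 2 * pos5 (y - (1 + \<mu>)))"
    by (simp add: algebra_simps)
  also have "\<dots> \<le> ennreal (\<integral>z. std_normal_density z * pos5 (z + y) \<partial>lborel)"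
    by (rule ennreal_leI two_point_pos5_le_normal[OF \<mu>])+
  also have "\<dots> = (\<integral>\<^sup>+z. ennreal (std_normal_density z * pos5 (z + y)) \<partial>lborel)"
    by (rule nn_integral_std_normal_pos5)
  finally show ?case by (simp add: mult.commute)
next
  case (Suc m)
  define n where "n = normal_density 0 (sqrt (real (Suc m)))"
  define F where "F = (\<lambda>y. \<integral>\<^sup>+x. ennreal (pos5 (x + y) * n x) \<partial>lborel)"
  have [measurable]: "n \<in> borel_measurable borel" by (simp add: n_def)
  have n0: "n x \<ge> 0" for x by (simp add: n_def)
  have IH: "ennreal (sign_sum_mean \<mu> (Suc m) (\<lambda>x. pos5 (x + y))) \<le> F y" for y
    using Suc.IH unfolding F_def n_def .
  have IH': "ennreal (c * sign_sum_mean \<mu> (Suc m) (\<lambda>x. pos5 (x + y))) \<le> ennreal c * F y" if "c \<ge> 0" for c y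
  proof -
    have "0 \<le> sign_sum_mean \<mu> (Suc m) (\<lambda>x. pos5 (x + y))" by (rule sign_sum_mean_nonneg[OF \<mu>]) auto
    from ennreal_mult[OF that this] show ?thesis using IH[of y] by (simp only:) (rule mult_left_mono, auto)
  qed
  have "sign_sum_mean \<mu> (Suc (Suc m)) (\<lambda>x. pos5 (x + y)) =
      (1 + \<mu>) / 2 * sign_sum_mean \<mu> (Suc m) (\<lambda>x. pos5 (x + (y + (1 - \<mu>)))) +
      (1 - \<mu>) / 2 * sign_sum_mean \<mu> (Suc m) (\<lambda>x. pos5 (x + (y - (1 + \<mu>))))"
    unfolding sign_sum_mean.simps(2)[of \<mu> "Suc m"] by (simp only: add_ac diff_conv_add_uminus)
  then have "ennreal (sign_sum_mean \<mu> (Suc (Suc m)) (\<lambda>x. pos5 (x + y))) =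
      ennreal ((1 + \<mu>) / 2 * sign_sum_mean \<mu> (Suc m) (\<lambda>x. pos5 (x + (y + (1 - \<mu>))))) +
      ennreal ((1 - \<mu>) / 2 * sign_sum_mean \<mu> (Suc m) (\<lambda>x. pos5 (x + (y - (1 + \<mu>)))))"
    using \<mu> sign_sum_mean_nonneg[OF \<mu>]
    by (simp only:) (intro ennreal_plus mult_nonneg_nonneg sign_sum_mean_nonneg, auto)
  also have "\<dots> \<le> ennreal ((1 + \<mu>) / 2) * F (y + (1 - \<mu>)) + ennreal ((1 - \<mu>) / 2) * F (y - (1 + \<mu>))"
    using \<mu> by (intro add_mono IH') auto
  also have "\<dots> = (\<integral>\<^sup>+x. ennreal (((1 + \<mu>) / 2 * pos5 (x + y + (1 - \<mu>)) + (1 - \<mu>) / 2 * pos5 (x + y - (1 + \<mu>))) * n x) \<partial>lborel)"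
  proof -
    have "(\<integral>\<^sup>+x. ennreal (((1 + \<mu>) / 2 * pos5 (x + y + (1 - \<mu>)) + (1 - \<mu>) / 2 * pos5 (x + y - (1 + \<mu>))) * n x) \<partial>lborel) =
       (\<integral>\<^sup>+x. ennreal ((1 + \<mu>) / 2) * ennreal (pos5 (x + (y + (1 - \<mu>))) * n x) +
         ennreal ((1 - \<mu>) / 2) * ennreal (pos5 (x + (y - (1 + \<mu>))) * n x) \<partial>lborel)"
    proof (rule nn_integral_cong)
      fix x :: real
      have "((1 + \<mu>) / 2 * pos5 (x + y + (1 - \<mu>)) + (1 - \<mu>) / 2 * pos5 (x + y - (1 + \<mu>))) * n x =
          (1 + \<mu>) / 2 * (pos5 (x + (y + (1 - \<mu>))) * n x) + (1 - \<mu>) / 2 * (pos5 (x + (y - (1 + \<mu>))) * n x)"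
        by (simp only: distrib_right mult.assoc add.assoc diff_conv_add_uminus)
      moreover have "0 \<le> (1 + \<mu>) / 2" "0 \<le> (1 - \<mu>) / 2" using \<mu> by auto
      ultimately show "ennreal (((1 + \<mu>) / 2 * pos5 (x + y + (1 - \<mu>)) + (1 - \<mu>) / 2 * pos5 (x + y - (1 + \<mu>))) * n x) =
          ennreal ((1 + \<mu>) / 2) * ennreal (pos5 (x + (y + (1 - \<mu>))) * n x) +
          ennreal ((1 - \<mu>) / 2) * ennreal (pos5 (x + (y - (1 + \<mu>))) * n x)"
        using n0 by (simp only: ennreal_mult'[symmetric]) (intro ennreal_plus mult_nonneg_nonneg, auto)
    qed
    then show ?thesis
      by (simp add: F_def nn_integral_add nn_integral_cmult)
  qed
  also have "\<dots> \<le> (\<integral>\<^sup>+x. (\<integral>\<^sup>+z. ennreal (std_normal_density z * pos5 (z + (x + y))) * ennreal (n x) \<partial>lborel) \<partial>lborel)"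
  proof (intro nn_integral_mono)
    fix x :: real
    have "ennreal (((1 + \<mu>) / 2 * pos5 (x + y + (1 - \<mu>)) + (1 - \<mu>) / 2 * pos5 (x + y - (1 + \<mu>))) * n x)
      \<le> ennreal ((\<integral>z. std_normal_density z * pos5 (z + (x + y)) \<partial>lborel) * n x)"
      using n0 two_point_pos5_le_normal[OF \<mu>, of "x + y"] by (intro ennreal_leI mult_right_mono) auto
    also have "\<dots> = ennreal (\<integral>z. std_normal_density z * pos5 (z + (x + y)) \<partial>lborel) * ennreal (n x)"
      using n0 by (simp add: ennreal_mult')
    also have "ennreal (\<integral>z. std_normal_density z * pos5 (z + (x + y)) \<partial>lborel) =
        (\<integral>\<^sup>+z. ennreal (std_normal_density z * pos5 (z + (x + y))) \<partial>lborel)"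
      by (rule nn_integral_std_normal_pos5)
    finally show "ennreal (((1 + \<mu>) / 2 * pos5 (x + y + (1 - \<mu>)) + (1 - \<mu>) / 2 * pos5 (x + y - (1 + \<mu>))) * n x)
      \<le> (\<integral>\<^sup>+z. ennreal (std_normal_density z * pos5 (z + (x + y))) * ennreal (n x) \<partial>lborel)"
      by (subst nn_integral_multc) auto
  qed
  also have "\<dots> = (\<integral>\<^sup>+x. (\<integral>\<^sup>+w. ennreal (pos5 (w + y)) * ennreal (std_normal_density (w - x) * n x) \<partial>lborel) \<partial>lborel)"
  proof (rule nn_integral_cong)
    fix x :: real
    show "(\<integral>\<^sup>+z. ennreal (std_normal_density z * pos5 (z + (x + y))) * ennreal (n x) \<partial>lborel) =
        (\<integral>\<^sup>+w. ennreal (pos5 (w + y)) * ennreal (std_normal_density (w - x) * n x) \<partial>lborel)"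
      using n0 by (subst nn_integral_real_affine[where c = 1 and t = "- x"])
        (auto intro!: nn_integral_cong simp: algebra_simps simp flip: ennreal_mult)
  qed
  also have "\<dots> = (\<integral>\<^sup>+w. (\<integral>\<^sup>+x. ennreal (pos5 (w + y)) * ennreal (std_normal_density (w - x) * n x) \<partial>lborel) \<partial>lborel)"
    by (rule lborel_pair.Fubini') measurable
  also have "\<dots> = (\<integral>\<^sup>+w. ennreal (pos5 (w + y)) * ennreal (normal_density 0 (sqrt (real (Suc (Suc m)))) w) \<partial>lborel)"
  proof (rule nn_integral_cong)
    fix w :: real
    have "(\<lambda>x. \<integral>\<^sup>+y. ennreal (normal_density 0 1 (x - y) * n y) \<partial>lborel) =
       normal_density 0 (sqrt (1\<^sup>2 + (sqrt (real (Suc m)))\<^sup>2))"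
      unfolding n_def by (rule conv_normal_density_zero_mean) auto
    moreover have "1\<^sup>2 + (sqrt (real (Suc m)))\<^sup>2 = real (Suc (Suc m))" by simp
    ultimately have "(\<integral>\<^sup>+x. ennreal (std_normal_density (w - x) * n x) \<partial>lborel) =
       ennreal (normal_density 0 (sqrt (real (Suc (Suc m)))) w)" by (metis (no_types, lifting))
    then show "(\<integral>\<^sup>+x. ennreal (pos5 (w + y)) * ennreal (std_normal_density (w - x) * n x) \<partial>lborel) =
       ennreal (pos5 (w + y)) * ennreal (normal_density 0 (sqrt (real (Suc (Suc m)))) w)"
      by (subst nn_integral_cmult) auto
  qed
  finally show ?case by (simp add: ennreal_mult)
qed

text \<open>The kernel is a scaled and shifted \<open>pos5\<close> plus its reflection. Reflection
  negates the bias and leaves the normal density unchanged, and the bound for \<open>pos5\<close>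
  holds for every bias.\<close>

lemma sign_sum_mean_pos5_kernel_le:
  assumes \<mu>: "\<bar>\<mu>\<bar> \<le> 1" and m: "m \<ge> 1" and t: "t > 0"
  shows "ennreal (sign_sum_mean \<mu> m (\<lambda>x. pos5 (\<bar>t * x\<bar> - 1))) \<le>
    (\<integral>\<^sup>+z. ennreal (pos5 (\<bar>t * (sqrt m * z)\<bar> - 1) * std_normal_density z) \<partial>lborel)"
proof -
  define n where "n = normal_density 0 (sqrt (real m))"
  have [measurable]: "n \<in> borel_measurable borel" by (simp add: n_def)
  have n0: "n x \<ge> 0" "n (- x) = n x" for x by (simp_all add: n_def normal_density_def)
  define p where "p = (\<lambda>x. t ^ 5 * pos5 (x + (- 1 / t)))"
  have p: "pos5 (\<bar>t * x\<bar> - 1) = p x + p (- x)" for x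
  proof -
    have "max 0 (t * y - 1) = t * max 0 (y + (- 1 / t))" for y
      using t by (simp add: max_def field_simps)
    then have "p y = pos5 (t * y - 1)" for y by (simp add: p_def power_mult_distrib)
    moreover have "pos5 (\<bar>t * x\<bar> - 1) = pos5 (t * x - 1) + pos5 (t * (- x) - 1)"
      by (auto simp: max_def abs_if)
    ultimately show ?thesis by simp
  qed
  have p0: "p x \<ge> 0" for x using t by (simp add: p_def)
  have [measurable]: "p \<in> borel_measurable borel" by (simp add: p_def)
  have le: "ennreal (sign_sum_mean \<nu> m p) \<le> (\<integral>\<^sup>+x. ennreal (p x * n x) \<partial>lborel)" if "\<bar>\<nu>\<bar> \<le> 1" for \<nu>
  proof -
    have "ennreal (sign_sum_mean \<nu> m p) = ennreal (t ^ 5) * ennreal (sign_sum_mean \<nu> m (\<lambda>x. pos5 (x + (- 1 / t))))"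
      unfolding p_def sign_sum_mean_cmult using t by (simp add: ennreal_mult')
    also have "\<dots> \<le> ennreal (t ^ 5) * (\<integral>\<^sup>+x. ennreal (pos5 (x + (- 1 / t)) * n x) \<partial>lborel)"
      using sign_sum_mean_pos5_le_normal[OF that, of "m - 1" "- 1 / t"] m
      by (intro mult_left_mono) (auto simp: n_def)
    also have "\<dots> = (\<integral>\<^sup>+x. ennreal (p x * n x) \<partial>lborel)"
      using t by (subst nn_integral_cmult[symmetric])
        (auto intro!: nn_integral_cong simp: p_def ennreal_mult' mult.assoc)
    finally show ?thesis .
  qed
  have neg: "(\<integral>\<^sup>+x. ennreal (p (- x) * n x) \<partial>lborel) = (\<integral>\<^sup>+x. ennreal (p x * n x) \<partial>lborel)"
    by (subst nn_integral_real_affine[where c = "-1" and t = 0]) (auto simp: n0)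
  have "ennreal (sign_sum_mean \<mu> m (\<lambda>x. pos5 (\<bar>t * x\<bar> - 1))) = ennreal (sign_sum_mean \<mu> m p) + ennreal (sign_sum_mean (- \<mu>) m p)"
    unfolding p sign_sum_mean_add sign_sum_mean_minus using \<mu> p0
    by (intro ennreal_plus sign_sum_mean_nonneg) auto
  also have "\<dots> \<le> (\<integral>\<^sup>+x. ennreal (p x * n x) \<partial>lborel) + (\<integral>\<^sup>+x. ennreal (p (- x) * n x) \<partial>lborel)"
    unfolding neg using \<mu> by (intro add_mono le) auto
  also have "\<dots> = (\<integral>\<^sup>+x. ennreal (pos5 (\<bar>t * x\<bar> - 1) * n x) \<partial>lborel)"
    using p0 n0 by (subst nn_integral_add[symmetric]) (auto intro!: nn_integral_cong simp: p distrib_right simp flip: ennreal_plus)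
  also have "\<dots> = (\<integral>\<^sup>+z. ennreal (pos5 (\<bar>t * (sqrt m * z)\<bar> - 1) * std_normal_density z) \<partial>lborel)"
    unfolding n_def using m by (intro nn_integral_normal_density_scale) auto
  finally show ?thesis .
qed

lemma sign_sum_moment_le_gt5:
  assumes \<mu>: "\<bar>\<mu>\<bar> \<le> 1" and m: "m \<ge> 1" and r: "r > 5"
  shows "sign_sum_mean \<mu> m (\<lambda>x. \<bar>x\<bar> powr r) \<le> real m powr (r / 2) * normal_abs_moment r"
proof -
  define k where "k = (\<lambda>x::real. pos5 (\<bar>x\<bar> - 1))"
  have [measurable]: "k \<in> borel_measurable borel" by (simp add: k_def)
  obtain K where K: "K > 0" "(\<integral>\<^sup>+t\<in>{0<..}. ennreal (k t * t powr (- r - 1)) \<partial>lborel) = ennreal K"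
  \<comment> \<open>The kernel vanishes on \<open>{0..1}\<close>, so any exponent above
    \<open>r\<close> serves at 0.\<close>
  proof (rule kernel_integral_finite[of k 1 "r + 1" r 5])
    show "k x \<le> 1 * x powr 5" if "1 \<le> x" for x
    proof -
      have "k x \<le> x ^ 5" unfolding k_def using that by (intro power_mono) auto
      then show ?thesis using that by simp
    qed
  qed (use r in \<open>auto simp: k_def max_def\<close>)
  show ?thesis
  proof (rule sign_sum_moment_le_via_kernel[OF _ _ _ _ \<mu> K(1) _ K(2)])
    show "(\<integral>\<^sup>+t\<in>{0<..}. ennreal (sign_sum_mean \<mu> m (\<lambda>x. k (t * x)) * t powr (- r - 1)) \<partial>lborel) \<le>
      (\<integral>\<^sup>+t\<in>{0<..}. (\<integral>\<^sup>+z. ennreal (k (t * (sqrt m * z)) * std_normal_density z) \<partial>lborel) * ennreal (t powr (- r - 1)) \<partial>lborel)"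
    proof (intro nn_integral_mono)
      fix t :: real
      show "ennreal (sign_sum_mean \<mu> m (\<lambda>x. k (t * x)) * t powr (- r - 1)) * indicator {0<..} t \<le>
        (\<integral>\<^sup>+z. ennreal (k (t * (sqrt m * z)) * std_normal_density z) \<partial>lborel) * ennreal (t powr (- r - 1)) * indicator {0<..} t"
      proof (cases "t > 0")
        case True
        have "ennreal (sign_sum_mean \<mu> m (\<lambda>x. k (t * x)) * t powr (- r - 1)) =
            ennreal (sign_sum_mean \<mu> m (\<lambda>x. k (t * x))) * ennreal (t powr (- r - 1))"
          by (rule ennreal_mult'') simp
        then show ?thesis
          using sign_sum_mean_pos5_kernel_le[OF \<mu> m True] unfolding k_def
          by (simp only:) (intro mult_right_mono, auto)
      qed simp
    qed
  qed (use r in \<open>auto simp: k_def\<close>)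
qed

text \<open>Khintchine's inequality with the sharp constant of the symmetric case, for centred signs
  of any bias.\<close>

theorem sign_sum_moment_le_normal:
  assumes \<mu>: "\<bar>\<mu>\<bar> \<le> 1" and m: "m \<ge> 1" and r: "r > 2"
  shows "sign_sum_mean \<mu> m (\<lambda>x. \<bar>x\<bar> powr r) \<le> real m powr (r / 2) * normal_abs_moment r"
proof -
  consider "m = 1" "r \<le> 5" | "m \<ge> 2" "r < 4" | "m \<ge> 2" "r = 4" | "m \<ge> 2" "4 < r" "r \<le> 5" | "r > 5"
    using m by linarith
  then show ?thesis
  proof cases
    case 1
    then show ?thesis using single_sign_moment_le_normal[OF \<mu> r] by simp
  next
    case 2
    then show ?thesis using sign_sum_moment_le_2_4[OF \<mu> _ r] by blast
  next
    case 3
    then show ?thesis using sign_sum_moment_le_4[OF \<mu> m] by simp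
  next
    case 4
    then show ?thesis using sign_sum_moment_le_4_5[OF \<mu>] by simp
  next
    case 5
    then show ?thesis using sign_sum_moment_le_gt5[OF \<mu> m] by simp
  qed
qed

section \<open>Norms of order r and reduction to signs\<close>

lemma is_fourier_transform_of_cos:
  fixes \<psi> :: "'a::euclidean_space \<Rightarrow> real"
  assumes prob: "prob_space \<Lambda>" and borel[measurable_cong]: "sets \<Lambda> = sets borel"
    and bochner: "is_fourier_transform_of \<psi> \<Lambda>"
  shows "(\<integral>\<omega>. cos (\<omega> \<bullet> z) \<partial>\<Lambda>) = \<psi> z"
proof -
  interpret prob_space \<Lambda> by (rule prob)
  have i: "integrable \<Lambda> (\<lambda>\<omega>. exp (\<i> * complex_of_real (\<omega> \<bullet> z)))"
    by (rule integrable_const_bound[where B = 1]) (auto simp: norm_exp_i_times)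
  have "\<psi> z = Re (\<integral>\<omega>. exp (\<i> * complex_of_real (\<omega> \<bullet> z)) \<partial>\<Lambda>)"
    using bochner unfolding is_fourier_transform_of_def by (metis Re_complex_of_real)
  also have "\<dots> = (\<integral>\<omega>. Re (exp (\<i> * complex_of_real (\<omega> \<bullet> z))) \<partial>\<Lambda>)"
    by (rule integral_Re[OF i, symmetric])
  also have "\<dots> = (\<integral>\<omega>. cos (\<omega> \<bullet> z) \<partial>\<Lambda>)" by (simp add: Re_exp)
  finally show ?thesis ..
qed

lemma (in prob_space) abs_expectation_le_1:
  fixes Y :: "'a \<Rightarrow> real"
  assumes i: "integrable M Y" and Y1: "\<And>x. \<bar>Y x\<bar> \<le> 1"
  shows "\<bar>expectation Y\<bar> \<le> 1"
proof -
  have "\<bar>expectation Y\<bar> \<le> expectation (\<lambda>x. \<bar>Y x\<bar>)" by (rule integral_abs_bound)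
  also have "\<dots> \<le> expectation (\<lambda>x. 1)" using i Y1 by (intro integral_mono) auto
  finally show ?thesis by (simp add: prob_space)
qed

text \<open>The concave function \<open>x powr \<theta>\<close> lies below its tangent at \<open>A\<close>.\<close>
lemma (in prob_space) expectation_powr_le:
  fixes X :: "'a \<Rightarrow> real"
  assumes X: "integrable M X" "\<And>x. x \<in> space M \<Longrightarrow> 0 \<le> X x" and A: "expectation X \<le> A" "0 < A"
    and \<theta>: "0 \<le> \<theta>" "\<theta> \<le> 1"
  shows "expectation (\<lambda>x. X x powr \<theta>) \<le> A powr \<theta>"
proof -
  have tangent: "y powr \<theta> \<le> A powr \<theta> * (1 + \<theta> * (y / A - 1))" if "0 \<le> y" for y :: real
  proof (cases "y = 0")
    case False
    have "(y / A) powr \<theta> \<le> 1 + \<theta> * (y / A - 1)"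
      using Youngs_inequality_0[of \<theta> "1 - \<theta>" "y / A" 1] A \<theta> that False by (simp add: algebra_simps)
    moreover have "y powr \<theta> = A powr \<theta> * (y / A) powr \<theta>" using A that by (simp flip: powr_mult)
    ultimately show ?thesis by (simp add: mult_left_mono)
  qed (use \<theta> in auto)
  have "expectation (\<lambda>x. X x powr \<theta>) \<le> expectation (\<lambda>x. A powr \<theta> * (1 + \<theta> * (X x / A - 1)))"
  proof (rule integral_mono)
    have m[measurable]: "X \<in> borel_measurable M" using X by auto
    show "integrable M (\<lambda>x. A powr \<theta> * (1 + \<theta> * (X x / A - 1)))" using X by auto
    then show "integrable M (\<lambda>x. X x powr \<theta>)"
      by (rule Bochner_Integration.integrable_bound) (use tangent X in \<open>auto intro!: AE_I2 order_trans[OF tangent abs_ge_self]\<close>)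
  qed (use tangent X in auto)
  also have "\<dots> = A powr \<theta> * (1 + \<theta> * (expectation X / A - 1))"
    using X by (simp add: prob_space)
  also have "\<dots> \<le> A powr \<theta> * 1"
    using A \<theta> by (intro mult_left_mono) (auto simp: mult_nonneg_nonpos)
  finally show ?thesis by simp
qed

text \<open>Minkowski's inequality against a constant, by convexity of \<open>x powr r\<close> with
  weights proportional to the two norms. It carries a uniform change of the error function over to
  its norm.\<close>

lemma (in finite_measure) powr_norm_le_add_const:
  fixes f g :: "'a \<Rightarrow> real"
  assumes r: "r \<ge> 1" and c: "c > 0" and pos: "measure M (space M) > 0"
    and f: "integrable M (\<lambda>x. \<bar>f x\<bar> powr r)" and g: "integrable M (\<lambda>x. \<bar>g x\<bar> powr r)"
    and fg: "\<And>x. x \<in> space M \<Longrightarrow> \<bar>f x - g x\<bar> \<le> c"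
  shows "(\<integral>x. \<bar>f x\<bar> powr r \<partial>M) powr (1 / r) \<le>
    (\<integral>x. \<bar>g x\<bar> powr r \<partial>M) powr (1 / r) + c * measure M (space M) powr (1 / r)"
proof -
  define \<nu> where "\<nu> = measure M (space M)"
  define b where "b = c * \<nu> powr (1 / r)"
  define a0 where "a0 = (\<integral>x. \<bar>g x\<bar> powr r \<partial>M) powr (1 / r)"
  have b: "b > 0" using c pos by (simp add: b_def \<nu>_def)
  have a0: "a0 \<ge> 0" by (simp add: a0_def)
  have g_int: "0 \<le> (\<integral>x. \<bar>g x\<bar> powr r \<partial>M)" "0 \<le> (\<integral>x. \<bar>f x\<bar> powr r \<partial>M)" by simp_all
  \<comment> \<open>The slack \<open>e\<close> keeps the weight of \<open>g\<close> positive when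
    its norm is 0.\<close>
  have "(\<integral>x. \<bar>f x\<bar> powr r \<partial>M) powr (1 / r) \<le> a0 + b + e" if e: "e > 0" for e
  proof -
    define a where "a = a0 + e"
    have a: "a > 0" using a0 e by (simp add: a_def)
    define t where "t = b / (a + b)"
    have t: "0 \<le> t" "t \<le> 1" using a b by (auto simp: t_def)
    have ta: "1 - t = a / (a + b)" using a b by (simp add: t_def field_simps)
    have pt: "\<bar>f x\<bar> powr r \<le> (a + b) powr r * ((1 - t) * (\<bar>g x\<bar> powr r / a powr r) + t * (c / b) powr r)"
      if "x \<in> space M" for x
    proof -
      have "\<bar>f x\<bar> \<le> (a + b) * ((1 - t) * (\<bar>g x\<bar> / a) + t * (c / b))"
      proof -
        have "(a + b) * ((1 - t) * (\<bar>g x\<bar> / a) + t * (c / b)) = \<bar>g x\<bar> + c"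
          unfolding ta unfolding t_def using a b by (simp add: distrib_left)
        then show ?thesis using fg[OF that] by linarith
      qed
      then have "\<bar>f x\<bar> powr r \<le> ((a + b) * ((1 - t) * (\<bar>g x\<bar> / a) + t * (c / b))) powr r"
        using r by (intro powr_mono2) auto
      also have "\<dots> = (a + b) powr r * ((1 - t) * (\<bar>g x\<bar> / a) + t * (c / b)) powr r"
        by (rule powr_mult)
      also have "\<dots> \<le> (a + b) powr r * ((1 - t) * (\<bar>g x\<bar> / a) powr r + t * (c / b) powr r)"
        using convex_onD[OF convex_on_powr_nonneg[OF r] t, of "\<bar>g x\<bar> / a" "c / b"] a b c
        by (intro mult_left_mono) auto
      finally show ?thesis using a by (simp add: powr_divide)
    qed
    have "(\<integral>x. \<bar>f x\<bar> powr r \<partial>M) \<le> (\<integral>x. (a + b) powr r * ((1 - t) * (\<bar>g x\<bar> powr r / a powr r) + t * (c / b) powr r) \<partial>M)"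
      using f g pt by (intro integral_mono) auto
    also have "\<dots> = (a + b) powr r * ((1 - t) * ((\<integral>x. \<bar>g x\<bar> powr r \<partial>M) / a powr r) + t * ((c / b) powr r * \<nu>))"
      using g by (simp add: \<nu>_def)
    also have "\<dots> \<le> (a + b) powr r * ((1 - t) * 1 + t * 1)"
    proof -
      have "(\<integral>x. \<bar>g x\<bar> powr r \<partial>M) = a0 powr r" using r g_int by (simp add: a0_def powr_powr)
      also have "\<dots> \<le> a powr r" using a0 e r by (intro powr_mono2) (auto simp: a_def)
      finally have 1: "(\<integral>x. \<bar>g x\<bar> powr r \<partial>M) / a powr r \<le> 1" using a by simp
      have "(c / b) powr r * \<nu> = 1"
      proof -
        have "c / b = \<nu> powr (- (1 / r))" using c pos by (simp add: b_def \<nu>_def powr_minus field_simps)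
        then have "(c / b) powr r = \<nu> powr (- 1)" using r by (simp add: powr_powr)
        then show ?thesis using pos by (simp add: \<nu>_def powr_minus)
      qed
      then show ?thesis using 1 t by (intro mult_left_mono add_mono) auto
    qed
    finally have "(\<integral>x. \<bar>f x\<bar> powr r \<partial>M) powr (1 / r) \<le> ((a + b) powr r) powr (1 / r)"
      using r g_int by (intro powr_mono2) auto
    also have "\<dots> = a + b" using a b r by (simp add: powr_powr)
    finally show ?thesis by (simp add: a_def)
  qed
  then show ?thesis unfolding a0_def b_def \<nu>_def by (rule field_le_epsilon)
qed

lemma convex_on_abs_powr:
  assumes "r \<ge> 1"
  shows "convex_on UNIV (\<lambda>x::real. \<bar>x\<bar> powr r)"
proof (rule convex_onI)
  fix t x y :: real assume t: "0 < t" "t < 1"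
  have "\<bar>(1 - t) *\<^sub>R x + t *\<^sub>R y\<bar> \<le> (1 - t) * \<bar>x\<bar> + t * \<bar>y\<bar>"
    using t abs_triangle_ineq[of "(1 - t) * x" "t * y"] by (simp add: abs_mult)
  then have "\<bar>(1 - t) *\<^sub>R x + t *\<^sub>R y\<bar> powr r \<le> ((1 - t) * \<bar>x\<bar> + t * \<bar>y\<bar>) powr r"
    using assms by (intro powr_mono2) auto
  also have "\<dots> \<le> (1 - t) * \<bar>x\<bar> powr r + t * \<bar>y\<bar> powr r"
    using convex_onD[OF convex_on_powr_nonneg[OF assms], of t "\<bar>x\<bar>" "\<bar>y\<bar>"] t by simp
  finally show "\<bar>(1 - t) *\<^sub>R x + t *\<^sub>R y\<bar> powr r \<le> (1 - t) * \<bar>x\<bar> powr r + t * \<bar>y\<bar> powr r" .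
qed simp

text \<open>Among variables with values in \<open>[-1, 1]\<close> and a given mean, the two-point distribution on
  \<open>{-1, 1}\<close> maximizes every convex functional.\<close>
lemma integral_centered_sum_le_sign_sum_mean:
  fixes f :: "real \<Rightarrow> real" and Y :: "'a \<Rightarrow> real"
  assumes prob: "prob_space \<Lambda>" and Y[measurable]: "Y \<in> borel_measurable \<Lambda>"
    and Y1: "\<And>x. \<bar>Y x\<bar> \<le> 1" and \<mu>: "(\<integral>x. Y x \<partial>\<Lambda>) = \<mu>"
    and f: "convex_on UNIV f" "continuous_on UNIV f" "\<And>x. 0 \<le> f x" and I: "finite I"
  shows "integrable (\<Pi>\<^sub>M i\<in>I. \<Lambda>) (\<lambda>w. f (c + (\<Sum>i\<in>I. Y (w i) - \<mu>))) \<and>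
    (\<integral>w. f (c + (\<Sum>i\<in>I. Y (w i) - \<mu>)) \<partial>(\<Pi>\<^sub>M i\<in>I. \<Lambda>)) \<le> sign_sum_mean \<mu> (card I) (\<lambda>x. f (c + x))"
proof -
  interpret L: prob_space \<Lambda> by (rule prob)
  interpret product_sigma_finite "\<lambda>_. \<Lambda>" ..
  have [measurable]: "f \<in> borel_measurable borel" by (rule borel_measurable_continuous_onI[OF f(2)])
  have Yi: "integrable \<Lambda> Y" by (rule L.integrable_const_bound[where B = 1]) (use Y1 in auto)
  have \<mu>1: "\<bar>\<mu>\<bar> \<le> 1" unfolding \<mu>[symmetric] by (rule L.abs_expectation_le_1[OF Yi Y1])
  have bounded: "\<exists>B. \<forall>x. \<bar>x\<bar> \<le> R \<longrightarrow> \<bar>f x\<bar> \<le> B" for R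
  proof -
    have "compact (f ` cball 0 R)" by (intro compact_continuous_image continuous_on_subset[OF f(2)]) auto
    then have "bounded (f ` cball 0 R)" by (rule compact_imp_bounded)
    then show ?thesis by (force simp: bounded_iff)
  qed
  have sum_bound: "\<bar>c + (\<Sum>i\<in>J. Y (w i) - \<mu>)\<bar> \<le> \<bar>c\<bar> + 2 * real (card J)" for c w and J :: "'b set"
  proof -
    have "\<bar>Y y - \<mu>\<bar> \<le> 2" for y using Y1[of y] \<mu>1 by linarith
    then have "\<bar>\<Sum>i\<in>J. Y (w i) - \<mu>\<bar> \<le> (\<Sum>i\<in>J. 2)"
      by (intro order_trans[OF sum_abs] sum_mono)
    then show ?thesis by simp
  qed
  have int: "integrable (\<Pi>\<^sub>M i\<in>J. \<Lambda>) (\<lambda>w. f (c + (\<Sum>i\<in>J. Y (w i) - \<mu>)))" for c and J :: "'b set"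
  proof -
    interpret J: prob_space "\<Pi>\<^sub>M i\<in>J. \<Lambda>" by (intro prob_space_PiM prob)
    obtain B where "\<And>x. \<bar>x\<bar> \<le> \<bar>c\<bar> + 2 * real (card J) \<Longrightarrow> \<bar>f x\<bar> \<le> B" using bounded by blast
    then show ?thesis using sum_bound
      by (intro J.integrable_const_bound[where B = B]) auto
  qed
  \<comment> \<open>The chord of \<open>f\<close> over the two extreme values is affine in
    \<open>Y y\<close>, so its mean depends only on \<open>\<mu>\<close>. The shift \<open>c\<close>
    stands for the other summands.\<close>
  have step: "(\<integral>y. f (c + (Y y - \<mu>)) \<partial>\<Lambda>) \<le> (1 + \<mu>) / 2 * f (c + (1 - \<mu>)) + (1 - \<mu>) / 2 * f (c - (1 + \<mu>))" for c
  proof -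
    have i: "integrable \<Lambda> (\<lambda>y. f (c + (Y y - \<mu>)))"
    proof -
      obtain B where B: "\<And>x. \<bar>x\<bar> \<le> \<bar>c\<bar> + 2 \<Longrightarrow> \<bar>f x\<bar> \<le> B" using bounded by blast
      have "\<bar>f (c + (Y y - \<mu>))\<bar> \<le> B" for y using Y1[of y] \<mu>1 by (intro B) linarith
      then show ?thesis by (intro L.integrable_const_bound[where B = B]) auto
    qed
    have "(\<integral>y. f (c + (Y y - \<mu>)) \<partial>\<Lambda>) \<le> (\<integral>y. (1 + Y y) / 2 * f (c + (1 - \<mu>)) + (1 - Y y) / 2 * f (c - (1 + \<mu>)) \<partial>\<Lambda>)"
    proof (rule integral_mono[OF i])
      fix y
      define t where "t = (1 + Y y) / 2"
      have t: "0 \<le> t" "t \<le> 1" using Y1[of y] by (auto simp: t_def)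
      have "c + (Y y - \<mu>) = (1 - t) *\<^sub>R (c - (1 + \<mu>)) + t *\<^sub>R (c + (1 - \<mu>))"
        by (simp add: t_def field_simps)
      then have "f (c + (Y y - \<mu>)) \<le> (1 - t) * f (c - (1 + \<mu>)) + t * f (c + (1 - \<mu>))"
        using convex_onD[OF f(1) t, of "c - (1 + \<mu>)" "c + (1 - \<mu>)"] by simp
      also have "\<dots> = (1 + Y y) / 2 * f (c + (1 - \<mu>)) + (1 - Y y) / 2 * f (c - (1 + \<mu>))"
      proof -
        have "1 - t = (1 - Y y) / 2" by (simp add: t_def field_simps)
        then show ?thesis by (simp only: t_def add.commute)
      qed
      finally show "f (c + (Y y - \<mu>)) \<le> (1 + Y y) / 2 * f (c + (1 - \<mu>)) + (1 - Y y) / 2 * f (c - (1 + \<mu>))" .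
    qed (use Yi in auto)
    also have "\<dots> = (1 + \<mu>) / 2 * f (c + (1 - \<mu>)) + (1 - \<mu>) / 2 * f (c - (1 + \<mu>))"
      using Yi by (simp add: L.prob_space \<mu>)
    finally show ?thesis .
  qed
  have "(\<integral>w. f (c + (\<Sum>i\<in>I. Y (w i) - \<mu>)) \<partial>(\<Pi>\<^sub>M i\<in>I. \<Lambda>)) \<le> sign_sum_mean \<mu> (card I) (\<lambda>x. f (c + x))"
    using I
  proof (induction I arbitrary: c rule: finite_induct)
    case empty
    show ?case by (simp add: PiM_empty lebesgue_integral_count_space_finite)
  next
    case (insert i J)
    define s where "s w = (\<Sum>j\<in>J. Y (w j) - \<mu>)" for w
    have upd: "(\<Sum>j\<in>insert i J. Y ((w(i := y)) j) - \<mu>) = (Y y - \<mu>) + s w" for w y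
    proof -
      have "(\<Sum>j\<in>J. Y ((w(i := y)) j) - \<mu>) = s w"
        unfolding s_def using insert.hyps by (intro sum.cong) auto
      then show ?thesis using insert.hyps by simp
    qed
    have "(\<integral>w. f (c + (\<Sum>j\<in>insert i J. Y (w j) - \<mu>)) \<partial>(\<Pi>\<^sub>M i\<in>insert i J. \<Lambda>)) =
        (\<integral>w. (\<integral>y. f (c + (\<Sum>j\<in>insert i J. Y ((w(i := y)) j) - \<mu>)) \<partial>\<Lambda>) \<partial>(\<Pi>\<^sub>M i\<in>J. \<Lambda>))"
      using insert.hyps by (intro product_integral_insert int)
    also have "\<dots> = (\<integral>w. (\<integral>y. f ((c + s w) + (Y y - \<mu>)) \<partial>\<Lambda>) \<partial>(\<Pi>\<^sub>M i\<in>J. \<Lambda>))"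
      unfolding upd by (simp add: algebra_simps)
    also have "\<dots> \<le> (\<integral>w. (1 + \<mu>) / 2 * f ((c + (1 - \<mu>)) + s w) + (1 - \<mu>) / 2 * f ((c - (1 + \<mu>)) + s w) \<partial>(\<Pi>\<^sub>M i\<in>J. \<Lambda>))"
    proof (rule integral_mono')
      show "integrable (\<Pi>\<^sub>M i\<in>J. \<Lambda>) (\<lambda>w. (1 + \<mu>) / 2 * f ((c + (1 - \<mu>)) + s w) + (1 - \<mu>) / 2 * f ((c - (1 + \<mu>)) + s w))"
        unfolding s_def using int by (intro Bochner_Integration.integrable_add integrable_mult_right) auto
      fix w
      have e: "c + s w + (1 - \<mu>) = c + (1 - \<mu>) + s w" "c + s w - (1 + \<mu>) = c - (1 + \<mu>) + s w" by auto
      show "(\<integral>y. f ((c + s w) + (Y y - \<mu>)) \<partial>\<Lambda>) \<le> (1 + \<mu>) / 2 * f ((c + (1 - \<mu>)) + s w) + (1 - \<mu>) / 2 * f ((c - (1 + \<mu>)) + s w)"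
        using step[of "c + s w"] unfolding e .
      show "0 \<le> (1 + \<mu>) / 2 * f ((c + (1 - \<mu>)) + s w) + (1 - \<mu>) / 2 * f ((c - (1 + \<mu>)) + s w)"
        using f(3) \<mu>1 by (intro add_nonneg_nonneg mult_nonneg_nonneg) auto
    qed
    also have "\<dots> = (1 + \<mu>) / 2 * (\<integral>w. f ((c + (1 - \<mu>)) + s w) \<partial>(\<Pi>\<^sub>M i\<in>J. \<Lambda>)) + (1 - \<mu>) / 2 * (\<integral>w. f ((c - (1 + \<mu>)) + s w) \<partial>(\<Pi>\<^sub>M i\<in>J. \<Lambda>))"
      unfolding s_def using int by simp
    also have "\<dots> \<le> (1 + \<mu>) / 2 * sign_sum_mean \<mu> (card J) (\<lambda>x. f ((c + (1 - \<mu>)) + x)) + (1 - \<mu>) / 2 * sign_sum_mean \<mu> (card J) (\<lambda>x. f ((c - (1 + \<mu>)) + x))"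
      unfolding s_def using \<mu>1 by (intro add_mono mult_left_mono insert.IH) auto
    also have "\<dots> = sign_sum_mean \<mu> (card (insert i J)) (\<lambda>x. f (c + x))"
      using insert.hyps by (simp add: algebra_simps)
    finally show ?case .
  qed
  then show ?thesis using int by blast
qed

section \<open>Random Fourier features\<close>

lemma khintchine_const_powr:
  assumes "r > 2"
  shows "khintchine_const r powr r = normal_abs_moment r"
proof -
  have G: "Gamma ((r + 1) / 2) > 0" using assms by (intro Gamma_real_pos) simp
  have "khintchine_const r powr r = sqrt 2 powr r * ((Gamma ((r + 1) / 2) / sqrt pi) powr (1 / r)) powr r"
    using assms by (simp add: khintchine_const_def powr_mult)
  also have "((Gamma ((r + 1) / 2) / sqrt pi) powr (1 / r)) powr r = Gamma ((r + 1) / 2) / sqrt pi"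
    using assms G by (simp add: powr_powr)
  also have "sqrt 2 powr r = 2 powr (r / 2)" by (simp add: powr_half_sqrt[symmetric] powr_powr)
  finally show ?thesis by (simp add: normal_abs_moment_def)
qed

lemma khintchine_const_pos: "r > 1 \<Longrightarrow> khintchine_const r > 0"
proof -
  assume "r > 1"
  then have "Gamma ((r + 1) / 2) > 0" by (intro Gamma_real_pos) simp
  then show ?thesis by (simp add: khintchine_const_def)
qed

text \<open>For \<open>r > 2\<close> the sum is compared with signs and these with a normal
  variable; for \<open>r \<le> 2\<close> its variance is at most \<open>m\<close>, and
  \<open>x powr (r / 2)\<close> is concave. The rate is \<open>1 / sqrt m\<close> for every
  \<open>r\<close>.\<close>

lemma rff_pointwise_moment:
  fixes \<psi> :: "'a::euclidean_space \<Rightarrow> real"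
  assumes prob: "prob_space \<Lambda>" and borel[measurable_cong]: "sets \<Lambda> = sets borel"
    and bochner: "is_fourier_transform_of \<psi> \<Lambda>" and m: "m \<ge> 1" and r: "r > 1"
  shows "(\<integral>w. \<bar>rff_kernel m w x y - \<psi> (x - y)\<bar> powr r \<partial>(\<Pi>\<^sub>M i\<in>{1..m}. \<Lambda>)) \<le>
    (khintchine_const r / sqrt (real m)) powr r"
proof -
  define \<mu> where "\<mu> = \<psi> (x - y)"
  define Y where "Y \<omega> = cos (\<omega> \<bullet> (x - y))" for \<omega> :: 'a
  define D where "D w = (\<Sum>i\<in>{1..m}. Y (w i) - \<mu>)" for w
  interpret L: prob_space \<Lambda> by (rule prob)
  interpret P: prob_space "\<Pi>\<^sub>M i\<in>{1..m}. \<Lambda>" by (intro prob_space_PiM prob)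
  have [measurable]: "Y \<in> borel_measurable \<Lambda>" unfolding Y_def by measurable
  have EY: "(\<integral>\<omega>. Y \<omega> \<partial>\<Lambda>) = \<mu>"
    unfolding Y_def \<mu>_def by (rule is_fourier_transform_of_cos[OF prob borel bochner])
  have Y1: "\<bar>Y \<omega>\<bar> \<le> 1" for \<omega> by (simp add: Y_def)
  have \<mu>1: "\<bar>\<mu>\<bar> \<le> 1"
    unfolding EY[symmetric] by (intro L.abs_expectation_le_1 Y1 L.integrable_const_bound[where B = 1]) (use Y1 in auto)
  have mean: "integrable (\<Pi>\<^sub>M i\<in>{1..m}. \<Lambda>) (\<lambda>w. f (D w)) \<and>
      (\<integral>w. f (D w) \<partial>(\<Pi>\<^sub>M i\<in>{1..m}. \<Lambda>)) \<le> sign_sum_mean \<mu> m f"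
    if "convex_on UNIV f" "continuous_on UNIV f" "\<And>x. 0 \<le> f x" for f
    using integral_centered_sum_le_sign_sum_mean[OF prob _ Y1 EY that, of "{1..m}" 0] by (simp add: D_def)
  have rff: "rff_kernel m w x y - \<psi> (x - y) = D w / real m" for w
    using m by (simp add: rff_kernel_def D_def Y_def \<mu>_def sum_subtractf field_simps)
  have sum_moment: "(\<integral>w. \<bar>D w\<bar> powr r \<partial>(\<Pi>\<^sub>M i\<in>{1..m}. \<Lambda>)) \<le> real m powr (r / 2) * khintchine_const r powr r"
  proof (cases "r > 2")
    case True
    have "(\<integral>w. \<bar>D w\<bar> powr r \<partial>(\<Pi>\<^sub>M i\<in>{1..m}. \<Lambda>)) \<le> sign_sum_mean \<mu> m (\<lambda>x. \<bar>x\<bar> powr r)"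
    proof -
      have "continuous_on UNIV (\<lambda>x::real. \<bar>x\<bar> powr r)"
        using r by (intro continuous_on_powr') (auto intro!: continuous_intros)
      then show ?thesis using mean[of "\<lambda>x. \<bar>x\<bar> powr r"] r convex_on_abs_powr[of r] by simp
    qed
    also have "\<dots> \<le> real m powr (r / 2) * normal_abs_moment r"
      by (rule sign_sum_moment_le_normal[OF \<mu>1 m True])
    finally show ?thesis by (simp add: khintchine_const_powr[OF True])
  next
    case False
    have sq: "integrable (\<Pi>\<^sub>M i\<in>{1..m}. \<Lambda>) (\<lambda>w. (D w)\<^sup>2) \<and>
      (\<integral>w. (D w)\<^sup>2 \<partial>(\<Pi>\<^sub>M i\<in>{1..m}. \<Lambda>)) \<le> sign_sum_mean \<mu> m (\<lambda>x. x\<^sup>2)"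
      by (rule mean) (auto intro!: continuous_intros convex_power2)
    moreover have "sign_sum_mean \<mu> m (\<lambda>x. x\<^sup>2) \<le> real m"
      by (simp add: sign_sum_mean_power2 mult_left_le)
    ultimately have "(\<integral>w. (D w)\<^sup>2 powr (r / 2) \<partial>(\<Pi>\<^sub>M i\<in>{1..m}. \<Lambda>)) \<le> real m powr (r / 2)"
      using False r m by (intro P.expectation_powr_le) auto
    moreover have "(D w)\<^sup>2 powr (r / 2) = \<bar>D w\<bar> powr r" for w
    proof (cases "D w = 0")
      case False
      then have "(\<bar>D w\<bar> powr 2) powr (r / 2) = \<bar>D w\<bar> powr r" by (simp only: powr_powr) simp
      then show ?thesis using False by simp
    qed simp
    ultimately show ?thesis using False by (simp add: khintchine_const_def)
  qed
  have "(\<integral>w. \<bar>rff_kernel m w x y - \<psi> (x - y)\<bar> powr r \<partial>(\<Pi>\<^sub>M i\<in>{1..m}. \<Lambda>)) =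
      (\<integral>w. \<bar>D w\<bar> powr r \<partial>(\<Pi>\<^sub>M i\<in>{1..m}. \<Lambda>)) / real m powr r"
    unfolding rff by (simp add: powr_divide)
  also have "\<dots> \<le> real m powr (r / 2) * khintchine_const r powr r / real m powr r"
    using sum_moment by (rule divide_right_mono) simp
  also have "\<dots> = (khintchine_const r / sqrt (real m)) powr r"
  proof -
    have "sqrt (real m) powr r = real m powr (r / 2)" by (simp add: powr_half_sqrt[symmetric] powr_powr)
    moreover have "real m powr r = real m powr (r / 2) * real m powr (r / 2)" by (simp flip: powr_add)
    ultimately show ?thesis using m by (simp add: powr_divide)
  qed
  finally show ?thesis .
qed

lemma rff_kernel_upd_diff:
  assumes i: "i \<in> {1..m}"
  shows "\<bar>rff_kernel m (w(i := v)) x y - rff_kernel m w x y\<bar> \<le> 2 / real m"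
proof -
  have "(\<Sum>j=1..m. cos ((w(i := v)) j \<bullet> (x - y))) - (\<Sum>j=1..m. cos (w j \<bullet> (x - y))) =
      (\<Sum>j=1..m. if j = i then cos (v \<bullet> (x - y)) - cos (w i \<bullet> (x - y)) else 0)"
    unfolding sum_subtractf[symmetric] by (intro sum.cong) auto
  also have "\<dots> = cos (v \<bullet> (x - y)) - cos (w i \<bullet> (x - y))" using i by simp
  finally have "rff_kernel m (w(i := v)) x y - rff_kernel m w x y = (cos (v \<bullet> (x - y)) - cos (w i \<bullet> (x - y))) / real m"
    unfolding rff_kernel_def right_diff_distrib[symmetric] by simp
  moreover have "\<bar>cos (v \<bullet> (x - y)) - cos (w i \<bullet> (x - y))\<bar> \<le> 2"
    using cos_le_one[of "v \<bullet> (x - y)"] cos_ge_minus_one[of "v \<bullet> (x - y)"]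
      cos_le_one[of "w i \<bullet> (x - y)"] cos_ge_minus_one[of "w i \<bullet> (x - y)"] by linarith
  ultimately show ?thesis by (simp add: abs_div divide_right_mono)
qed

text \<open>Positive volume makes the difference constant \<open>c\<close> and the deviation
  \<open>\<epsilon>\<close> positive, as \<open>mcdiarmid\<close> demands. The free threshold
  \<open>t\<close> lets volume and rate be replaced by larger quantities afterwards.\<close>

lemma rff_deviation_volume:
  fixes \<psi> :: "'a::euclidean_space \<Rightarrow> real" and S :: "'a set"
  assumes prob: "prob_space \<Lambda>" and borel[measurable_cong]: "sets \<Lambda> = sets borel"
    and bochner: "is_fourier_transform_of \<psi> \<Lambda>" and \<psi>[measurable]: "\<psi> \<in> borel_measurable borel"
    and m: "m \<ge> 1" and r: "r > 1" and \<tau>: "\<tau> > 0"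
    and S[measurable]: "S \<in> sets borel" and fin: "emeasure lborel S < \<infinity>" and pos: "measure lborel S > 0"
    and t: "measure lborel S powr (2 / r) * (khintchine_const r / sqrt (real m) + sqrt (2 * \<tau>) / sqrt (real m)) \<le> t"
  shows "measure (\<Pi>\<^sub>M i\<in>{1..m}. \<Lambda>)
    {w \<in> space (\<Pi>\<^sub>M i\<in>{1..m}. \<Lambda>). Lr_norm r S (\<lambda>x y. rff_kernel m w x y - \<psi> (x - y)) \<ge> t} \<le> exp (- \<tau>)"
proof -
  define s where "s = measure lborel S"
  define \<kappa> where "\<kappa> = khintchine_const r"
  define P where "P = (\<Pi>\<^sub>M i\<in>{1..m}. \<Lambda>)"
  \<comment> \<open>Lebesgue measure on \<open>S\<close>, kept as a measure on the whole space so
    that no restricted sigma-algebra arises.\<close>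
  define N where "N = density lborel (\<lambda>x. ennreal (indicat_real S x))"
  have sN[measurable_cong, simp]: "sets N = sets borel" and spN[simp]: "space N = UNIV" by (auto simp: N_def)
  have s: "s > 0" using pos by (simp add: s_def)
  have eN: "emeasure N UNIV = ennreal s"
  proof -
    have "emeasure N UNIV = (\<integral>\<^sup>+x. ennreal (indicat_real S x) * indicator UNIV x \<partial>lborel)"
      unfolding N_def by (rule emeasure_density) auto
    also have "\<dots> = (\<integral>\<^sup>+x. indicator S x \<partial>lborel)" by (intro nn_integral_cong) (auto simp: indicator_def)
    also have "\<dots> = ennreal s" using fin by (simp add: s_def emeasure_eq_ennreal_measure less_top)
    finally show ?thesis .
  qed
  interpret L: prob_space \<Lambda> by (rule prob)
  interpret P: prob_space P unfolding P_def by (intro prob_space_PiM prob)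
  interpret N: finite_measure N by (rule finite_measureI) (simp add: eN)
  interpret NN: pair_sigma_finite N N ..
  interpret Q: finite_measure "N \<Otimes>\<^sub>M N" by (intro finite_measure_pair_measure N.finite_measure_axioms)
  interpret PQ: pair_sigma_finite P "N \<Otimes>\<^sub>M N" ..
  interpret R: finite_measure "P \<Otimes>\<^sub>M (N \<Otimes>\<^sub>M N)"
    by (intro finite_measure_pair_measure P.finite_measure_axioms Q.finite_measure_axioms)
  have spQ: "space (N \<Otimes>\<^sub>M N) = UNIV" by (simp add: space_pair_measure)
  have mQ: "measure (N \<Otimes>\<^sub>M N) UNIV = s\<^sup>2"
  proof -
    have "emeasure (N \<Otimes>\<^sub>M N) (UNIV \<times> UNIV) = ennreal s * ennreal s"
      unfolding eN[symmetric] by (rule N.emeasure_pair_measure_Times) auto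
    then show ?thesis using s by (simp add: Sigma_Algebra.measure_def power2_eq_square flip: ennreal_mult)
  qed
  \<comment> \<open>The first component of \<open>z\<close> is \<open>y\<close>, because
    \<open>Lr_norm\<close> integrates over \<open>x\<close> inside and over \<open>y\<close>
    outside.\<close>
  define F where "F w z = rff_kernel m w (snd z) (fst z) - \<psi> (snd z - fst z)" for w :: "nat \<Rightarrow> 'a" and z
  have Fm[measurable]: "(\<lambda>p. F (fst p) (snd p)) \<in> borel_measurable (P \<Otimes>\<^sub>M (N \<Otimes>\<^sub>M N))"
    unfolding F_def rff_kernel_def P_def by measurable
  have Fw[measurable]: "F w \<in> borel_measurable (N \<Otimes>\<^sub>M N)" for w
    unfolding F_def rff_kernel_def by measurable
  have \<psi>1: "\<bar>\<psi> z\<bar> \<le> 1" for z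
    unfolding is_fourier_transform_of_cos[OF prob borel bochner, symmetric]
    by (intro L.abs_expectation_le_1 L.integrable_const_bound[where B = 1]) auto
  have F2: "\<bar>F w z\<bar> \<le> 2" for w z
  proof -
    have "\<bar>\<Sum>i=1..m. cos (w i \<bullet> (snd z - fst z))\<bar> \<le> (\<Sum>i=1..m. 1)"
      by (intro order_trans[OF sum_abs] sum_mono) auto
    then have "\<bar>rff_kernel m w (snd z) (fst z)\<bar> \<le> 1"
      using m by (simp add: rff_kernel_def abs_mult field_simps)
    then show ?thesis using \<psi>1[of "snd z - fst z"] unfolding F_def by linarith
  qed
  have F2r: "\<bar>F w z\<bar> powr r \<le> 2 powr r" for w z using F2 r by (intro powr_mono2) auto
  have intQ: "integrable (N \<Otimes>\<^sub>M N) (\<lambda>z. \<bar>F w z\<bar> powr r)" for w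
    by (rule Q.integrable_const_bound[where B = "2 powr r"]) (use F2r in auto)
  have intR: "integrable (P \<Otimes>\<^sub>M (N \<Otimes>\<^sub>M N)) (\<lambda>(w, z). \<bar>F w z\<bar> powr r)"
    by (rule R.integrable_const_bound[where B = "2 powr r"]) (use F2r in \<open>auto simp: case_prod_beta'\<close>)
  define X where "X w = (\<integral>z. \<bar>F w z\<bar> powr r \<partial>(N \<Otimes>\<^sub>M N))" for w
  have X0: "0 \<le> X w" for w by (simp add: X_def)
  define f where "f w = X w powr (1 / r)" for w
  have Lr: "Lr_norm r S (\<lambda>x y. rff_kernel m w x y - \<psi> (x - y)) = f w" for w
  proof -
    have inner: "(LINT x:S|lborel. \<bar>rff_kernel m w x y - \<psi> (x - y)\<bar> powr r) = (\<integral>x. \<bar>F w (y, x)\<bar> powr r \<partial>N)" for y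
      unfolding N_def set_lebesgue_integral_def F_def fst_conv snd_conv
      by (subst integral_density) (auto simp: rff_kernel_def)
    have "(LINT y:S|lborel. (\<integral>x. \<bar>F w (y, x)\<bar> powr r \<partial>N)) = (\<integral>y. (\<integral>x. \<bar>F w (y, x)\<bar> powr r \<partial>N) \<partial>N)"
      unfolding set_lebesgue_integral_def
      by (subst (2) N_def, subst integral_density) (auto simp: F_def rff_kernel_def)
    also have "\<dots> = X w" unfolding X_def using NN.integral_fst'[OF intQ[of w]] .
    finally show ?thesis by (simp add: Lr_norm_def inner f_def)
  qed
  have Xm[measurable]: "X \<in> borel_measurable P"
  proof -
    have "sigma_finite_measure (N \<Otimes>\<^sub>M N)" by unfold_locales
    then show ?thesis
      unfolding X_def
      by (rule sigma_finite_measure.borel_measurable_lebesgue_integral) (use Fm in \<open>simp add: case_prod_beta'\<close>)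
  qed
  have fm: "f \<in> borel_measurable P" unfolding f_def by measurable
  define V where "V = (s\<^sup>2) powr (1 / r)"
  have V: "V > 0" using s by (simp add: V_def)
  have Vs: "V = s powr (2 / r)"
    using s by (simp add: V_def powr_powr flip: powr_numeral)
  have Xb: "X w \<le> 2 powr r * s\<^sup>2" for w
  proof -
    have "X w \<le> (\<integral>z. 2 powr r \<partial>(N \<Otimes>\<^sub>M N))"
      unfolding X_def using intQ F2r by (intro integral_mono) auto
    then show ?thesis by (simp add: spQ mQ mult.commute)
  qed
  have fb: "\<bar>f w\<bar> \<le> (2 powr r * s\<^sup>2) powr (1 / r)" for w
    using X0 Xb r by (auto simp: f_def intro!: powr_mono2)
  \<comment> \<open>A uniform change by \<open>2 / m\<close> changes the norm by at most that number
    times the norm of the constant 1, which is \<open>V\<close>.\<close>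
  define c where "c = 2 / real m * V"
  have c: "c > 0" using V m by (simp add: c_def)
  have step: "f w \<le> f w' + c" if "\<And>z. \<bar>F w z - F w' z\<bar> \<le> 2 / real m" for w w'
    unfolding f_def X_def c_def V_def mQ[symmetric] spQ[symmetric]
    using that r m s by (intro Q.powr_norm_le_add_const intQ) (auto simp: spQ mQ)
  have diff: "\<bar>f (w(i := v)) - f w\<bar> \<le> c" if i: "i \<in> {1..m}" for i w v
  proof -
    have "\<bar>F (w(i := v)) z - F w z\<bar> \<le> 2 / real m" for z
      using rff_kernel_upd_diff[OF i, of w v "snd z" "fst z"] unfolding F_def by linarith
    then show ?thesis using step[of "w(i := v)" w] step[of w "w(i := v)"] by (simp add: abs_le_iff abs_minus_commute)
  qed
  have \<kappa>: "\<kappa> > 0" using khintchine_const_pos[OF r] by (simp add: \<kappa>_def)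
  have Ef: "(\<integral>w. f w \<partial>P) \<le> V * (\<kappa> / sqrt (real m))"
  proof -
    define b where "b = (\<kappa> / sqrt (real m)) powr r"
    \<comment> \<open>Fubini reduces to the moment bound at single pairs of points; Jensen for the
      root follows below.\<close>
    have "(\<integral>w. X w \<partial>P) = (\<integral>z. (\<integral>w. \<bar>F w z\<bar> powr r \<partial>P) \<partial>(N \<Otimes>\<^sub>M N))"
      unfolding X_def by (rule PQ.Fubini_integral[OF intR, symmetric])
    also have "\<dots> \<le> (\<integral>z. b \<partial>(N \<Otimes>\<^sub>M N))"
    proof (rule integral_mono)
      show "integrable (N \<Otimes>\<^sub>M N) (\<lambda>z. \<integral>w. \<bar>F w z\<bar> powr r \<partial>P)"
        using PQ.integrable_snd[OF intR] by simp
      show "(\<integral>w. \<bar>F w z\<bar> powr r \<partial>P) \<le> b" for z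
        unfolding F_def P_def b_def \<kappa>_def by (rule rff_pointwise_moment[OF prob borel bochner m r])
    qed auto
    finally have EX: "(\<integral>w. X w \<partial>P) \<le> s\<^sup>2 * b" by (simp add: spQ mQ)
    have Xi: "integrable P X"
      unfolding X_def using PQ.integrable_fst[OF intR] by simp
    have "(\<integral>w. f w \<partial>P) \<le> (s\<^sup>2 * b) powr (1 / r)"
      unfolding f_def using Xi X0 EX r s m \<kappa> by (intro P.expectation_powr_le) (auto simp: b_def)
    also have "\<dots> = V * (\<kappa> / sqrt (real m))"
      using r \<kappa> by (simp add: V_def b_def powr_mult powr_powr)
    finally show ?thesis .
  qed
  define \<epsilon> where "\<epsilon> = V * (sqrt (2 * \<tau>) / sqrt (real m))"
  have \<epsilon>: "\<epsilon> > 0" using V \<tau> m by (simp add: \<epsilon>_def)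
  have le_t: "(\<integral>w. f w \<partial>P) + \<epsilon> \<le> t"
    using Ef t unfolding s_def[symmetric] \<kappa>_def[symmetric] Vs[symmetric] distrib_left \<epsilon>_def by linarith
  have "measure P {w \<in> space P. f w \<ge> t} \<le> measure P {w \<in> space P. f w \<ge> (\<integral>w. f w \<partial>P) + \<epsilon>}"
  proof (rule P.finite_measure_mono)
    show "{w \<in> space P. f w \<ge> t} \<subseteq> {w \<in> space P. f w \<ge> (\<integral>w. f w \<partial>P) + \<epsilon>}"
      using le_t by auto
    show "{w \<in> space P. f w \<ge> (\<integral>w. f w \<partial>P) + \<epsilon>} \<in> sets P"
      using fm by measurable
  qed
  also have "\<dots> \<le> exp (- (2 * \<epsilon>\<^sup>2 / (real (card {1..m}) * c\<^sup>2)))"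
    unfolding P_def using m c \<epsilon> fm fb diff
    by (intro mcdiarmid[OF prob]) (auto simp: P_def)
  \<comment> \<open>\<open>m * c\<^sup>2\<close> equals \<open>4 * V\<^sup>2 / m\<close>, and
    \<open>2 * \<epsilon>\<^sup>2\<close> is \<open>\<tau>\<close> times the same number.\<close>
  also have "2 * \<epsilon>\<^sup>2 / (real (card {1..m}) * c\<^sup>2) = \<tau>"
    using V m \<tau> by (simp add: \<epsilon>_def c_def power_mult_distrib power_divide) (simp add: power2_eq_square field_simps)
  finally show ?thesis
    unfolding Lr P_def[symmetric] .
qed

theorem theorem3:
  fixes k :: "real ^ 'n \<Rightarrow> real ^ 'n \<Rightarrow> real"
    and \<psi> :: "real ^ 'n \<Rightarrow> real"
    and \<Lambda> :: "(real ^ 'n) measure"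
    and S :: "(real ^ 'n) set"
    and m d :: nat
    and r \<tau> :: real
  assumes d: "d = CARD('n)"
    and k: "\<And>x y. k x y = \<psi> (x - y)"
    and bounded: "bounded (range \<psi>)"
    and continuous: "continuous_on UNIV \<psi>"
    and pos_def: "positive_definite_fun \<psi>"
    and \<psi>_0: "\<psi> 0 = 1"
    and prob: "prob_space \<Lambda>"
    and borel: "sets \<Lambda> = sets borel"
    and bochner: "is_fourier_transform_of \<psi> \<Lambda>"
    and m: "m \<ge> 1"
    and r: "1 < r"
    and \<tau>: "\<tau> > 0"
    and S: "S \<noteq> {}" "compact S"
    (* for a singleton S both sides of the inequality in the event are 0 and the claim fails *)
    and S_diameter: "diameter S > 0"
  shows "measure (\<Pi>\<^sub>M i\<in>{1..m}. \<Lambda>)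
           {w \<in> space (\<Pi>\<^sub>M i\<in>{1..m}. \<Lambda>).
              Lr_norm r S (\<lambda>x y. rff_kernel m w x y - k x y) \<ge>
                (pi powr (real d / 2) * diameter S ^ d / (2 ^ d * Gamma (real d / 2 + 1)))
                  powr (2 / r) *
                (khintchine_const r / real m powr (1 - max (1 / 2) (1 / r)) +
                 sqrt (2 * \<tau>) / sqrt (real m))}
         \<le> exp (- \<tau>)"
proof -
  define s where "s = measure lborel S"
  define V where "V = pi powr (real d / 2) * diameter S ^ d / (2 ^ d * Gamma (real d / 2 + 1))"
  define T where "T = khintchine_const r / real m powr (1 - max (1 / 2) (1 / r)) + sqrt (2 * \<tau>) / sqrt (real m)"
  define T0 where "T0 = khintchine_const r / sqrt (real m) + sqrt (2 * \<tau>) / sqrt (real m)"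
  interpret P: prob_space "\<Pi>\<^sub>M i\<in>{1..m}. \<Lambda>" by (intro prob_space_PiM prob)
  have V: "V > 0" using S_diameter by (simp add: V_def Gamma_real_pos)
  have Sb: "S \<in> sets borel" using S by (simp add: borel_closed compact_imp_closed)
  have fin: "emeasure lborel S < \<infinity>" using S by (intro emeasure_bounded_finite compact_imp_bounded)
  have \<kappa>: "khintchine_const r > 0" by (rule khintchine_const_pos[OF r])
  \<comment> \<open>The isodiametric inequality: \<open>V\<close> is the volume of a ball with the
    diameter of \<open>S\<close>.\<close>
  have sV: "s \<le> V"
  proof -
    have "emeasure lborel S \<le> ennreal (unit_ball_vol (DIM(real ^ 'n)) * (diameter S / 2) ^ DIM(real ^ 'n))"
      using Sb S_diameter diameter_bounded_bound[OF compact_imp_bounded[OF S(2)]]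
      by (intro isodiametric_inequality) auto
    also have "unit_ball_vol (DIM(real ^ 'n)) * (diameter S / 2) ^ DIM(real ^ 'n) = V"
      by (simp add: V_def d unit_ball_vol_def power_divide)
    finally show ?thesis
      using V fin by (simp add: s_def emeasure_eq_ennreal_measure less_top)
  qed
  \<comment> \<open>The exponent \<open>1 - max (1 / 2) (1 / r)\<close> is at most
    \<open>1 / 2\<close>, so the claimed threshold is at least the proved one, with equality for
    \<open>r \<ge> 2\<close>.\<close>
  have T: "T0 \<le> T" "T0 > 0"
  proof -
    have "real m powr (1 - max (1 / 2) (1 / r)) \<le> real m powr (1 / 2)"
      using m by (intro powr_mono) auto
    also have "\<dots> = sqrt (real m)" by (simp add: powr_half_sqrt)
    finally have "khintchine_const r / sqrt (real m) \<le> khintchine_const r / real m powr (1 - max (1 / 2) (1 / r))"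
      using \<kappa> m by (intro divide_left_mono) auto
    then show "T0 \<le> T" by (simp add: T_def T0_def)
    show "T0 > 0" using \<kappa> m \<tau> by (simp add: T0_def add_pos_pos)
  qed
  show ?thesis
    unfolding k V_def[symmetric] T_def[symmetric]
  proof (cases "s > 0")
    case True
    have "s powr (2 / r) * T0 \<le> V powr (2 / r) * T"
      using True sV r T by (intro mult_mono powr_mono2) auto
    then show "measure (\<Pi>\<^sub>M i\<in>{1..m}. \<Lambda>) {w \<in> space (\<Pi>\<^sub>M i\<in>{1..m}. \<Lambda>).
          Lr_norm r S (\<lambda>x y. rff_kernel m w x y - \<psi> (x - y)) \<ge> V powr (2 / r) * T} \<le> exp (- \<tau>)"
      using True unfolding T0_def s_def
      by (intro rff_deviation_volume[OF prob borel bochner borel_measurable_continuous_onI[OF continuous] m r \<tau> Sb fin])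
  next
    \<comment> \<open>On a null set the norm is 0 for every sample while the threshold is strictly
      positive, so the event is empty.\<close>
    case False
    then have "emeasure lborel S = 0"
      using fin measure_nonneg[of lborel S] by (simp add: s_def emeasure_eq_ennreal_measure less_top)
    then have "AE y in lborel. y \<notin> S" using Sb by (intro AE_not_in) (auto simp: null_sets_def)
    then have "Lr_norm r S g = 0" for g
    proof -
      have "(LINT y:S|lborel. h y) = 0" for h :: "real ^ 'n \<Rightarrow> real"
        unfolding set_lebesgue_integral_def
        using \<open>AE y in lborel. y \<notin> S\<close> by (intro integral_eq_zero_AE) (auto elim!: eventually_mono)
      then show ?thesis by (simp add: Lr_norm_def)
    qed
    moreover have "V powr (2 / r) * T > 0" using V T by simp
    ultimately show "measure (\<Pi>\<^sub>M i\<in>{1..m}. \<Lambda>) {w \<in> space (\<Pi>\<^sub>M i\<in>{1..m}. \<Lambda>).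
          Lr_norm r S (\<lambda>x y. rff_kernel m w x y - \<psi> (x - y)) \<ge> V powr (2 / r) * T} \<le> exp (- \<tau>)"
      by simp
  qed
qed

end
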